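(* Let the setting, the CDGARCH variance equation and the notion of strong solution be as in the context, and suppose: (i) the initial process $\Phi$ (càdlàg on $[-r,0]$) is adapted to the natural filtration of $L$ and satisfies $\|\Phi\|_0<\infty$; (ii) $\mathbb E[L_1^4]<\infty$ (so that $S=[L,L]$ is square integrable). Then: (a) there exists a unique strong solution $X$ to the CDGARCH variance equation with initial condition $\Phi$; (b) for every $\alpha\in[0,2]$, the function $t\mapsto \mathbb E[|X_t|^\alpha]$ is finite valued and càdlàg.
   Context: Let $p,q\ge 0$, $r:=p\vee q>0$. Let $(\Omega,\mathcal F,\mathbb F=(\mathcal F_t)_{t\ge -r},\mathbb P)$ be a filtered probability space satisfying the usual conditions, supporting a càdlàg $\mathbb F$-adapted Lévy process $(L_t)_{t\ge -r}$ with $L_{-r}=0$, such that for $-r\le s<t$, $L_t-L_s$ is independent of $\mathcal F_s$ and has the law of $L_{t-s-r}$. Assume $L$ is centered and square integrable (its Lévy measure $\Pi_L$ has finite second moment), so $L_t=\sigma_L B_t+\int_{-r}^t\int_{\mathbb R\setminus\{0\}} z\,\widetilde N(dz,ds)$, where $B$ is a standard $\mathbb F$-Brownian motion with $B_{-r}=0$, $\sigma_L\ge 0$, $N$ is the jump measure of $L$ and $\widetilde N(dz,dt)=N(dz,dt)-\Pi_L(dz)dt$. Let $S=[L,L]$, i.e. $S_t=\sigma_L^2(t+r)+\int_{-r}^t\int z^2N(dz,ds)$. Parameters: $\eta>0$, $c_\mu,c_\nu>0$, $f_\mu,f_\nu$ nonnegative continuous functions supported on $[-p,0]$ and $[-q,0]$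 respectively; signed measures $\mu(E)=\int_{E\cap[-p,0]}f_\mu(u)\,du-c_\mu\delta_0(E)$, $\nu(E)=\int_{E\cap[-q,0]}f_\nu(u)\,du+c_\nu\delta_0(E)$ on Borel subsets of $[-r,0]$. Given a càdlàg adapted process $\Phi$ on $[-r,0]$, extend it by $\Phi_t=\Phi_0$ for $t>0$ and set $\theta_t=\Phi_t+\eta t\mathbf 1_{[0,\infty)}(t)$. CDGARCH variance equation: $X_t=\theta_t+\int_{-p}^0\int_u^{t+u}X_s\,ds\,\mu(du)+\int_{-q}^0\int_{u+}^{t+u}X_{s-}\,dS_s\,\nu(du)$ for $t\ge 0$, with $X_u=\Phi_u$ on $[-r,0]$. For a càdlàg process $Z$ on $[-r,\infty)$, $\|Z\|_t:=(\mathbb E[\sup_{s\in[-r,t]}|Z_s|^2])^{1/2}$; $\mathcal S^2$ is the class of càdlàg processes on $[-r,\infty)$ with $\|Z\|_t<\infty$ for every $t\ge -r$. A strong solution with initial condition $\Phi$ is a process $X\in\mathcal S^2$, adapted to $\mathbb F$, with $X|_{[-r,0]}=\Phi$, satisfying the variance equation on $(0,\infty)$. *)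

theory Defs
  imports "HOL-Probability.Probability"
begin

definition cadlag_from :: "real \<Rightarrow> (real \<Rightarrow> real) \<Rightarrow> bool" where
  "cadlag_from a f \<longleftrightarrow>
     (\<forall>t\<ge>a. continuous (at_right t) f) \<and> (\<forall>t>a. \<exists>l. (f \<longlongrightarrow> l) (at_left t))"

definition cadlag_on :: "real \<Rightarrow> real \<Rightarrow> (real \<Rightarrow> real) \<Rightarrow> bool" where
  "cadlag_on a b f \<longleftrightarrow>
     (\<forall>t\<in>{a..<b}. continuous (at_right t) f) \<and> (\<forall>t\<in>{a<..b}. \<exists>l. (f \<longlongrightarrow> l) (at_left t))"

definition left_lim :: "(real \<Rightarrow> real) \<Rightarrow> real \<Rightarrow> real" where
  "left_lim f s = Lim (at_left s) f"

definition usual_filtration :: "'a measure \<Rightarrow> real \<Rightarrow> (real \<Rightarrow> 'a measure) \<Rightarrow> bool" where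
  "usual_filtration M r0 F \<longleftrightarrow>
     (\<forall>t\<ge>r0. subalgebra M (F t)) \<and>
     (\<forall>s t. r0 \<le> s \<longrightarrow> s \<le> t \<longrightarrow> sets (F s) \<subseteq> sets (F t)) \<and>
     (\<forall>t\<ge>r0. sets (F t) = (\<Inter>u\<in>{t<..}. sets (F u))) \<and>
     (\<forall>N. N \<subseteq> space M \<and> (\<exists>N'\<in>null_sets M. N \<subseteq> N') \<longrightarrow> N \<in> sets (F r0))"

definition adapted_from :: "real \<Rightarrow> (real \<Rightarrow> 'a measure) \<Rightarrow> (real \<Rightarrow> 'a \<Rightarrow> real) \<Rightarrow> bool" where
  "adapted_from r0 F X \<longleftrightarrow> (\<forall>t\<ge>r0. X t \<in> borel_measurable (F t))"

definition levy_process_from ::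
  "'a measure \<Rightarrow> real \<Rightarrow> (real \<Rightarrow> 'a measure) \<Rightarrow> (real \<Rightarrow> 'a \<Rightarrow> real) \<Rightarrow> bool" where
  "levy_process_from M r0 F L \<longleftrightarrow>
     (\<forall>\<omega>\<in>space M. L r0 \<omega> = 0) \<and>
     (\<forall>\<omega>\<in>space M. cadlag_from r0 (\<lambda>t. L t \<omega>)) \<and>
     adapted_from r0 F L \<and>
     (\<forall>s t. r0 \<le> s \<longrightarrow> s < t \<longrightarrow>
        (\<forall>A\<in>sets (F s). \<forall>B\<in>sets borel.
           measure M (A \<inter> ((\<lambda>\<omega>. L t \<omega> - L s \<omega>) -` B \<inter> space M))
             = measure M A * measure M ((\<lambda>\<omega>. L t \<omega> - L s \<omega>) -` B \<inter> space M)) \<and>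
        distr M borel (\<lambda>\<omega>. L t \<omega> - L s \<omega>) = distr M borel (L (t - s + r0)))"

definition natural_filtration :: "'a measure \<Rightarrow> real \<Rightarrow> (real \<Rightarrow> 'a \<Rightarrow> real) \<Rightarrow> real \<Rightarrow> 'a measure" where
  "natural_filtration M r0 L t =
     sigma (space M) (\<Union>s\<in>{r0..t}. {L s -` B \<inter> space M | B. B \<in> sets borel})"

definition jumpsq :: "(real \<Rightarrow> 'a \<Rightarrow> real) \<Rightarrow> 'a \<Rightarrow> real \<Rightarrow> real \<Rightarrow> real" where
  "jumpsq L \<omega> a b = (\<Sum>\<^sub>\<infinity> s\<in>{a<..b}. (L s \<omega> - left_lim (\<lambda>u. L u \<omega>) s)\<^sup>2)"

text \<open>Gaussian variance sigma_L^2 of the (centred, square integrable) Levy process,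
  recovered as E[(L(r0+1))^2] - E[sum of squared jumps on (r0, r0+1]]
  (= (sigma_L^2 + int z^2 Pi_L(dz)) - int z^2 Pi_L(dz)).\<close>
definition gauss_var :: "'a measure \<Rightarrow> real \<Rightarrow> (real \<Rightarrow> 'a \<Rightarrow> real) \<Rightarrow> real" where
  "gauss_var M r0 L =
     (\<integral>\<omega>. (L (r0 + 1) \<omega>)\<^sup>2 \<partial>M) - (\<integral>\<omega>. jumpsq L \<omega> r0 (r0 + 1) \<partial>M)"

text \<open>Path of S = [L,L]: S t = sigma_L^2 (t - r0) + sum_{r0 < s <= t} (Delta L s)^2,
  extended by 0 to t < r0.\<close>
definition qv_path :: "'a measure \<Rightarrow> real \<Rightarrow> (real \<Rightarrow> 'a \<Rightarrow> real) \<Rightarrow> 'a \<Rightarrow> real \<Rightarrow> real" where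
  "qv_path M r0 L \<omega> t = gauss_var M r0 L * max 0 (t - r0) + jumpsq L \<omega> r0 t"

definition sup_norm2 :: "'a measure \<Rightarrow> real \<Rightarrow> (real \<Rightarrow> 'a \<Rightarrow> real) \<Rightarrow> real \<Rightarrow> ennreal" where
  "sup_norm2 M r0 Z t = (\<integral>\<^sup>+ \<omega>. (SUP s\<in>{r0..t}. ennreal ((Z s \<omega>)\<^sup>2)) \<partial>M)"

definition abs_pow :: "real \<Rightarrow> real \<Rightarrow> real" where
  "abs_pow x \<alpha> = (if \<alpha> = 0 then 1 else \<bar>x\<bar> powr \<alpha>)"

text \<open>Strong solution of the CDGARCH variance equation with parameters
  p q eta c_mu c_nu f_mu f_nu, with r = max p q, initial condition Phi.
  mu = f_mu du on [-p,0] - c_mu delta_0, nu = f_nu du on [-q,0] + c_nu delta_0,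
  theta t = Phi 0 + eta t for t >= 0, and the dS-integrals are pathwise
  Lebesgue-Stieltjes integrals w.r.t. the increasing path of S = [L,L].\<close>
definition cdgarch_strong_solution ::
  "'a measure \<Rightarrow> (real \<Rightarrow> 'a measure) \<Rightarrow> (real \<Rightarrow> 'a \<Rightarrow> real) \<Rightarrow>
   real \<Rightarrow> real \<Rightarrow> real \<Rightarrow> real \<Rightarrow> real \<Rightarrow> (real \<Rightarrow> real) \<Rightarrow> (real \<Rightarrow> real) \<Rightarrow>
   (real \<Rightarrow> 'a \<Rightarrow> real) \<Rightarrow> (real \<Rightarrow> 'a \<Rightarrow> real) \<Rightarrow> bool" where
  "cdgarch_strong_solution M F L p q \<eta> c\<^sub>\<mu> c\<^sub>\<nu> f\<^sub>\<mu> f\<^sub>\<nu> \<Phi> X \<longleftrightarrow>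
     (let r = max p q; S = qv_path M (- r) L in
       (\<forall>\<omega>\<in>space M. cadlag_from (- r) (\<lambda>t. X t \<omega>)) \<and>
       (\<forall>t\<ge>- r. sup_norm2 M (- r) X t < \<infinity>) \<and>
       adapted_from (- r) F X \<and>
       (\<forall>\<omega>\<in>space M. \<forall>t\<in>{- r..0}. X t \<omega> = \<Phi> t \<omega>) \<and>
       (AE \<omega> in M. \<forall>t>0.
          X t \<omega> = \<Phi> 0 \<omega> + \<eta> * t
            + (LINT u:{- p..0}|lborel. f\<^sub>\<mu> u * (LINT s:{u..t + u}|lborel. X s \<omega>))
            - c\<^sub>\<mu> * (LINT s:{0..t}|lborel. X s \<omega>)
            + (LINT u:{- q..0}|lborel. f\<^sub>\<nu> u *
                 (LINT s:{u<..t + u}|interval_measure (S \<omega>). left_lim (\<lambda>v. X v \<omega>) s))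
            + c\<^sub>\<nu> * (LINT s:{0<..t}|interval_measure (S \<omega>). left_lim (\<lambda>v. X v \<omega>) s)))"

end

theory Submission
  imports Defs
begin

text \<open>
  The path of \<open>S = [L,L]\<close> is increasing, so all integrals are pathwise and the equation is a linear fixed point
  equation, solved by Picard iteration in the norm \<open>E sup |Z|\<^sup>2\<close>. What has to be shown is a contraction
  estimate. Comparing the squared jumps of \<open>L\<close> with the squared increments along fine partitions (Fatou) and
  using that \<open>h \<mapsto> E[(L\<^sub>t\<^sub>+\<^sub>h - L\<^sub>t)\<^sup>2]\<close> and \<open>h \<mapsto> E[(L\<^sub>t\<^sub>+\<^sub>h - L\<^sub>t)^4]\<close> are superadditive, hence \<open>O(h)\<close>,
  one obtains \<open>E[Y (S\<^sub>t - S\<^sub>s)^k] \<le> C (t - s) E[Y]\<close> for \<open>k = 1, 2\<close> and nonnegative \<open>F\<^sub>s\<close>-measurable \<open>Y\<close>.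
  For left-point Riemann sums this gives a discrete Gronwall inequality, so that
  \<open>E[H\<^sub>s\<^sup>2] \<le> B exp (\<beta> s)\<close> implies \<open>E[(\<integral> H\<^sub>s\<^sub>- dS\<^sub>s)\<^sup>2] \<le> (K / \<beta>) B exp (\<beta> t)\<close>; for large \<open>\<beta>\<close> this is a
  contraction, which yields existence and uniqueness. Lebesgue measure is handled as the clock \<open>t \<mapsto> t\<close>.
  The moment functions are then cadlag by dominated convergence.
\<close>

section \<open>Cadlag paths\<close>

text \<open>Three obstacles shape the development. The delay windows (u, t + u] move at both ends,
  but each lies in (-r, t]; so the delayed terms are dominated by a single integral of the running
  supremum over the whole past. This majorant is nondecreasing in t, hence a bound at each time is
  at once a bound for the supremum, and a second moment at one fixed time controls the norm. Next,
  the integrands are left limits, so the integrals are limits of left-point sums in which each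
  increment of the clock meets a factor known before it; independence of increments then acts one
  grid cell at a time. Finally, the squared jumps are summable only almost surely. On the
  exceptional null set the clock is replaced by t, the usual conditions keep it adapted, and every
  path of the clock is then a genuine Stieltjes path. The fourth moment, given at one time, is
  spread to all times by doubling upwards and by convexity downwards.\<close>

lemma left_lim_eqI: "(f \<longlongrightarrow> l) (at_left s) \<Longrightarrow> left_lim f s = l"
  unfolding left_lim_def by (rule tendsto_Lim) simp_all

lemma cadlag_on_tendsto_left_lim:
  assumes "cadlag_on a b f" "s \<in> {a<..b}"
  shows "(f \<longlongrightarrow> left_lim f s) (at_left s)"
  using assms left_lim_eqI unfolding cadlag_on_def by metis

lemma cadlag_from_imp_on:
  assumes "cadlag_from a f" "a \<le> c"
  shows "cadlag_on c d f"
  using assms unfolding cadlag_on_def cadlag_from_def by auto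

text \<open>Compactness, through the bisection principle: near a point x, right continuity and the
  left limit keep f within e/2 of a constant on either side, so only x itself has to enter
  \<open>E\<close>. The intervals are open at the left end because a jump at the starting point does
  not contribute to the difference of the values.\<close>

lemma cadlag_on_oscillation:
  assumes f: "cadlag_on a b f" and ab: "a \<le> b" and e: "0 < (e::real)"
  obtains E where "finite E"
    "\<And>x y. a \<le> x \<Longrightarrow> x \<le> y \<Longrightarrow> y \<le> b \<Longrightarrow> E \<inter> {x<..y} = {} \<Longrightarrow> \<bar>f y - f x\<bar> \<le> e"
proof -
  \<comment> \<open>Clipped to [a, b], because the bisection principle tests small intervals that
    may stick out of it.\<close>
  define P where "P c d \<longleftrightarrow> (\<exists>E. finite E \<and> (\<forall>x y. max a c \<le> x \<longrightarrow> x \<le> y \<longrightarrow> y \<le> min b d \<longrightarrow>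
     E \<inter> {x<..y} = {} \<longrightarrow> \<bar>f y - f x\<bar> \<le> e))" for c d
  have "P a b"
    using ab
  proof (induct rule: Bolzano)
    case (trans c1 c2 c3)
    then obtain E1 E2 where E: "finite E1" "finite E2"
      "\<And>x y. max a c1 \<le> x \<Longrightarrow> x \<le> y \<Longrightarrow> y \<le> min b c2 \<Longrightarrow> E1 \<inter> {x<..y} = {} \<Longrightarrow> \<bar>f y - f x\<bar> \<le> e"
      "\<And>x y. max a c2 \<le> x \<Longrightarrow> x \<le> y \<Longrightarrow> y \<le> min b c3 \<Longrightarrow> E2 \<inter> {x<..y} = {} \<Longrightarrow> \<bar>f y - f x\<bar> \<le> e"
      unfolding P_def by blast
    \<comment> \<open>With the common end point c2 in the exceptional set, no admissible interval
      straddles it.\<close>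
    have "\<bar>f y - f x\<bar> \<le> e" if xy: "max a c1 \<le> x" "x \<le> y" "y \<le> min b c3"
      "insert c2 (E1 \<union> E2) \<inter> {x<..y} = {}" for x y
    proof (cases "y < c2")
      case True
      then show ?thesis using xy by (intro E(3)) auto
    next
      case False
      then have "c2 \<le> x" using xy by auto
      then show ?thesis using xy by (intro E(4)) auto
    qed
    then show ?case unfolding P_def using E(1,2)
      by (intro exI[of _ "insert c2 (E1 \<union> E2)"]) auto
  next
    case (local x)
    have "\<exists>d>0. \<forall>y. x \<le> y \<and> y < x + d \<and> y \<le> b \<longrightarrow> \<bar>f y - f x\<bar> < e/2"
    proof (cases "x < b")
      case True
      then have "(f \<longlongrightarrow> f x) (at_right x)"
        using f local unfolding cadlag_on_def continuous_within by auto
      then have "eventually (\<lambda>y. dist (f y) (f x) < e/2) (at_right x)"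
        using e by (intro tendstoD) auto
      then obtain c where c: "c > x" "\<forall>y>x. y < c \<longrightarrow> dist (f y) (f x) < e/2"
        unfolding eventually_at_right_field by auto
      have "\<bar>f y - f x\<bar> < e/2" if "x \<le> y" "y < x + (c - x)" for y
        using c(2) that e by (cases "y = x") (auto simp: dist_real_def)
      then show ?thesis using c(1) by (intro exI[of _ "c - x"]) auto
    next
      case False
      then show ?thesis using local e by (intro exI[of _ 1]) (auto dest!: antisym)
    qed
    then obtain d1 where d1: "d1 > 0" "\<And>y. x \<le> y \<Longrightarrow> y < x + d1 \<Longrightarrow> y \<le> b \<Longrightarrow> \<bar>f y - f x\<bar> < e/2"
      by blast
    have "\<exists>d>0. \<exists>l. \<forall>y. y < x \<and> x - d < y \<and> a \<le> y \<longrightarrow> \<bar>f y - l\<bar> < e/2"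
    proof (cases "a < x")
      case True
      then obtain l where "(f \<longlongrightarrow> l) (at_left x)"
        using f local unfolding cadlag_on_def by (meson greaterThanAtMost_iff)
      then have "eventually (\<lambda>y. dist (f y) l < e/2) (at_left x)"
        using e by (intro tendstoD) auto
      then obtain c where c: "c < x" "\<forall>y>c. y < x \<longrightarrow> dist (f y) l < e/2"
        unfolding eventually_at_left_field by auto
      then show ?thesis by (intro exI[of _ "x - c"] conjI exI[of _ l]) (auto simp: dist_real_def)
    next
      case False
      then show ?thesis by (intro exI[of _ 1]) auto
    qed
    then obtain d2 l where d2: "d2 > 0" "\<And>y. y < x \<Longrightarrow> x - d2 < y \<Longrightarrow> a \<le> y \<Longrightarrow> \<bar>f y - l\<bar> < e/2"
      by blast
    have "P c1 c2" if c: "c1 \<le> x" "x \<le> c2" "c2 - c1 < min d1 d2" for c1 c2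
      unfolding P_def
    proof (intro exI[of _ "{x}"] conjI allI impI)
      fix y z assume yz: "max a c1 \<le> y" "y \<le> z" "z \<le> min b c2" "{x} \<inter> {y<..z} = {}"
      then consider "x \<le> y" | "z < x" by fastforce
      then show "\<bar>f z - f y\<bar> \<le> e"
      proof cases
        case 1
        have "\<bar>f z - f x\<bar> < e/2" "\<bar>f y - f x\<bar> < e/2" using 1 yz c by (auto intro!: d1(2) simp del: less_divide_eq_numeral1)
        then show ?thesis by linarith
      next
        case 2
        have "\<bar>f z - l\<bar> < e/2" "\<bar>f y - l\<bar> < e/2" using 2 yz c by (auto intro!: d2(2) simp del: less_divide_eq_numeral1)
        then show ?thesis by linarith
      qed
    qed simp
    then show ?case using d1(1) d2(1) by (intro exI[of _ "min d1 d2"]) auto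
  qed
  then show ?thesis using that unfolding P_def by auto
qed

text \<open>Each x lies within 1 of the value at the last exceptional point not after it. The left
  end a is added to these points so that there always is one; the sum of their finitely many
  absolute values then bounds all of them.\<close>

lemma cadlag_on_bounded:
  assumes f: "cadlag_on a b f"
  obtains B where "0 \<le> B" "\<And>x. x \<in> {a..b} \<Longrightarrow> \<bar>f x\<bar> \<le> B"
proof (cases "a \<le> b")
  case False
  then show ?thesis using that[of 0] by auto
next
  case True
  obtain E where E: "finite E"
    "\<And>x y. a \<le> x \<Longrightarrow> x \<le> y \<Longrightarrow> y \<le> b \<Longrightarrow> E \<inter> {x<..y} = {} \<Longrightarrow> \<bar>f y - f x\<bar> \<le> 1"
    using cadlag_on_oscillation[OF f True, of 1] by auto
  define B where "B = 1 + (\<Sum>e\<in>insert a E. \<bar>f e\<bar>)"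
  have "\<bar>f x\<bar> \<le> B" if x: "x \<in> {a..b}" for x
  proof -
    define A where "A = insert a E \<inter> {a..x}"
    have A: "finite A" "a \<in> A" using E x by (auto simp: A_def)
    have m: "Max A \<in> A" using A by (intro Max_in) auto
    have "\<bar>f x - f (Max A)\<bar> \<le> 1"
    proof (rule E(2))
      have "Max A \<in> {a..x}" using m unfolding A_def by blast
      then show "a \<le> Max A" "Max A \<le> x" by auto
      have "z \<in> A" if "z \<in> E" "Max A < z" "z \<le> x" for z
        unfolding A_def using that \<open>a \<le> Max A\<close> by auto
      then show "E \<inter> {Max A<..x} = {}" using Max_ge[OF A(1)] by fastforce
    qed (use x in auto)
    moreover have "\<bar>f (Max A)\<bar> \<le> (\<Sum>e\<in>insert a E. \<bar>f e\<bar>)"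
      using m E(1) by (intro member_le_sum) (auto simp: A_def)
    ultimately show ?thesis unfolding B_def by linarith
  qed
  moreover have "0 \<le> B" unfolding B_def by (intro add_nonneg_nonneg sum_nonneg) auto
  ultimately show ?thesis using that by blast
qed

lemma cadlag_jump_small:
  assumes f: "cadlag_on a b f" and E: "finite E"
    "\<And>x y. a \<le> x \<Longrightarrow> x \<le> y \<Longrightarrow> y \<le> b \<Longrightarrow> E \<inter> {x<..y} = {} \<Longrightarrow> \<bar>f y - f x\<bar> \<le> e"
    and s: "s \<in> {a<..b}" "s \<notin> E"
  shows "\<bar>f s - left_lim f s\<bar> \<le> e"
proof (rule tendsto_upperbound)
  show "((\<lambda>x. \<bar>f s - f x\<bar>) \<longlongrightarrow> \<bar>f s - left_lim f s\<bar>) (at_left s)"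
    by (intro tendsto_intros cadlag_on_tendsto_left_lim[OF f s(1)])
  have "eventually (\<lambda>x. \<forall>z\<in>E. z \<notin> {x<..s}) (at_left s)"
  proof (intro eventually_ball_finite E(1) ballI)
    fix z assume "z \<in> E"
    then consider "z < s" | "s < z" using s(2) by fastforce
    then show "eventually (\<lambda>x. z \<notin> {x<..s}) (at_left s)"
    proof cases
      case 1
      then have "eventually (\<lambda>x. x \<in> {z<..<s}) (at_left s)"
        using eventually_at_left_real by simp
      then show ?thesis by eventually_elim auto
    qed auto
  qed
  moreover have "eventually (\<lambda>x. x \<in> {a<..<s}) (at_left s)"
    using eventually_at_left_real[of a s] s by simp
  ultimately show "eventually (\<lambda>x. \<bar>f s - f x\<bar> \<le> e) (at_left s)"
    by eventually_elim (use s in \<open>auto intro!: E(2)\<close>)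
qed simp

text \<open>Jumps larger than 1/(n+1) all lie in the finite exceptional set for that
  tolerance.\<close>

lemma cadlag_on_countable_jumps:
  assumes f: "cadlag_on a b f"
  shows "countable {s\<in>{a<..b}. left_lim f s \<noteq> f s}"
proof (cases "a \<le> b")
  case True
  have "\<exists>E. finite E \<and> (\<forall>s\<in>{a<..b} - E. \<bar>f s - left_lim f s\<bar> \<le> 1 / real (Suc n))" for n
  proof -
    obtain E where "finite E" "\<And>x y. a \<le> x \<Longrightarrow> x \<le> y \<Longrightarrow> y \<le> b \<Longrightarrow> E \<inter> {x<..y} = {} \<Longrightarrow>
        \<bar>f y - f x\<bar> \<le> 1 / real (Suc n)"
      using cadlag_on_oscillation[OF f True, of "1 / real (Suc n)"] by auto
    then show ?thesis using cadlag_jump_small[OF f] by (intro exI[of _ E]) auto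
  qed
  then obtain E where E: "\<And>n. finite (E n)"
    "\<And>n s. s \<in> {a<..b} - E n \<Longrightarrow> \<bar>f s - left_lim f s\<bar> \<le> 1 / real (Suc n)" by metis
  have "{s\<in>{a<..b}. left_lim f s \<noteq> f s} \<subseteq> (\<Union>n. E n)"
  proof safe
    fix s assume s: "s \<in> {a<..b}" "left_lim f s \<noteq> f s"
    then obtain n where "inverse (real (Suc n)) < \<bar>f s - left_lim f s\<bar>"
      using reals_Archimedean[of "\<bar>f s - left_lim f s\<bar>"] by auto
    then have "s \<in> E n" using E(2)[of s n] s by (force simp: inverse_eq_divide)
    then show "s \<in> (\<Union>n. E n)" by auto
  qed
  moreover have "countable (\<Union>n. E n)" using E(1) by (auto intro: countable_finite)
  ultimately show ?thesis by (rule countable_subset)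
qed auto

section \<open>Uniform grids and the cell that contains a point\<close>

definition grid :: "real \<Rightarrow> real \<Rightarrow> nat \<Rightarrow> nat \<Rightarrow> real" where
  "grid a b n i = a + real i * ((b - a) / real (Suc n))"

text \<open>Ceiling minus one rather than floor: the cells are open on the left and closed on the
  right, so a grid point belongs to the cell that it ends.\<close>

definition grid_index :: "real \<Rightarrow> real \<Rightarrow> nat \<Rightarrow> real \<Rightarrow> nat" where
  "grid_index a b n s = nat (\<lceil>(s - a) / ((b - a) / real (Suc n))\<rceil> - 1)"

lemma grid_0 [simp]: "grid a b n 0 = a"
  by (simp add: grid_def)

lemma grid_last [simp]: "grid a b n (Suc n) = b"
  by (simp add: grid_def del: of_nat_Suc)

lemma grid_Suc: "grid a b n (Suc i) = grid a b n i + (b - a) / real (Suc n)"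
  unfolding grid_def of_nat_Suc[of i] by (simp add: distrib_right add_divide_distrib del: of_nat_Suc)

lemma grid_mono: "a \<le> b \<Longrightarrow> i \<le> j \<Longrightarrow> grid a b n i \<le> grid a b n j"
  unfolding grid_def by (intro add_left_mono mult_right_mono) auto

lemma grid_bounds:
  assumes "a \<le> b" "i \<le> Suc n"
  shows "a \<le> grid a b n i" "grid a b n i \<le> b"
  using grid_mono[OF assms(1), of 0 i n] grid_mono[OF assms, of n] by auto

lemma grid_index_less:
  assumes ab: "a < b" and s: "s \<in> {a<..b}"
  shows "grid_index a b n s < Suc n"
    "grid a b n (grid_index a b n s) < s" "s \<le> grid a b n (Suc (grid_index a b n s))"
proof -
  define d where "d = (b - a) / real (Suc n)"
  have d: "d > 0" using ab by (simp add: d_def)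
  define k where "k = \<lceil>(s - a) / d\<rceil>"
  have "(s - a) / d > 0" using s d by auto
  then have k: "k \<ge> 1" unfolding k_def by linarith
  have "(s - a) / d \<le> (b - a) / d" using s d by (intro divide_right_mono) auto
  also have "(b - a) / d = real (Suc n)" using ab by (simp add: d_def del: of_nat_Suc)
  finally have k2: "k \<le> int (Suc n)" unfolding k_def by (intro ceiling_le) simp
  have gi: "grid_index a b n s = nat (k - 1)" by (simp add: grid_index_def k_def d_def)
  show "grid_index a b n s < Suc n" using k k2 unfolding gi by linarith
  have r: "real (nat (k - 1)) = of_int k - 1" using k by simp
  have "of_int k - 1 < (s - a) / d" "(s - a) / d \<le> of_int k" unfolding k_def by linarith+
  then have *: "(of_int k - 1) * d < s - a" "s - a \<le> of_int k * d" using d by (auto simp: field_simps)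
  show "grid a b n (grid_index a b n s) < s" using *(1)
    unfolding grid_def gi r d_def[symmetric] by linarith
  have "real (Suc (nat (k - 1))) = of_int k" using k by simp
  then show "s \<le> grid a b n (Suc (grid_index a b n s))" using *(2)
    unfolding grid_def gi d_def[symmetric] by simp
qed

lemma grid_index_unique:
  assumes ab: "a < b" and s: "grid a b n i < s" "s \<le> grid a b n (Suc i)"
  shows "grid_index a b n s = i"
proof -
  define d where "d = (b - a) / real (Suc n)"
  have d: "d > 0" using ab by (simp add: d_def)
  have "real i < (s - a) / d" "(s - a) / d \<le> real i + 1"
    using s d unfolding grid_def d_def[symmetric] by (auto simp: field_simps)
  then have "\<lceil>(s - a) / d\<rceil> = int i + 1" by (intro ceiling_unique) auto
  then show ?thesis by (simp add: grid_index_def d_def)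
qed

lemma grid_mesh_tendsto: "(\<lambda>n. (b - a) / real (Suc n)) \<longlonglongrightarrow> 0"
  by (intro real_tendsto_divide_at_top[OF tendsto_const] filterlim_compose[OF filterlim_real_sequentially filterlim_Suc])

text \<open>The left end of the cell is strictly below s even if s is a grid point. This is why
  left-point sums see the left limit of the integrand.\<close>

lemma grid_index_tendsto_left:
  assumes ab: "a < b" and s: "s \<in> {a<..b}"
  shows "filterlim (\<lambda>n. grid a b n (grid_index a b n s)) (at_left s) sequentially"
proof (rule tendsto_imp_filterlim_at_left)
  show "(\<lambda>n. grid a b n (grid_index a b n s)) \<longlonglongrightarrow> s"
  proof (rule tendsto_sandwich)
    show "eventually (\<lambda>n. s - (b - a) / real (Suc n) \<le> grid a b n (grid_index a b n s)) sequentially"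
      using grid_index_less(3)[OF assms] by (intro always_eventually) (auto simp: grid_Suc algebra_simps)
    show "eventually (\<lambda>n. grid a b n (grid_index a b n s) \<le> s) sequentially"
      using grid_index_less(2)[OF assms] by (intro always_eventually) (auto intro: less_imp_le)
    show "(\<lambda>n. s - (b - a) / real (Suc n)) \<longlonglongrightarrow> s"
      using tendsto_diff[OF tendsto_const grid_mesh_tendsto, of s] by simp
  qed simp
  show "eventually (\<lambda>n. grid a b n (grid_index a b n s) < s) sequentially"
    using grid_index_less(2)[OF assms] by auto
qed

text \<open>The right end of the cell may equal s, so the limit is taken within
  \<open>{s..}\<close>. At s = b right continuity is not part of \<open>cadlag_on\<close>, but there
  the right end is b itself.\<close>

lemma cadlag_grid_right_tendsto:
  assumes f: "cadlag_on a b f" and ab: "a < b" and s: "s \<in> {a<..b}"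
  shows "(\<lambda>n. f (grid a b n (Suc (grid_index a b n s)))) \<longlonglongrightarrow> f s"
proof (cases "s = b")
  case True
  have "grid a b n (Suc (grid_index a b n s)) = s" for n
  proof -
    have "grid a b n (Suc (grid_index a b n s)) \<le> b"
      using grid_index_less(1)[OF ab s, of n] ab by (intro grid_bounds) auto
    then show ?thesis using grid_index_less(3)[OF ab s, of n] True by auto
  qed
  then show ?thesis by simp
next
  case False
  let ?x = "\<lambda>n. grid a b n (Suc (grid_index a b n s))"
  have x: "?x \<longlonglongrightarrow> s"
  proof (rule tendsto_sandwich)
    show "eventually (\<lambda>n. s \<le> ?x n) sequentially"
      using grid_index_less(3)[OF ab s] by auto
    show "eventually (\<lambda>n. ?x n \<le> s + (b - a) / real (Suc n)) sequentially"
      using grid_index_less(2)[OF ab s] by (intro always_eventually) (auto simp: grid_Suc intro: less_imp_le)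
    show "(\<lambda>n. s + (b - a) / real (Suc n)) \<longlonglongrightarrow> s"
      using tendsto_add[OF tendsto_const grid_mesh_tendsto, of s] by simp
  qed simp
  have "(f \<longlongrightarrow> f s) (at_right s)"
    using f s False unfolding cadlag_on_def continuous_within by auto
  then have "(f \<longlongrightarrow> f s) (at s within {s..})"
    by (simp add: at_within_Ici_at_right)
  then have "continuous (at s within {s..}) f" by (simp add: continuous_within)
  then show ?thesis
    using grid_index_less(3)[OF ab s] x unfolding continuous_within_sequentially comp_def by auto
qed

text \<open>Since h vanishes near 0, a cell without exceptional points contributes nothing, and over
  the cell of an exceptional point the increment tends to the jump there. For h = square the
  statement would fail for paths with a Brownian part, whose small increments add up; the cutoff
  isolates the jumps.\<close>

lemma cadlag_jump_sum_limit:
  fixes h :: "real \<Rightarrow> real"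
  assumes f: "cadlag_on a b f" and ab: "a < b" and h: "continuous_on UNIV h"
    and e: "0 < e" "\<And>x. \<bar>x\<bar> \<le> e \<Longrightarrow> h x = 0"
  shows "finite {s\<in>{a<..b}. h (f s - left_lim f s) \<noteq> 0}"
    and "(\<lambda>n. \<Sum>i<Suc n. h (f (grid a b n (Suc i)) - f (grid a b n i)))
      \<longlonglongrightarrow> (\<Sum>\<^sub>\<infinity>s\<in>{a<..b}. h (f s - left_lim f s))"
proof -
  obtain E0 where E0: "finite E0"
    "\<And>x y. a \<le> x \<Longrightarrow> x \<le> y \<Longrightarrow> y \<le> b \<Longrightarrow> E0 \<inter> {x<..y} = {} \<Longrightarrow> \<bar>f y - f x\<bar> \<le> e"
    using cadlag_on_oscillation[OF f _ e(1)] ab by auto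
  define E where "E = E0 \<inter> {a<..b}"
  have E: "finite E" "E \<subseteq> {a<..b}" using E0 by (auto simp: E_def)
  have zero: "h (f s - left_lim f s) = 0" if "s \<in> {a<..b} - E" for s
  proof (intro e(2) cadlag_jump_small[OF f E0(1)])
    show "s \<in> {a<..b}" "s \<notin> E0" using that by (auto simp: E_def)
  qed (use E0(2) in blast)
  show "finite {s\<in>{a<..b}. h (f s - left_lim f s) \<noteq> 0}"
    by (rule finite_subset[OF _ E(1)]) (use zero in auto)
  have inf: "(\<Sum>\<^sub>\<infinity>s\<in>{a<..b}. h (f s - left_lim f s)) = (\<Sum>s\<in>E. h (f s - left_lim f s))"
    using E zero by (subst infsum_cong_neutral[where T=E and g="\<lambda>s. h (f s - left_lim f s)"]) auto
  let ?D = "\<lambda>n i. h (f (grid a b n (Suc i)) - f (grid a b n i))"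
  let ?i = "\<lambda>n. grid_index a b n"
  \<comment> \<open>Once the mesh is below the smallest gap in \<open>E\<close>, every cell holds at
    most one point of \<open>E\<close>, so the sum over \<open>E\<close> is a sum over
    cells.\<close>
  have "eventually (\<lambda>n. \<forall>z\<in>E. \<forall>y\<in>E. z < y \<longrightarrow> ?i n z \<noteq> ?i n y) sequentially"
  proof (intro eventually_ball_finite E(1) ballI)
    fix z y assume zy: "z \<in> E" "y \<in> E"
    show "eventually (\<lambda>n. z < y \<longrightarrow> ?i n z \<noteq> ?i n y) sequentially"
    proof (cases "z < y")
      case True
      have "eventually (\<lambda>n. (b - a) / real (Suc n) < y - z) sequentially"
        using order_tendstoD(2)[OF grid_mesh_tendsto, of "y - z"] True by simp
      then show ?thesis
      proof eventually_elim
        case (elim n)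
        have "y \<le> grid a b n (?i n y) + (b - a) / real (Suc n)" "grid a b n (?i n z) < z"
          using grid_index_less[OF ab, of y n] grid_index_less[OF ab, of z n] E zy
          by (auto simp: grid_Suc)
        then show ?case using elim by auto
      qed
    qed auto
  qed
  then have ev: "eventually (\<lambda>n. (\<Sum>s\<in>E. ?D n (?i n s)) = (\<Sum>i<Suc n. ?D n i)) sequentially"
  proof eventually_elim
    case (elim n)
    have inj: "inj_on (?i n) E"
      using elim by (intro inj_onI) (metis linorder_less_linear)
    have "(\<Sum>s\<in>E. ?D n (?i n s)) = (\<Sum>i\<in>?i n ` E. ?D n i)"
      by (simp add: sum.reindex[OF inj])
    also have "\<dots> = (\<Sum>i<Suc n. ?D n i)"
    proof (rule sum.mono_neutral_left)
      show "?i n ` E \<subseteq> {..<Suc n}" using grid_index_less(1)[OF ab] E by blast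
      show "\<forall>i\<in>{..<Suc n} - ?i n ` E. ?D n i = 0"
      proof
        fix i assume i: "i \<in> {..<Suc n} - ?i n ` E"
        have "grid a b n i \<le> grid a b n (Suc i)" using ab by (intro grid_mono) simp_all
        moreover have "a \<le> grid a b n i" "grid a b n (Suc i) \<le> b"
          using ab i by (auto simp del: grid_last intro!: grid_bounds)
        moreover have "E0 \<inter> {grid a b n i<..grid a b n (Suc i)} = {}"
        proof (rule ccontr)
          assume "E0 \<inter> {grid a b n i<..grid a b n (Suc i)} \<noteq> {}"
          then obtain z where z: "z \<in> E0" "grid a b n i < z" "z \<le> grid a b n (Suc i)" by auto
          then have "z \<in> E" using calculation unfolding E_def by auto
          moreover have "?i n z = i" using grid_index_unique[OF ab z(2,3)] .
          ultimately show False using i by auto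
        qed
        ultimately show "?D n i = 0" by (intro e(2) E0(2))
      qed
    qed auto
    finally show ?case .
  qed
  have "(\<lambda>n. \<Sum>s\<in>E. ?D n (?i n s)) \<longlonglongrightarrow> (\<Sum>s\<in>E. h (f s - left_lim f s))"
  proof (rule tendsto_sum)
    fix s assume "s \<in> E"
    then have s: "s \<in> {a<..b}" using E by auto
    have "(\<lambda>n. f (grid a b n (Suc (?i n s))) - f (grid a b n (?i n s))) \<longlonglongrightarrow> f s - left_lim f s"
      by (intro tendsto_diff cadlag_grid_right_tendsto[OF f ab s]
          filterlim_compose[OF cadlag_on_tendsto_left_lim[OF f s] grid_index_tendsto_left[OF ab s]])
    moreover have "isCont h (f s - left_lim f s)"
      using h by (simp add: continuous_on_eq_continuous_at)
    ultimately show "(\<lambda>n. ?D n (?i n s)) \<longlonglongrightarrow> h (f s - left_lim f s)"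
      by (rule isCont_tendsto_compose[rotated])
  qed
  then show "(\<lambda>n. \<Sum>i<Suc n. ?D n i) \<longlonglongrightarrow> (\<Sum>\<^sub>\<infinity>s\<in>{a<..b}. h (f s - left_lim f s))"
    unfolding inf using ev by (rule Lim_transform_eventually)
qed

section \<open>Pathwise Stieltjes integrals\<close>

lemma mono_on_left_limit:
  fixes g :: "real \<Rightarrow> real"
  assumes g: "mono_on {a..s} g" and s: "a < s"
  shows "\<exists>l. (g \<longlongrightarrow> l) (at_left s)"
proof -
  have "(g \<longlongrightarrow> Sup (g ` ({..<s} \<inter> {a..s}))) (at s within ({..<s} \<inter> {a..s}))"
    using g s by (intro Lim_left_bound[where K="g s"]) (auto simp: mono_on_def)
  moreover have "at s within ({..<s} \<inter> {a..s}) = at_left s"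
    by (rule at_within_nhd[of _ "{a<..}"]) (use s in auto)
  ultimately show ?thesis by auto
qed

text \<open>What the Riemann sum argument uses of an integrand. It covers cadlag paths as well as
  monotone functions such as running suprema.\<close>

definition left_regular :: "real \<Rightarrow> real \<Rightarrow> (real \<Rightarrow> real) \<Rightarrow> bool" where
  "left_regular a b z \<longleftrightarrow>
     (\<exists>B. \<forall>x\<in>{a..b}. \<bar>z x\<bar> \<le> B) \<and> (\<forall>s\<in>{a<..b}. \<exists>l. (z \<longlongrightarrow> l) (at_left s))"

lemma left_regular_left_lim:
  assumes "left_regular a b z" "s \<in> {a<..b}"
  shows "(z \<longlongrightarrow> left_lim z s) (at_left s)"
  using assms left_lim_eqI unfolding left_regular_def by metis

lemma left_regular_bound:
  assumes "left_regular a b z"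
  obtains B where "0 \<le> B" "\<And>x. x \<in> {a..b} \<Longrightarrow> \<bar>z x\<bar> \<le> B"
proof -
  obtain B where "\<forall>x\<in>{a..b}. \<bar>z x\<bar> \<le> B" using assms unfolding left_regular_def by auto
  then show ?thesis using that[of "max 0 B"] by fastforce
qed

lemma left_regular_subset:
  assumes "left_regular a b z" "a \<le> c" "d \<le> b"
  shows "left_regular c d z"
  using assms unfolding left_regular_def
  by (meson atLeastatMost_subset_iff greaterThanAtMost_iff le_less_trans order_trans subsetD)

lemma left_regular_cadlag:
  assumes "cadlag_on a b z"
  shows "left_regular a b z"
proof -
  obtain B where "\<And>x. x \<in> {a..b} \<Longrightarrow> \<bar>z x\<bar> \<le> B" using cadlag_on_bounded[OF assms] by auto
  then show ?thesis using assms unfolding left_regular_def cadlag_on_def by blast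
qed

lemma left_regular_mono:
  assumes z: "mono_on {a..b} z"
  shows "left_regular a b z"
proof -
  have "\<bar>z x\<bar> \<le> \<bar>z a\<bar> + \<bar>z b\<bar>" if "x \<in> {a..b}" for x
  proof -
    have "z a \<le> z x" "z x \<le> z b" using z that by (auto simp: mono_on_def)
    then show ?thesis by linarith
  qed
  moreover have "\<exists>l. (z \<longlongrightarrow> l) (at_left s)" if "s \<in> {a<..b}" for s
    using that by (intro mono_on_left_limit[of a]) (auto intro: mono_on_subset[OF z])
  ultimately show ?thesis unfolding left_regular_def by blast
qed

lemma left_regular_const: "left_regular a b (\<lambda>x. c)"
  unfolding left_regular_def
  by (intro conjI ballI exI[of _ "\<bar>c\<bar>"] exI[of _ c] tendsto_const) simp

lemma left_regular_diff:
  assumes z: "left_regular a b z" and y: "left_regular a b y"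
  shows "left_regular a b (\<lambda>x. z x - y x)"
proof -
  obtain B C where B: "\<And>x. x \<in> {a..b} \<Longrightarrow> \<bar>z x\<bar> \<le> B" and C: "\<And>x. x \<in> {a..b} \<Longrightarrow> \<bar>y x\<bar> \<le> C"
    using left_regular_bound[OF z] left_regular_bound[OF y] by metis
  have "\<bar>z x - y x\<bar> \<le> B + C" if "x \<in> {a..b}" for x
    using B[OF that] C[OF that] by linarith
  moreover have "((\<lambda>x. z x - y x) \<longlongrightarrow> left_lim z s - left_lim y s) (at_left s)" if "s \<in> {a<..b}" for s
    using left_regular_left_lim[OF z that] left_regular_left_lim[OF y that] by (rule tendsto_diff)
  ultimately show ?thesis unfolding left_regular_def by blast
qed

text \<open>The shape of the dS-integrals in the variance equation: the integrand is taken at s-,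
  the interval is open on the left, so in the approximating sums each increment of A is multiplied
  by a value at the left end of its cell.\<close>

definition sint :: "(real \<Rightarrow> real) \<Rightarrow> (real \<Rightarrow> real) \<Rightarrow> real \<Rightarrow> real \<Rightarrow> real" where
  "sint A z a b = (LINT s:{a<..b}|interval_measure A. left_lim z s)"

lemma sint_empty [simp]: "b \<le> a \<Longrightarrow> sint A z a b = 0"
  by (simp add: sint_def set_lebesgue_integral_def)

section \<open>Left-point Riemann sums and their consequences\<close>

locale stieltjes =
  fixes A :: "real \<Rightarrow> real"
  assumes mono: "x \<le> y \<Longrightarrow> A x \<le> A y" and rcont: "continuous (at_right x) A"
begin

lemma emeasure_Ioc: "a \<le> b \<Longrightarrow> emeasure (interval_measure A) {a<..b} = ennreal (A b - A a)"
  by (intro emeasure_interval_measure_Ioc mono rcont)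

lemma measure_Ioc: "a \<le> b \<Longrightarrow> measure (interval_measure A) {a<..b} = A b - A a"
  by (intro measure_interval_measure_Ioc mono rcont)

lemma grid_step_integral:
  assumes ab: "a < b"
  shows "has_bochner_integral (interval_measure A)
     (\<lambda>s. indicator {a<..b} s * z (grid a b n (grid_index a b n s)))
     (\<Sum>i<Suc n. z (grid a b n i) * (A (grid a b n (Suc i)) - A (grid a b n i)))"
proof -
  let ?g = "grid a b n"
  have le: "?g i \<le> ?g (Suc i)" for i using ab by (intro grid_mono) simp_all
  have "has_bochner_integral (interval_measure A)
     (\<lambda>s. \<Sum>i<Suc n. z (?g i) * indicator {?g i<..?g (Suc i)} s)
     (\<Sum>i<Suc n. z (?g i) * measure (interval_measure A) {?g i<..?g (Suc i)})"
    by (intro has_bochner_integral_sum has_bochner_integral_mult_right has_bochner_integral_real_indicator)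
       (auto simp: emeasure_Ioc le simp del: grid_last)
  also have "(\<lambda>s. \<Sum>i<Suc n. z (?g i) * indicator {?g i<..?g (Suc i)} s) =
     (\<lambda>s. indicator {a<..b} s * z (?g (grid_index a b n s)))"
  proof
    fix s
    show "(\<Sum>i<Suc n. z (?g i) * indicator {?g i<..?g (Suc i)} s) =
      indicator {a<..b} s * z (?g (grid_index a b n s))"
    proof (cases "s \<in> {a<..b}")
      case True
      note gi = grid_index_less[OF ab True, of n]
      have "(\<Sum>i<Suc n. z (?g i) * indicator {?g i<..?g (Suc i)} s) =
        (\<Sum>i<Suc n. if i = grid_index a b n s then z (?g i) else 0)"
      proof (intro sum.cong refl)
        fix i
        have "s \<in> {?g i<..?g (Suc i)} \<longleftrightarrow> i = grid_index a b n s"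
          using gi grid_index_unique[OF ab, of n i s] by auto
        then show "z (?g i) * indicator {?g i<..?g (Suc i)} s = (if i = grid_index a b n s then z (?g i) else 0)"
          by (simp add: indicator_def)
      qed
      also have "\<dots> = z (?g (grid_index a b n s))"
        using gi(1) by (subst sum.delta) auto
      finally show ?thesis using True by simp
    next
      case False
      have "s \<notin> {?g i<..?g (Suc i)}" if "i < Suc n" for i
      proof -
        have "a \<le> ?g i" "?g (Suc i) \<le> b" using ab that by (auto intro!: grid_bounds simp del: grid_last)
        then show ?thesis using False by auto
      qed
      then have "(\<Sum>i<Suc n. z (?g i) * indicator {?g i<..?g (Suc i)} s) = 0"
        by (intro sum.neutral) auto
      then show ?thesis using False by simp
    qed
  qed
  finally show ?thesis using le by (simp add: measure_Ioc del: sum.lessThan_Suc)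
qed

text \<open>Dominated convergence for the left-point step functions, which are bounded and tend to
  z(s-). The sums involve finitely many values of z and A, so monotonicity, linearity, measurability
  and moment bounds of \<open>sint\<close> can all be read off from them.\<close>

lemma
  assumes ab: "a < b" and z: "left_regular a b z"
  shows sint_integrable': "integrable (interval_measure A) (\<lambda>s. indicator {a<..b} s * left_lim z s)"
    and sint_riemann: "(\<lambda>n. \<Sum>i<Suc n. z (grid a b n i) * (A (grid a b n (Suc i)) - A (grid a b n i)))
      \<longlonglongrightarrow> sint A z a b"
    and left_lim_measurable': "(\<lambda>s. indicator {a<..b} s * left_lim z s) \<in> borel_measurable borel"
proof -
  obtain B where B: "0 \<le> B" "\<And>x. x \<in> {a..b} \<Longrightarrow> \<bar>z x\<bar> \<le> B" using left_regular_bound[OF z] by metis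
  let ?f = "\<lambda>s. indicator {a<..b} s * left_lim z s"
  let ?s = "\<lambda>n s. indicator {a<..b} s * z (grid a b n (grid_index a b n s))"
  let ?M = "interval_measure A"
  note hb = grid_step_integral[OF ab, where z=z]
  have s[measurable]: "?s n \<in> borel_measurable ?M" for n
    using hb[of n] by (rule borel_measurable_has_bochner_integral)
  have lim: "(\<lambda>n. ?s n x) \<longlonglongrightarrow> ?f x" for x
  proof (cases "x \<in> {a<..b}")
    case True
    then show ?thesis
      using filterlim_compose[OF left_regular_left_lim[OF z True] grid_index_tendsto_left[OF ab True]] by simp
  qed simp
  have f[measurable]: "?f \<in> borel_measurable ?M"
    by (rule borel_measurable_LIMSEQ_real[OF lim s])
  then show "?f \<in> borel_measurable borel" by simp
  have w: "integrable ?M (\<lambda>s. B * indicator {a<..b} s)"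
    using ab by (intro integrable_mult_right integrable_real_indicator) (auto simp: emeasure_Ioc)
  have bound: "norm (?s n x) \<le> B * indicator {a<..b} x" for n x
  proof (cases "x \<in> {a<..b}")
    case True
    have "\<bar>z (grid a b n (grid_index a b n x))\<bar> \<le> B"
      using grid_index_less(1)[OF ab True, of n] ab by (intro B(2)) (auto intro!: grid_bounds)
    then show ?thesis using True by simp
  qed simp
  show "integrable ?M ?f"
    by (rule integrable_dominated_convergence[where s="?s", OF f s w]) (use lim bound in auto)
  have "(\<lambda>n. integral\<^sup>L ?M (?s n)) \<longlonglongrightarrow> integral\<^sup>L ?M ?f"
    by (rule integral_dominated_convergence[where s="?s", OF f s w]) (use lim bound in auto)
  then show "(\<lambda>n. \<Sum>i<Suc n. z (grid a b n i) * (A (grid a b n (Suc i)) - A (grid a b n i))) \<longlonglongrightarrow> sint A z a b"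
    unfolding has_bochner_integral_integral_eq[OF hb] sint_def set_lebesgue_integral_def real_scaleR_def .
qed

lemma sint_mono:
  assumes z: "left_regular a b z" and y: "left_regular a b y"
    and le: "\<And>x. x \<in> {a..b} \<Longrightarrow> \<bar>z x\<bar> \<le> y x"
  shows "\<bar>sint A z a b\<bar> \<le> sint A y a b"
proof (cases "a < b")
  case True
  show ?thesis
  proof (rule LIMSEQ_le)
    show "(\<lambda>n. \<bar>\<Sum>i<Suc n. z (grid a b n i) * (A (grid a b n (Suc i)) - A (grid a b n i))\<bar>) \<longlonglongrightarrow> \<bar>sint A z a b\<bar>"
      by (intro tendsto_rabs sint_riemann True z)
    show "(\<lambda>n. \<Sum>i<Suc n. y (grid a b n i) * (A (grid a b n (Suc i)) - A (grid a b n i))) \<longlonglongrightarrow> sint A y a b"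
      by (intro sint_riemann True y)
    have "\<bar>\<Sum>i<Suc n. z (grid a b n i) * (A (grid a b n (Suc i)) - A (grid a b n i))\<bar>
        \<le> (\<Sum>i<Suc n. y (grid a b n i) * (A (grid a b n (Suc i)) - A (grid a b n i)))" for n
    proof (rule order_trans[OF sum_abs], rule sum_mono)
      fix i assume i: "i \<in> {..<Suc n}"
      have d: "0 \<le> A (grid a b n (Suc i)) - A (grid a b n i)"
        using mono[OF grid_mono[of a b i "Suc i" n]] True by auto
      have "\<bar>z (grid a b n i)\<bar> \<le> y (grid a b n i)"
        using True i by (intro le) (auto intro!: grid_bounds)
      then show "\<bar>z (grid a b n i) * (A (grid a b n (Suc i)) - A (grid a b n i))\<bar>
         \<le> y (grid a b n i) * (A (grid a b n (Suc i)) - A (grid a b n i))"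
        using d by (simp add: abs_mult mult_right_mono)
    qed
    then show "\<exists>N. \<forall>n\<ge>N. \<bar>\<Sum>i<Suc n. z (grid a b n i) * (A (grid a b n (Suc i)) - A (grid a b n i))\<bar>
        \<le> (\<Sum>i<Suc n. y (grid a b n i) * (A (grid a b n (Suc i)) - A (grid a b n i)))" by blast
  qed
qed simp

lemma sint_const: "a \<le> b \<Longrightarrow> sint A (\<lambda>x. c) a b = c * (A b - A a)"
proof (cases "a < b")
  case True
  have "(\<Sum>i<Suc n. c * (A (grid a b n (Suc i)) - A (grid a b n i))) = c * (A b - A a)" for n
    unfolding sum_distrib_left[symmetric]
    using sum_lessThan_telescope[of "\<lambda>i. A (grid a b n i)" "Suc n"] by (simp only: grid_last grid_0)
  then show ?thesis using sint_riemann[OF True left_regular_const[of a b c]]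
    by (simp add: LIMSEQ_const_iff del: sum.lessThan_Suc)
qed simp

lemma sint_bound:
  assumes "a \<le> b" "left_regular a b z" "\<And>x. x \<in> {a..b} \<Longrightarrow> \<bar>z x\<bar> \<le> B"
  shows "\<bar>sint A z a b\<bar> \<le> B * (A b - A a)"
  using sint_mono[OF assms(2) left_regular_const[of a b B]] assms sint_const by auto

lemma sint_diff:
  assumes z: "left_regular a b z" and y: "left_regular a b y"
  shows "sint A (\<lambda>x. z x - y x) a b = sint A z a b - sint A y a b"
proof (cases "a < b")
  case True
  have "(\<lambda>n. \<Sum>i<Suc n. (z (grid a b n i) - y (grid a b n i)) * (A (grid a b n (Suc i)) - A (grid a b n i)))
      \<longlonglongrightarrow> sint A z a b - sint A y a b"
    unfolding left_diff_distrib sum_subtractf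
    unfolding left_diff_distrib[symmetric]
    by (intro tendsto_diff sint_riemann[OF True] z y)
  with sint_riemann[OF True left_regular_diff[OF z y]] show ?thesis by (rule LIMSEQ_unique)
qed simp

lemma sint_integrable:
  assumes z: "left_regular a b z"
  shows "set_integrable (interval_measure A) {a<..b} (left_lim z)"
  using sint_integrable'[OF _ z] unfolding set_integrable_def real_scaleR_def
  by (cases "a < b") auto

lemma sint_combine:
  assumes "left_regular a c z" "a \<le> b" "b \<le> c"
  shows "sint A z a c = sint A z a b + sint A z b c"
proof -
  have eq: "{a<..c} = {a<..b} \<union> {b<..c}" using assms by auto
  show ?thesis unfolding sint_def eq
    by (intro set_integral_Un sint_integrable left_regular_subset[OF assms(1)])
       (use assms in auto)
qed

text \<open>\<open>sint_mono\<close> with z as its own majorant: an absolute value lies below the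
  integral.\<close>

lemma sint_nonneg:
  assumes "left_regular a b z" "\<And>x. x \<in> {a..b} \<Longrightarrow> 0 \<le> z x"
  shows "0 \<le> sint A z a b"
  using sint_mono[OF assms(1,1)] assms(2) by fastforce

lemma sint_mono_upper:
  assumes z: "left_regular a c z" "\<And>x. x \<in> {a..c} \<Longrightarrow> 0 \<le> z x" and "a \<le> b" "b \<le> c"
  shows "sint A z a b \<le> sint A z a c"
proof -
  have "0 \<le> sint A z b c"
    using assms by (intro sint_nonneg left_regular_subset[OF z(1)]) auto
  then show ?thesis using sint_combine[OF z(1) assms(3,4)] by simp
qed

lemma sint_cadlag:
  assumes z: "\<And>b. left_regular a b z"
  shows "cadlag_from a (\<lambda>t. sint A z a t)"
proof -
  have diff: "\<bar>sint A z a t - sint A z a s\<bar> \<le> B * (A t - A s)"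
    if B: "\<And>x. x \<in> {a..T} \<Longrightarrow> \<bar>z x\<bar> \<le> B" and st: "a \<le> s" "s \<le> t" "t \<le> T" for B s t T
    using sint_bound[OF st(2) left_regular_subset[OF z st(1) order_refl], of B]
      sint_combine[OF z st(1,2)] B st by auto
  have right: "continuous (at_right t) (\<lambda>t. sint A z a t)" if t: "a \<le> t" for t
  proof -
    obtain B where B: "0 \<le> B" "\<And>x. x \<in> {a..t+1} \<Longrightarrow> \<bar>z x\<bar> \<le> B" using left_regular_bound[OF z] by metis
    have "((\<lambda>s. sint A z a s - sint A z a t) \<longlongrightarrow> 0) (at_right t)"
    proof (rule Lim_null_comparison)
      have "eventually (\<lambda>s. s \<in> {t<..<t+1}) (at_right t)" by (rule eventually_at_right_real) simp
      then show "eventually (\<lambda>s. norm (sint A z a s - sint A z a t) \<le> B * (A s - A t)) (at_right t)"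
        by eventually_elim (use t in \<open>auto intro!: diff[OF B(2)]\<close>)
      have "((\<lambda>s. B * (A s - A t)) \<longlongrightarrow> B * (A t - A t)) (at_right t)"
        using rcont[of t] unfolding continuous_within by (intro tendsto_intros) auto
      then show "((\<lambda>s. B * (A s - A t)) \<longlongrightarrow> 0) (at_right t)" by simp
    qed
    then show ?thesis unfolding continuous_within using LIM_zero_iff by blast
  qed
  have left: "\<exists>l. ((\<lambda>t. sint A z a t) \<longlongrightarrow> l) (at_left t)" if t: "a < t" for t
  proof -
    obtain B where B: "0 \<le> B" "\<And>x. x \<in> {a..t} \<Longrightarrow> \<bar>z x\<bar> \<le> B" using left_regular_bound[OF z] by metis
    \<comment> \<open>Increments of the integral are at least -B times those of A, so adding B A
      makes it nondecreasing. The integral is then a difference of two monotone functions, which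
      gives left limits.\<close>
    have "mono_on {a..t} (\<lambda>s. sint A z a s + B * A s)"
      using diff[OF B(2)] by (force simp: mono_on_def algebra_simps abs_le_iff)
    moreover have "mono_on {a..t} (\<lambda>s. B * A s)"
      using mono B(1) by (auto simp: mono_on_def intro!: mult_left_mono)
    ultimately obtain l1 l2 where "((\<lambda>s. sint A z a s + B * A s) \<longlongrightarrow> l1) (at_left t)"
      "((\<lambda>s. B * A s) \<longlongrightarrow> l2) (at_left t)"
      using mono_on_left_limit t by metis
    from tendsto_diff[OF this] show ?thesis by auto
  qed
  show ?thesis unfolding cadlag_from_def using left right by auto
qed

end

interpretation stieltjes_id: stieltjes "\<lambda>x. x"
  by standard (auto intro!: continuous_intros)

section \<open>Lebesgue integrals of cadlag paths\<close>

lemma cadlag_on_measurable: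
  assumes z: "cadlag_on a b z"
  shows "(\<lambda>s. indicator {a..b} s * z s) \<in> borel_measurable borel"
proof (rule measurable_discrete_difference)
  show "(\<lambda>s. indicator {a<..b} s * left_lim z s) \<in> borel_measurable borel"
    using stieltjes_id.left_lim_measurable'[OF _ left_regular_cadlag[OF z]] by (cases "a < b") auto
  show "countable (insert a {s\<in>{a<..b}. left_lim z s \<noteq> z s})"
    using cadlag_on_countable_jumps[OF z] by auto
qed (auto split: split_indicator)

text \<open>A cadlag function differs from its left limits at countably many points, a Lebesgue null
  set. This brings the ds-terms of the equation into the same form as the dS-terms.\<close>

lemma lborel_integral_eq_sint:
  assumes z: "cadlag_on a b z"
  shows "(LINT s:{a..b}|lborel. z s) = sint (\<lambda>x. x) z a b"
proof -
  have "AE s in lborel. s \<notin> insert a {s\<in>{a<..b}. left_lim z s \<noteq> z s}"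
    using cadlag_on_countable_jumps[OF z] by (intro AE_not_in countable_imp_null_set_lborel) auto
  then have "AE s in lborel. indicator {a..b} s * z s = indicator {a<..b} s * left_lim z s"
    by eventually_elim (auto split: split_indicator)
  moreover have m: "(\<lambda>s. indicator {a<..b} s * left_lim z s) \<in> borel_measurable borel"
    using stieltjes_id.left_lim_measurable'[OF _ left_regular_cadlag[OF z]] by (cases "a < b") auto
  ultimately show ?thesis
    unfolding sint_def set_lebesgue_integral_def real_scaleR_def lborel_eq_real[symmetric]
    using cadlag_on_measurable[OF z] m by (intro integral_cong_AE) auto
qed

section \<open>The delay operator\<close>

lemma cadlag_from_cong:
  assumes "\<And>t. a \<le> t \<Longrightarrow> f t = g t" "cadlag_from a f"
  shows "cadlag_from a g"
proof -
  have "(g \<longlongrightarrow> g t) (at_right t)" if "a \<le> t" for t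
  proof (rule Lim_transform_eventually)
    show "(f \<longlongrightarrow> g t) (at_right t)"
      using assms that unfolding cadlag_from_def continuous_within by force
    have "eventually (\<lambda>x. x > t) (at_right t)" by (simp add: eventually_at_right_less)
    then show "eventually (\<lambda>x. f x = g x) (at_right t)"
      by eventually_elim (use assms(1) that in auto)
  qed
  moreover have "\<exists>l. (g \<longlongrightarrow> l) (at_left t)" if t: "a < t" for t
  proof -
    obtain l where l: "(f \<longlongrightarrow> l) (at_left t)" using assms(2) t unfolding cadlag_from_def by blast
    have "eventually (\<lambda>x. x \<in> {a<..<t}) (at_left t)" using t by (rule eventually_at_left_real)
    then have "eventually (\<lambda>x. f x = g x) (at_left t)"
      by eventually_elim (use assms(1) in auto)
    then show ?thesis using Lim_transform_eventually[OF l] by blast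
  qed
  ultimately show ?thesis unfolding cadlag_from_def continuous_within by blast
qed

lemma cadlag_from_add:
  assumes "cadlag_from a f" "cadlag_from a g"
  shows "cadlag_from a (\<lambda>t. f t + g t)"
  using assms unfolding cadlag_from_def
  by (auto intro!: continuous_intros) (metis tendsto_add)

lemma cadlag_from_diff:
  assumes "cadlag_from a f" "cadlag_from a g"
  shows "cadlag_from a (\<lambda>t. f t - g t)"
  using assms unfolding cadlag_from_def
  by (auto intro!: continuous_intros) (metis tendsto_diff)

lemma cadlag_from_cmult:
  assumes "cadlag_from a f"
  shows "cadlag_from a (\<lambda>t. c * f t)"
  using assms unfolding cadlag_from_def
  by (auto intro!: continuous_intros) (metis tendsto_mult_left)

lemma cadlag_from_continuous:
  assumes "continuous_on UNIV f"
  shows "cadlag_from a f"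
proof -
  have "isCont f t" for t using assms by (simp add: continuous_on_eq_continuous_at)
  then show ?thesis unfolding cadlag_from_def
    by (auto intro: continuous_at_imp_continuous_at_within simp: isCont_def filterlim_at_split)
qed

lemma cadlag_from_subset:
  "cadlag_from a f \<Longrightarrow> a \<le> b \<Longrightarrow> cadlag_from b f"
  unfolding cadlag_from_def by auto

lemma cadlag_from_left_regular:
  assumes "cadlag_from a z"
  shows "left_regular a b z"
  using left_regular_cadlag[OF cadlag_from_imp_on[OF assms order_refl]] .

lemma cadlag_on_diff:
  assumes "cadlag_on a b f" "cadlag_on a b g"
  shows "cadlag_on a b (\<lambda>t. f t - g t)"
  using assms unfolding cadlag_on_def
  by (auto intro!: continuous_intros simp del: greaterThanAtMost_iff) (metis tendsto_diff)

lemma cadlag_on_mult: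
  assumes "cadlag_on a b f" "cadlag_on a b g"
  shows "cadlag_on a b (\<lambda>t. f t * g t)"
  using assms unfolding cadlag_on_def
  by (auto intro!: continuous_intros simp del: greaterThanAtMost_iff) (metis tendsto_mult)

lemma cadlag_on_continuous:
  fixes f :: "real \<Rightarrow> real"
  assumes f: "continuous_on {a..b} f"
  shows "cadlag_on a b f"
proof -
  have "(f \<longlongrightarrow> f t) (at_right t)" if t: "t \<in> {a..<b}" for t
  proof -
    have "(f \<longlongrightarrow> f t) (at t within {a..b})"
      using f t unfolding continuous_on_def by auto
    then have "(f \<longlongrightarrow> f t) (at t within {t..b})"
      by (rule tendsto_within_subset) (use t in auto)
    then show ?thesis using t by (simp add: at_within_Icc_at_right)
  qed
  moreover have "(f \<longlongrightarrow> f t) (at_left t)" if t: "t \<in> {a<..b}" for t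
  proof -
    have "(f \<longlongrightarrow> f t) (at t within {a..b})"
      using f t unfolding continuous_on_def by auto
    then have "(f \<longlongrightarrow> f t) (at t within {a..t})"
      by (rule tendsto_within_subset) (use t in auto)
    then show ?thesis using t by (simp add: at_within_Icc_at_left)
  qed
  ultimately show ?thesis unfolding cadlag_on_def continuous_within by blast
qed

lemma cadlag_from_shift:
  assumes f: "cadlag_from a f" and "a \<le> t + c"
  shows "cadlag_on c d (\<lambda>u. f (t + u))"
proof -
  have r: "filterlim (\<lambda>u. t + u) (at_right (t + u)) (at_right u)" for u
    using filtermap_at_right_shift[of "-t" u] by (simp add: filterlim_def add.commute)
  have l: "filterlim (\<lambda>u. t + u) (at_left (t + u)) (at_left u)" for u
    using filtermap_at_left_shift[of "-t" u] by (simp add: filterlim_def add.commute)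
  have "((\<lambda>u. f (t + u)) \<longlongrightarrow> f (t + u)) (at_right u)" if "c \<le> u" for u
  proof (rule filterlim_compose[OF _ r])
    show "(f \<longlongrightarrow> f (t + u)) (at_right (t + u))"
      using f assms(2) that unfolding cadlag_from_def continuous_within by auto
  qed
  moreover have "\<exists>l. ((\<lambda>u. f (t + u)) \<longlongrightarrow> l) (at_left u)" if "c < u" for u
  proof -
    have "a < t + u" using assms(2) that by linarith
    then obtain k where "(f \<longlongrightarrow> k) (at_left (t + u))"
      using f unfolding cadlag_from_def by blast
    then show ?thesis using filterlim_compose l by blast
  qed
  ultimately show ?thesis unfolding cadlag_on_def continuous_within by auto
qed

lemma cadlag_on_integrable:
  assumes z: "cadlag_on a b z"
  shows "set_integrable lborel {a..b} z"
proof -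
  obtain B where B: "0 \<le> B" "\<And>x. x \<in> {a..b} \<Longrightarrow> \<bar>z x\<bar> \<le> B" using cadlag_on_bounded[OF z] by metis
  show ?thesis unfolding set_integrable_def real_scaleR_def
  proof (rule Bochner_Integration.integrable_bound)
    show "integrable lborel (\<lambda>x. B * indicator {a..b} x)"
      by (intro integrable_mult_right integrable_real_indicator) (auto simp: emeasure_lborel_Icc_eq)
    show "(\<lambda>x. indicator {a..b} x * z x) \<in> borel_measurable lborel"
      using cadlag_on_measurable[OF z] by simp
    show "AE x in lborel. norm (indicator {a..b} x * z x) \<le> norm (B * indicator {a..b} x)"
      using B by (auto split: split_indicator)
  qed
qed

text \<open>Along a sequence approaching t strictly from one side, J(t_n + u) converges for every u,
  to J(t + u) or to its left limit; dominated convergence then carries the one-sided limits through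
  the integral.\<close>

lemma cadlag_from_convolution:
  fixes f :: "real \<Rightarrow> real"
  assumes J: "cadlag_from (-r) J" and f: "continuous_on {-p..0} f" and p: "p \<le> r"
  shows "cadlag_from 0 (\<lambda>t. LINT u:{-p..0}|lborel. f u * J (t + u))"
proof -
  obtain C where C: "0 \<le> C" "\<And>x. x \<in> {-p..0} \<Longrightarrow> \<bar>f x\<bar> \<le> C"
    using cadlag_on_bounded[OF cadlag_on_continuous[OF f]] by metis
  have Jc: "cadlag_on (-p) 0 (\<lambda>u. J (t + u))" if "0 \<le> t" for t
    using that p by (intro cadlag_from_shift[OF J]) auto
  let ?h = "\<lambda>t u. indicator {-p..0} u * (f u * J (t + u))"
  have meas: "?h t \<in> borel_measurable lborel" if "0 \<le> t" for t
    using cadlag_on_measurable[OF cadlag_on_mult[OF cadlag_on_continuous[OF f] Jc[OF that]]] by simp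
  \<comment> \<open>One dominated convergence serves both sides: k is J(t + u) from the right and
    its left limit from the left. The dominating constant uses the boundedness of J on the compact
    interval that contains all arguments.\<close>
  have conv: "(\<lambda>n. LINT u:{-p..0}|lborel. f u * J (S n + u)) \<longlonglongrightarrow> (LINT u:{-p..0}|lborel. f u * k u)"
    if S: "\<And>n. 0 \<le> S n" "\<And>n. S n \<le> T" and lim: "\<And>u. u \<in> {-p..0} \<Longrightarrow> (\<lambda>n. J (S n + u)) \<longlonglongrightarrow> k u"
    for S :: "nat \<Rightarrow> real" and T k
  proof -
    obtain B where B: "0 \<le> B" "\<And>x. x \<in> {-r..T} \<Longrightarrow> \<bar>J x\<bar> \<le> B"
      using cadlag_on_bounded[OF cadlag_from_imp_on[OF J order_refl]] by metis
    have lim': "(\<lambda>n. ?h (S n) u) \<longlonglongrightarrow> indicator {-p..0} u * (f u * k u)" for u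
      using lim by (cases "u \<in> {-p..0}") (auto intro!: tendsto_intros simp del: atLeastAtMost_iff)
    show ?thesis unfolding set_lebesgue_integral_def real_scaleR_def
    proof (rule integral_dominated_convergence[where w="\<lambda>u. (C * B) * indicator {-p..0} u"])
      show "(\<lambda>u. indicator {-p..0} u * (f u * k u)) \<in> borel_measurable lborel"
        by (rule borel_measurable_LIMSEQ_real[OF lim' meas[OF S(1)]])
      show "?h (S n) \<in> borel_measurable lborel" for n by (rule meas[OF S(1)])
      show "integrable lborel (\<lambda>u. (C * B) * indicator {-p..0} u)"
        by (intro integrable_mult_right integrable_real_indicator) (auto simp: emeasure_lborel_Icc_eq)
      have "\<bar>?h (S n) u\<bar> \<le> (C * B) * indicator {-p..0} u" for n u
      proof (cases "u \<in> {-p..0}")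
        case True
        have "\<bar>f u\<bar> * \<bar>J (S n + u)\<bar> \<le> C * B"
          using True p S(1)[of n] S(2)[of n] by (intro mult_mono C B) auto
        then show ?thesis using True by (simp add: abs_mult)
      qed simp
      then show "AE u in lborel. norm (?h (S n) u) \<le> (C * B) * indicator {-p..0} u" for n by simp
      show "AE u in lborel. (\<lambda>n. ?h (S n) u) \<longlonglongrightarrow> indicator {-p..0} u * (f u * k u)"
        using lim' by simp
    qed
  qed
  have "((\<lambda>t. LINT u:{-p..0}|lborel. f u * J (t + u)) \<longlongrightarrow> (LINT u:{-p..0}|lborel. f u * J (t + u))) (at_right t)"
    if t: "0 \<le> t" for t
  proof (rule tendsto_at_right_sequentially[of t "t+1"])
    fix S assume S: "\<And>n. t < S n" "\<And>n. S n < t + 1" "S \<longlonglongrightarrow> t"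
    show "(\<lambda>n. LINT u:{-p..0}|lborel. f u * J (S n + u)) \<longlonglongrightarrow> (LINT u:{-p..0}|lborel. f u * J (t + u))"
    proof (rule conv[of _ "t+1"])
      show "0 \<le> S n" "S n \<le> t + 1" for n using S(1)[of n] S(2)[of n] t by auto
      fix u assume u: "u \<in> {-p..0}"
      have "filterlim (\<lambda>n. S n + u) (at_right (t + u)) sequentially"
        using S by (intro tendsto_imp_filterlim_at_right tendsto_intros) auto
      moreover have "(J \<longlongrightarrow> J (t + u)) (at_right (t + u))"
        using J u t p unfolding cadlag_from_def continuous_within by auto
      ultimately show "(\<lambda>n. J (S n + u)) \<longlonglongrightarrow> J (t + u)" by (rule filterlim_compose[rotated])
    qed
  qed simp
  moreover have "\<exists>l. ((\<lambda>t. LINT u:{-p..0}|lborel. f u * J (t + u)) \<longlongrightarrow> l) (at_left t)" if t: "0 < t" for t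
  proof
    show "((\<lambda>t. LINT u:{-p..0}|lborel. f u * J (t + u)) \<longlongrightarrow> (LINT u:{-p..0}|lborel. f u * left_lim J (t + u))) (at_left t)"
    proof (rule tendsto_at_left_sequentially[of 0])
      fix S assume S: "\<And>n. S n < t" "\<And>n. 0 < S n" "S \<longlonglongrightarrow> t"
      show "(\<lambda>n. LINT u:{-p..0}|lborel. f u * J (S n + u)) \<longlonglongrightarrow> (LINT u:{-p..0}|lborel. f u * left_lim J (t + u))"
      proof (rule conv[of _ t])
        show "0 \<le> S n" "S n \<le> t" for n using S(1)[of n] S(2)[of n] by auto
        fix u assume u: "u \<in> {-p..0}"
        have "filterlim (\<lambda>n. S n + u) (at_left (t + u)) sequentially"
          using S by (intro tendsto_imp_filterlim_at_left tendsto_intros) auto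
        moreover have "(J \<longlongrightarrow> left_lim J (t + u)) (at_left (t + u))"
          using u t p by (intro cadlag_on_tendsto_left_lim[OF cadlag_from_imp_on[OF J order_refl, of "t + u"]]) auto
        ultimately show "(\<lambda>n. J (S n + u)) \<longlonglongrightarrow> left_lim J (t + u)" by (rule filterlim_compose[rotated])
      qed
    qed (rule t)
  qed
  ultimately show ?thesis unfolding cadlag_from_def continuous_within by blast
qed

text \<open>The Riemann sums only use values of A and z at times in [a, b]; with N the sigma-algebra
  at time b this yields adaptedness of the integral.\<close>

lemma sint_measurable:
  assumes A: "\<And>\<omega>. \<omega> \<in> space N \<Longrightarrow> stieltjes (A \<omega>)" "\<And>s. s \<in> {a..b} \<Longrightarrow> (\<lambda>\<omega>. A \<omega> s) \<in> borel_measurable N"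
    and z: "\<And>\<omega>. \<omega> \<in> space N \<Longrightarrow> left_regular a b (z \<omega>)" "\<And>s. s \<in> {a..b} \<Longrightarrow> (\<lambda>\<omega>. z \<omega> s) \<in> borel_measurable N"
  shows "(\<lambda>\<omega>. sint (A \<omega>) (z \<omega>) a b) \<in> borel_measurable N"
proof (cases "a < b")
  case True
  show ?thesis
  proof (rule borel_measurable_LIMSEQ_real)
    show "\<omega> \<in> space N \<Longrightarrow> (\<lambda>n. \<Sum>i<Suc n. z \<omega> (grid a b n i) *
        (A \<omega> (grid a b n (Suc i)) - A \<omega> (grid a b n i))) \<longlonglongrightarrow> sint (A \<omega>) (z \<omega>) a b" for \<omega>
      by (intro stieltjes.sint_riemann A True z)
    have "grid a b n i \<in> {a..b}" if "i \<le> Suc n" for n i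
      using grid_bounds[of a b i n] True that by simp
    then show "(\<lambda>\<omega>. \<Sum>i<Suc n. z \<omega> (grid a b n i) *
        (A \<omega> (grid a b n (Suc i)) - A \<omega> (grid a b n i))) \<in> borel_measurable N" for n
      by (intro borel_measurable_sum borel_measurable_times borel_measurable_diff A z)
         (simp_all del: atLeastAtMost_iff grid_last)
  qed
qed simp

text \<open>The delay term of one clock, for the signed measure with density f on [-p, 0] and point
  mass c at 0. It occurs with the identity clock and c = \<open>- c\<^sub>\<mu>\<close>, and with
  the quadratic variation and c = \<open>c\<^sub>\<nu>\<close>.\<close>

definition delay_op :: "(real \<Rightarrow> real) \<Rightarrow> (real \<Rightarrow> real) \<Rightarrow> real \<Rightarrow> real \<Rightarrow> (real \<Rightarrow> real) \<Rightarrow> real \<Rightarrow> real" where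
  "delay_op A f p c z t =
     (LINT u:{-p..0}|lborel. f u * sint A z u (t + u)) + c * sint A z 0 t"

text \<open>The total variation of that signed measure.\<close>

definition delay_mass :: "(real \<Rightarrow> real) \<Rightarrow> real \<Rightarrow> real \<Rightarrow> real" where
  "delay_mass f p c = (LINT u:{-p..0}|lborel. \<bar>f u\<bar>) + \<bar>c\<bar>"

lemma delay_mass_nonneg: "0 \<le> delay_mass f p c"
  unfolding delay_mass_def set_lebesgue_integral_def by (intro add_nonneg_nonneg integral_nonneg) auto

context stieltjes
begin

context
  fixes f :: "real \<Rightarrow> real" and p r :: real
  assumes f: "continuous_on {-p..0} f" and p: "0 \<le> p" "p \<le> r"
begin

lemma sint_window:
  assumes z: "\<And>b. left_regular (-r) b z" and "-r \<le> u" "0 \<le> t"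
  shows "sint A z u (t + u) = sint A z (-r) (t + u) - sint A z (-r) u"
  using sint_combine[OF z, of u "t + u"] assms by simp

lemma delay_integrand_cadlag:
  assumes z: "\<And>b. left_regular (-r) b z" and t: "0 \<le> t"
  shows "cadlag_on (-p) 0 (\<lambda>u. f u * (sint A z (-r) (t + u) - sint A z (-r) u))"
proof -
  note J = sint_cadlag[OF z]
  show ?thesis
    using p t cadlag_from_shift[OF J, of 0 "-p" 0]
    by (intro cadlag_on_mult[OF cadlag_on_continuous[OF f]] cadlag_on_diff cadlag_from_shift[OF J]) auto
qed

text \<open>The window integral becomes a difference of values of one cadlag function, the integral
  from -r to a variable end point. Regularity in u and in t follows from that of this
  function.\<close>

lemma delay_op_eq:
  assumes z: "\<And>b. left_regular (-r) b z" and t: "0 \<le> t"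
  shows "delay_op A f p c z t =
    (LINT u:{-p..0}|lborel. f u * (sint A z (-r) (t + u) - sint A z (-r) u))
      + c * (sint A z (-r) t - sint A z (-r) 0)"
proof -
  have "(LINT u:{-p..0}|lborel. f u * sint A z u (t + u)) =
    (LINT u:{-p..0}|lborel. f u * (sint A z (-r) (t + u) - sint A z (-r) u))"
    by (rule set_lebesgue_integral_cong) (use p sint_window[OF z _ t] in auto)
  then show ?thesis using sint_window[OF z _ t, of 0] p unfolding delay_op_def by simp
qed

lemma delay_integrable:
  assumes z: "\<And>b. left_regular (-r) b z" and t: "0 \<le> t"
  shows "set_integrable lborel {-p..0} (\<lambda>u. f u * sint A z u (t + u))"
proof -
  have "set_integrable lborel {-p..0} (\<lambda>u. f u * (sint A z (-r) (t + u) - sint A z (-r) u))"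
    by (intro cadlag_on_integrable delay_integrand_cadlag z t)
  then show ?thesis
    by (rule set_integrable_cong[THEN iffD1, rotated 3]) (use p sint_window[OF z _ t] in auto)
qed

lemma delay_op_diff:
  assumes z: "\<And>b. left_regular (-r) b z" and y: "\<And>b. left_regular (-r) b y" and t: "0 \<le> t"
  shows "delay_op A f p c (\<lambda>x. z x - y x) t = delay_op A f p c z t - delay_op A f p c y t"
proof -
  have d: "sint A (\<lambda>x. z x - y x) u v = sint A z u v - sint A y u v" if "-r \<le> u" for u v
    using that by (intro sint_diff left_regular_subset[OF z] left_regular_subset[OF y]) auto
  have "(LINT u:{-p..0}|lborel. f u * sint A (\<lambda>x. z x - y x) u (t + u)) =
     (LINT u:{-p..0}|lborel. f u * sint A z u (t + u) - f u * sint A y u (t + u))"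
    by (rule set_lebesgue_integral_cong) (use p d in \<open>auto simp: right_diff_distrib\<close>)
  also have "\<dots> = (LINT u:{-p..0}|lborel. f u * sint A z u (t + u)) - (LINT u:{-p..0}|lborel. f u * sint A y u (t + u))"
    by (intro set_integral_diff delay_integrable z y t)
  finally show ?thesis using d[of 0 t] p unfolding delay_op_def by (simp add: right_diff_distrib)
qed

text \<open>Every window (u, t + u] with u in [-r, 0] lies in (-r, t], and y is nonnegative there,
  so the integral of y over the whole past dominates all windows at once; integrating over u leaves
  the total variation.\<close>

lemma delay_op_bound:
  assumes z: "\<And>b. left_regular (-r) b z" and y: "left_regular (-r) t y" and t: "0 \<le> t"
    and le: "\<And>x. x \<in> {-r..t} \<Longrightarrow> \<bar>z x\<bar> \<le> y x"
  shows "\<bar>delay_op A f p c z t\<bar> \<le> delay_mass f p c * sint A y (-r) t"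
proof -
  have y0: "0 \<le> y x" if "x \<in> {-r..t}" for x using le[OF that] by linarith
  have b: "\<bar>sint A z u (t + u)\<bar> \<le> sint A y (-r) t" if u: "u \<in> {-r..0}" for u
  proof -
    have "\<bar>sint A z u (t + u)\<bar> \<le> sint A y u (t + u)"
      using u t by (intro sint_mono left_regular_subset[OF z] left_regular_subset[OF y] le) auto
    also have "sint A y u (t + u) \<le> sint A y (-r) (t + u)"
    proof -
      have "0 \<le> sint A y (-r) u"
        using u t by (intro sint_nonneg left_regular_subset[OF y] y0) auto
      then show ?thesis
        using sint_combine[of "-r" "t + u" y u] u t left_regular_subset[OF y, of "-r" "t+u"] by auto
    qed
    also have "\<dots> \<le> sint A y (-r) t"
      using u t by (intro sint_mono_upper y y0) auto
    finally show ?thesis .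
  qed
  have "\<bar>LINT u:{-p..0}|lborel. f u * sint A z u (t + u)\<bar> \<le> (LINT u:{-p..0}|lborel. \<bar>f u\<bar> * sint A y (-r) t)"
  proof -
    have "\<bar>LINT u:{-p..0}|lborel. f u * sint A z u (t + u)\<bar> \<le> (LINT u:{-p..0}|lborel. \<bar>f u * sint A z u (t + u)\<bar>)"
      using set_integral_norm_bound[OF delay_integrable[OF z t]] by simp
    also have "\<dots> \<le> (LINT u:{-p..0}|lborel. \<bar>f u\<bar> * sint A y (-r) t)"
    proof (rule set_integral_mono)
      show "set_integrable lborel {-p..0} (\<lambda>u. \<bar>f u * sint A z u (t + u)\<bar>)"
        using set_integrable_abs[OF delay_integrable[OF z t]] by simp
      show "set_integrable lborel {-p..0} (\<lambda>u. \<bar>f u\<bar> * sint A y (-r) t)"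
        by (intro cadlag_on_integrable cadlag_on_continuous continuous_intros f)
      show "\<bar>f u * sint A z u (t + u)\<bar> \<le> \<bar>f u\<bar> * sint A y (-r) t" if "u \<in> {-p..0}" for u
        using b[of u] that p unfolding abs_mult by (intro mult_left_mono) auto
    qed
    finally show ?thesis .
  qed
  also have "\<dots> = (LINT u:{-p..0}|lborel. \<bar>f u\<bar>) * sint A y (-r) t"
    by (simp add: set_integral_mult_left)
  finally have 1: "\<bar>LINT u:{-p..0}|lborel. f u * sint A z u (t + u)\<bar> \<le> (LINT u:{-p..0}|lborel. \<bar>f u\<bar>) * sint A y (-r) t" .
  have "\<bar>c * sint A z 0 t\<bar> \<le> \<bar>c\<bar> * sint A y (-r) t"
    using b[of 0] p unfolding abs_mult by (intro mult_left_mono) auto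
  with 1 show ?thesis unfolding delay_op_def delay_mass_def distrib_right by linarith
qed

lemma delay_op_cadlag:
  assumes z: "\<And>b. left_regular (-r) b z"
  shows "cadlag_from 0 (delay_op A f p c z)"
proof (rule cadlag_from_cong)
  note J = sint_cadlag[OF z]
  let ?J = "\<lambda>t. sint A z (-r) t"
  let ?k = "LINT u:{-p..0}|lborel. f u * ?J u"
  show "cadlag_from 0 (\<lambda>t. (LINT u:{-p..0}|lborel. f u * ?J (t + u)) + (c * ?J t - (?k + c * ?J 0)))"
    using p by (intro cadlag_from_add cadlag_from_diff cadlag_from_cmult cadlag_from_convolution[OF J f]
        cadlag_from_subset[OF J] cadlag_from_continuous continuous_on_const) auto
  fix t :: real assume t: "0 \<le> t"
  have "(LINT u:{-p..0}|lborel. f u * (?J (t + u) - ?J u)) =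
     (LINT u:{-p..0}|lborel. f u * ?J (t + u) - f u * ?J u)"
    by (simp add: right_diff_distrib)
  also have "\<dots> = (LINT u:{-p..0}|lborel. f u * ?J (t + u)) - ?k"
    using p t cadlag_from_shift[OF J, of 0 "-p" 0]
    by (intro set_integral_diff cadlag_on_integrable cadlag_on_mult[OF cadlag_on_continuous[OF f]]
        cadlag_from_shift[OF J]) auto
  finally show "(LINT u:{-p..0}|lborel. f u * ?J (t + u)) + (c * ?J t - (?k + c * ?J 0)) = delay_op A f p c z t"
    unfolding delay_op_eq[OF z t] by (simp add: algebra_simps)
qed

end

end

text \<open>The outer integral over u has a cadlag integrand, so it is itself a \<open>sint\<close>
  against the identity, and \<open>sint_measurable\<close> applies a second time.\<close>

lemma delay_op_measurable:
  assumes f: "continuous_on {-p..0} f" and p: "0 \<le> p" "p \<le> r" and t: "0 \<le> t"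
    and A: "\<And>\<omega>. \<omega> \<in> space N \<Longrightarrow> stieltjes (A \<omega>)" "\<And>s. s \<in> {-r..t} \<Longrightarrow> (\<lambda>\<omega>. A \<omega> s) \<in> borel_measurable N"
    and z: "\<And>\<omega> b. \<omega> \<in> space N \<Longrightarrow> left_regular (-r) b (z \<omega>)" "\<And>s. s \<in> {-r..t} \<Longrightarrow> (\<lambda>\<omega>. z \<omega> s) \<in> borel_measurable N"
  shows "(\<lambda>\<omega>. delay_op (A \<omega>) f p c (z \<omega>) t) \<in> borel_measurable N"
proof -
  define J where "J \<omega> s = sint (A \<omega>) (z \<omega>) (-r) s" for \<omega> s
  have J: "(\<lambda>\<omega>. J \<omega> s) \<in> borel_measurable N" if "s \<in> {-r..t}" for s
    unfolding J_def using that by (intro sint_measurable A z) auto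
  let ?g = "\<lambda>\<omega> u. f u * (J \<omega> (t + u) - J \<omega> u)"
  have eq: "delay_op (A \<omega>) f p c (z \<omega>) t = sint (\<lambda>x. x) (?g \<omega>) (-p) 0 + c * (J \<omega> t - J \<omega> 0)" if \<omega>: "\<omega> \<in> space N" for \<omega>
  proof -
    interpret stieltjes "A \<omega>" using A(1)[OF \<omega>] .
    show ?thesis unfolding delay_op_eq[OF f p z(1)[OF \<omega>] t] J_def
      by (subst lborel_integral_eq_sint[OF delay_integrand_cadlag[OF f p z(1)[OF \<omega>] t]]) simp
  qed
  have "(\<lambda>\<omega>. sint (\<lambda>x. x) (?g \<omega>) (-p) 0 + c * (J \<omega> t - J \<omega> 0)) \<in> borel_measurable N"
  proof (intro borel_measurable_add borel_measurable_times borel_measurable_diff borel_measurable_const J sint_measurable)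
    show "stieltjes (\<lambda>x. x)" by (rule stieltjes_id.stieltjes_axioms)
    fix \<omega> assume \<omega>: "\<omega> \<in> space N"
    interpret stieltjes "A \<omega>" using A(1)[OF \<omega>] .
    show "left_regular (-p) 0 (?g \<omega>)"
      unfolding J_def by (intro left_regular_cadlag delay_integrand_cadlag f p z(1)[OF \<omega>] t)
  qed (use p t in auto)
  then show ?thesis using measurable_cong[of N "\<lambda>\<omega>. delay_op (A \<omega>) f p c (z \<omega>) t"] eq by simp
qed

section \<open>Moments of the Levy process\<close>

text \<open>A continuous replacement for the square of x restricted to large x. It vanishes near 0,
  as the limit theorem for jump sums requires, and increases to the square as e decreases to
  0.\<close>

definition soft_sq :: "real \<Rightarrow> real \<Rightarrow> real" where
  "soft_sq e x = (max 0 (\<bar>x\<bar> - e))\<^sup>2"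

lemma soft_sq_nonneg [simp]: "0 \<le> soft_sq e x"
  by (simp add: soft_sq_def)

lemma soft_sq_small: "\<bar>x\<bar> \<le> e \<Longrightarrow> soft_sq e x = 0"
  by (simp add: soft_sq_def)

lemma soft_sq_antimono: "e \<le> e' \<Longrightarrow> soft_sq e' x \<le> soft_sq e x"
  unfolding soft_sq_def by (intro power_mono) auto

lemma soft_sq_le: "0 \<le> e \<Longrightarrow> soft_sq e x \<le> x\<^sup>2"
  using soft_sq_antimono[of 0 e x] by (simp add: soft_sq_def)

lemma continuous_on_soft_sq: "continuous_on UNIV (soft_sq e)"
  unfolding soft_sq_def by (intro continuous_intros)

lemma soft_sq_measurable [measurable]: "soft_sq e \<in> borel_measurable borel"
  by (intro borel_measurable_continuous_onI continuous_on_soft_sq)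

lemma soft_sq_tendsto: "(\<lambda>k. soft_sq (1 / real (Suc k)) x) \<longlonglongrightarrow> x\<^sup>2"
proof -
  have "(\<lambda>k. (max 0 (\<bar>x\<bar> - 1 / real (Suc k)))\<^sup>2) \<longlonglongrightarrow> (max 0 (\<bar>x\<bar> - 0))\<^sup>2"
    by (intro tendsto_intros real_tendsto_divide_at_top[OF tendsto_const]
        filterlim_compose[OF filterlim_real_sequentially filterlim_Suc])
  then show ?thesis by (simp add: soft_sq_def)
qed

lemma soft_sum_le_infsum:
  assumes "finite {u\<in>I. soft_sq e (d u) \<noteq> 0}" "finite K" "K \<subseteq> I"
  shows "(\<Sum>u\<in>K. soft_sq e (d u)) \<le> (\<Sum>\<^sub>\<infinity>u\<in>I. soft_sq e (d u))"
  using assms by (intro finite_sum_le_infsum finite_nonzero_values_imp_summable_on) auto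

lemma soft_infsum_mono:
  assumes "finite {u\<in>I. soft_sq e (d u) \<noteq> 0}" "finite {u\<in>I. soft_sq e' (d u) \<noteq> 0}" "e' \<le> e"
  shows "(\<Sum>\<^sub>\<infinity>u\<in>I. soft_sq e (d u)) \<le> (\<Sum>\<^sub>\<infinity>u\<in>I. soft_sq e' (d u))"
  using assms by (intro infsum_mono finite_nonzero_values_imp_summable_on soft_sq_antimono) auto

text \<open>On a finite set of indices the thresholded sums converge to the sum of squares, which
  inherits the bound B; bounded finite sums of nonnegative terms give summability.\<close>

lemma soft_sum_bounded_imp_summable:
  assumes fin: "\<And>k. finite {u\<in>I. soft_sq (1 / real (Suc k)) (d u) \<noteq> 0}"
    and B: "\<And>k. (\<Sum>\<^sub>\<infinity>u\<in>I. soft_sq (1 / real (Suc k)) (d u)) \<le> B"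
  shows "(\<lambda>u. (d u)\<^sup>2) summable_on I"
proof (rule nonneg_bdd_above_summable_on)
  have "(\<Sum>u\<in>K. (d u)\<^sup>2) \<le> B" if K: "K \<subseteq> I" "finite K" for K
  proof (rule LIMSEQ_le_const2)
    show "(\<lambda>k. \<Sum>u\<in>K. soft_sq (1 / real (Suc k)) (d u)) \<longlonglongrightarrow> (\<Sum>u\<in>K. (d u)\<^sup>2)"
      by (intro tendsto_sum soft_sq_tendsto)
    show "\<exists>N. \<forall>k\<ge>N. (\<Sum>u\<in>K. soft_sq (1 / real (Suc k)) (d u)) \<le> B"
      using order_trans[OF soft_sum_le_infsum[OF fin K(2,1)] B] by blast
  qed
  then show "bdd_above (sum (\<lambda>u. (d u)\<^sup>2) ` {F. F \<subseteq> I \<and> finite F})" by (auto intro!: bdd_aboveI)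
qed simp

text \<open>Monotone convergence by hand: a finite set K carries the total up to e/2, and on K the
  thresholds cost at most another e/2 for some k.\<close>

lemma soft_infsum_tendsto:
  assumes fin: "\<And>k. finite {u\<in>I. soft_sq (1 / real (Suc k)) (d u) \<noteq> 0}"
    and s: "(\<lambda>u. (d u)\<^sup>2) summable_on I"
  shows "(\<lambda>k. \<Sum>\<^sub>\<infinity>u\<in>I. soft_sq (1 / real (Suc k)) (d u)) \<longlonglongrightarrow> (\<Sum>\<^sub>\<infinity>u\<in>I. (d u)\<^sup>2)"
proof (rule increasing_LIMSEQ)
  fix k
  show "(\<Sum>\<^sub>\<infinity>u\<in>I. soft_sq (1 / real (Suc k)) (d u)) \<le> (\<Sum>\<^sub>\<infinity>u\<in>I. soft_sq (1 / real (Suc (Suc k))) (d u))"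
    by (intro soft_infsum_mono fin) (auto simp: field_simps)
  show "(\<Sum>\<^sub>\<infinity>u\<in>I. soft_sq (1 / real (Suc k)) (d u)) \<le> (\<Sum>\<^sub>\<infinity>u\<in>I. (d u)\<^sup>2)"
    by (intro infsum_mono finite_nonzero_values_imp_summable_on fin s soft_sq_le) auto
next
  fix e :: real assume e: "0 < e"
  have "(SUP K\<in>{K. finite K \<and> K \<subseteq> I}. \<Sum>u\<in>K. (d u)\<^sup>2) > (\<Sum>\<^sub>\<infinity>u\<in>I. (d u)\<^sup>2) - e/2"
    using infsum_nonneg_is_SUPREMUM_real[OF s] e by auto
  then obtain K where K: "finite K" "K \<subseteq> I" "(\<Sum>\<^sub>\<infinity>u\<in>I. (d u)\<^sup>2) - e/2 < (\<Sum>u\<in>K. (d u)\<^sup>2)"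
    by (subst (asm) less_cSUP_iff) (auto intro!: bdd_aboveI2 finite_sum_le_infsum[OF s])
  have "(\<lambda>k. \<Sum>u\<in>K. soft_sq (1 / real (Suc k)) (d u)) \<longlonglongrightarrow> (\<Sum>u\<in>K. (d u)\<^sup>2)"
    by (intro tendsto_sum soft_sq_tendsto)
  then have "eventually (\<lambda>k. (\<Sum>u\<in>K. (d u)\<^sup>2) - e/2 < (\<Sum>u\<in>K. soft_sq (1 / real (Suc k)) (d u))) sequentially"
    using e by (intro order_tendstoD) auto
  then obtain k where "(\<Sum>u\<in>K. (d u)\<^sup>2) - e/2 < (\<Sum>u\<in>K. soft_sq (1 / real (Suc k)) (d u))"
    unfolding eventually_sequentially by blast
  with K(3) soft_sum_le_infsum[OF fin K(1,2), of k]
  have "(\<Sum>\<^sub>\<infinity>u\<in>I. (d u)\<^sup>2) \<le> (\<Sum>\<^sub>\<infinity>u\<in>I. soft_sq (1 / real (Suc k)) (d u)) + e" by linarith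
  then show "\<exists>k. (\<Sum>\<^sub>\<infinity>u\<in>I. (d u)\<^sup>2) \<le> (\<Sum>\<^sub>\<infinity>u\<in>I. soft_sq (1 / real (Suc k)) (d u)) + e" ..
qed

section \<open>Superadditive functions of the time span\<close>

lemma superadditive_multiple:
  fixes G :: "real \<Rightarrow> real"
  assumes G: "\<And>h. 0 \<le> h \<Longrightarrow> 0 \<le> G h" "\<And>h k. 0 \<le> h \<Longrightarrow> 0 \<le> k \<Longrightarrow> G h + G k \<le> G (h + k)" and "0 \<le> h"
  shows "real n * G h \<le> G (real n * h)"
proof (induction n)
  case (Suc n)
  have "G (real n * h) + G h \<le> G (real n * h + h)" using assms by (intro G(2)) auto
  with Suc show ?case by (simp add: algebra_simps)
qed (use G in auto)

text \<open>With n the integer part of T/h, n G(h) is at most G(T). The factor 2 pays for the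
  rounding: n is at least 1, so T/h is at most n + 1 and hence at most 2n.\<close>

lemma superadditive_linear_bound:
  fixes G :: "real \<Rightarrow> real"
  assumes G: "\<And>h. 0 \<le> h \<Longrightarrow> 0 \<le> G h" "\<And>h k. 0 \<le> h \<Longrightarrow> 0 \<le> k \<Longrightarrow> G h + G k \<le> G (h + k)"
    and T: "0 < T" and h: "0 \<le> h" "h \<le> T"
  shows "G h \<le> 2 * G T / T * h"
proof (cases "h = 0")
  case True
  have "G 0 \<le> 0" using G(2)[of 0 0] by simp
  then show ?thesis using True by simp
next
  case False
  then have h0: "h > 0" using h by simp
  define n where "n = nat \<lfloor>T / h\<rfloor>"
  have "T / h \<ge> 1" using h h0 by simp
  then have f1: "\<lfloor>T / h\<rfloor> \<ge> 1" by (simp add: le_floor_iff)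
  then have n: "real n = of_int \<lfloor>T / h\<rfloor>" unfolding n_def by simp
  have "real n \<le> T / h" unfolding n by linarith
  then have nh: "real n * h \<le> T" using h0 by (simp add: field_simps)
  have "T / h \<le> real n + 1" unfolding n by linarith
  also have "\<dots> \<le> 2 * real n" using f1 n by linarith
  finally have n2: "T \<le> 2 * real n * h" using h0 by (simp add: field_simps)
  have "real n * G h \<le> G (real n * h)" by (rule superadditive_multiple[OF G h(1)])
  also have "\<dots> \<le> G T"
    using G(2)[of "real n * h" "T - real n * h"] G(1)[of "T - real n * h"] nh h by auto
  finally have "real n * G h \<le> G T" .
  have "T * G h \<le> 2 * real n * h * G h" using n2 G(1)[OF h(1)] by (rule mult_right_mono)
  also have "\<dots> = 2 * h * (real n * G h)" by simp
  also have "\<dots> \<le> 2 * h * G T" using \<open>real n * G h \<le> G T\<close> h0 by (intro mult_left_mono) auto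
  finally show ?thesis using T by (simp add: field_simps)
qed

lemma (in prob_space) indep_var_nn_integral:
  fixes X Y :: "'a \<Rightarrow> ennreal"
  assumes "indep_var borel X borel Y"
  shows "(\<integral>\<^sup>+\<omega>. X \<omega> * Y \<omega> \<partial>M) = (\<integral>\<^sup>+\<omega>. X \<omega> \<partial>M) * (\<integral>\<^sup>+\<omega>. Y \<omega> \<partial>M)"
proof -
  have b: "(\<lambda>_. borel) = case_bool borel (borel :: ennreal measure)"
    by (rule ext) (simp split: bool.split)
  have "(\<integral>\<^sup>+\<omega>. (\<Prod>i\<in>UNIV. case_bool X Y i \<omega>) \<partial>M) = (\<Prod>i\<in>UNIV. \<integral>\<^sup>+\<omega>. case_bool X Y i \<omega> \<partial>M)"
    using assms unfolding indep_var_def b[symmetric] by (intro indep_vars_nn_integral) auto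
  then show ?thesis by (simp add: UNIV_bool mult.commute)
qed

text \<open>Convexity of the fourth power. The correction is linear in y, so it has mean zero when y
  is a centred increment and the coefficient is known before it.\<close>

lemma fourth_power_tangent: "(x::real)^4 + 4 * (x^3 * y) \<le> (x + y)^4"
proof -
  have "(x + y)^4 - (x^4 + 4 * (x^3 * y)) = y\<^sup>2 * (2 * x\<^sup>2 + (2 * x + y)\<^sup>2)"
    by (simp add: power2_eq_square power3_eq_cube power4_eq_xxxx algebra_simps)
  also have "\<dots> \<ge> 0" by (intro mult_nonneg_nonneg add_nonneg_nonneg) auto
  finally show ?thesis by linarith
qed

text \<open>Only the nonnegative middle term 6 (x y)^2 is dropped; the mixed terms that are kept
  have an odd power of each factor and vanish in expectation for independent centred x and
  y.\<close>

lemma fourth_power_superadd: "(x::real)^4 + y^4 + 4 * (x^3 * y) + 4 * (x * y^3) \<le> (x + y)^4"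
proof -
  have "(x + y)^4 - (x^4 + y^4 + 4 * (x^3 * y) + 4 * (x * y^3)) = 6 * (x * y)\<^sup>2"
    by (simp add: power2_eq_square power3_eq_cube power4_eq_xxxx algebra_simps)
  also have "\<dots> \<ge> 0" by simp
  finally show ?thesis by linarith
qed

lemma fourth_power_convex: "((x::real) + y)^4 \<le> 8 * (x^4 + y^4)"
proof -
  have "(x + y)\<^sup>2 \<le> 2 * (x\<^sup>2 + y\<^sup>2)"
    using zero_le_power2[of "x - y"] by (simp add: power2_eq_square algebra_simps)
  then have "((x + y)\<^sup>2)\<^sup>2 \<le> (2 * (x\<^sup>2 + y\<^sup>2))\<^sup>2" by (intro power_mono) auto
  also have "\<dots> \<le> 4 * (2 * ((x\<^sup>2)\<^sup>2 + (y\<^sup>2)\<^sup>2))"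
    using zero_le_power2[of "x\<^sup>2 - y\<^sup>2"] by (simp add: power2_eq_square algebra_simps)
  finally show ?thesis by simp
qed

lemma abs_cube_le: "\<bar>x\<bar>^3 \<le> 1 + (x::real)^4"
proof (cases "\<bar>x\<bar> \<le> 1")
  case True
  then have "\<bar>x\<bar>^3 \<le> 1" by (simp add: power_le_one)
  then show ?thesis by (simp add: add_increasing2)
next
  case False
  then have "\<bar>x\<bar>^3 \<le> \<bar>x\<bar>^4" by (intro power_increasing) auto
  then show ?thesis by simp
qed

section \<open>Increments given the past, and their moments of order two and four\<close>

locale levy_fourth_moment = prob_space M for M :: "'a measure" +
  fixes r0 :: real and F :: "real \<Rightarrow> 'a measure" and L :: "real \<Rightarrow> 'a \<Rightarrow> real" and T0 :: real
  assumes filtration: "usual_filtration M r0 F"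
    and levy: "levy_process_from M r0 F L"
    and square: "\<And>t. r0 \<le> t \<Longrightarrow> integrable M (\<lambda>\<omega>. (L t \<omega>)\<^sup>2)"
    and centred: "\<And>t. r0 \<le> t \<Longrightarrow> (\<integral>\<omega>. L t \<omega> \<partial>M) = 0"
    and T0: "r0 < T0" and fourth: "integrable M (\<lambda>\<omega>. (L T0 \<omega>)^4)"
begin

lemma subalg: "r0 \<le> t \<Longrightarrow> subalgebra M (F t)"
  using filtration unfolding usual_filtration_def by blast

lemma space_F: "r0 \<le> t \<Longrightarrow> space (F t) = space M"
  using subalg unfolding subalgebra_def by blast

lemma sets_F_mono: "r0 \<le> s \<Longrightarrow> s \<le> t \<Longrightarrow> sets (F s) \<subseteq> sets (F t)"
  using filtration unfolding usual_filtration_def by blast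

lemma sets_F_subset: "r0 \<le> s \<Longrightarrow> sets (F s) \<subseteq> sets M"
  using subalg unfolding subalgebra_def by blast

lemma measurable_F_mono: "f \<in> measurable (F s) N \<Longrightarrow> r0 \<le> s \<Longrightarrow> s \<le> t \<Longrightarrow> f \<in> measurable (F t) N"
  using measurable_mono[of N N "F s" "F t"] sets_F_mono[of s t] space_F[of s] space_F[of t] by auto

lemma measurable_F_M: "f \<in> measurable (F s) N \<Longrightarrow> r0 \<le> s \<Longrightarrow> f \<in> measurable M N"
  using measurable_from_subalg subalg by blast

text \<open>The first sigma-algebra of the filtration contains every subset of a null set. Hence
  processes may be redefined off an almost sure event and remain adapted.\<close>

lemma AE_sets_F:
  assumes "AE \<omega> in M. P \<omega>"
  shows "r0 \<le> t \<Longrightarrow> {\<omega>\<in>space M. P \<omega>} \<in> sets (F t)"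
proof -
  assume t: "r0 \<le> t"
  obtain N where "N \<in> null_sets M" "{\<omega>\<in>space M. \<not> P \<omega>} \<subseteq> N"
    using assms unfolding eventually_ae_filter by blast
  moreover have "\<forall>N. N \<subseteq> space M \<and> (\<exists>N'\<in>null_sets M. N \<subseteq> N') \<longrightarrow> N \<in> sets (F r0)"
    using filtration unfolding usual_filtration_def by (elim conjE)
  moreover have "{\<omega>\<in>space M. \<not> P \<omega>} \<subseteq> space M" by simp
  ultimately have "{\<omega>\<in>space M. \<not> P \<omega>} \<in> sets (F r0)" by meson
  then have "{\<omega>\<in>space M. \<not> P \<omega>} \<in> sets (F t)" using sets_F_mono[of r0 t] t by auto
  then have "space (F t) - {\<omega>\<in>space M. \<not> P \<omega>} \<in> sets (F t)" by (rule sets.compl_sets)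
  also have "space (F t) - {\<omega>\<in>space M. \<not> P \<omega>} = {\<omega>\<in>space M. P \<omega>}"
    using space_F[OF t] by auto
  finally show ?thesis .
qed

lemma L_meas: "r0 \<le> s \<Longrightarrow> s \<le> t \<Longrightarrow> L s \<in> borel_measurable (F t)"
  using levy measurable_F_mono unfolding levy_process_from_def adapted_from_def by blast

lemma L_meas_M: "r0 \<le> s \<Longrightarrow> L s \<in> borel_measurable M"
  using L_meas[of s s] measurable_F_M by blast

lemma L_r0: "\<omega> \<in> space M \<Longrightarrow> L r0 \<omega> = 0"
  using levy unfolding levy_process_from_def by blast

lemma L_cadlag: "\<omega> \<in> space M \<Longrightarrow> cadlag_from r0 (\<lambda>t. L t \<omega>)"
  using levy unfolding levy_process_from_def by blast

text \<open>The product rule for sets of \<open>F s\<close>, lifted to random variables. The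
  function h is left general so that powers of the increment are included.\<close>

lemma indep_increment:
  fixes Y :: "'a \<Rightarrow> 'b" and h :: "real \<Rightarrow> 'b"
  assumes st: "r0 \<le> s" "s < t" and Y: "Y \<in> measurable (F s) N" and h: "h \<in> measurable borel N'"
  shows "indep_var N Y N' (\<lambda>\<omega>. h (L t \<omega> - L s \<omega>))"
proof -
  let ?D = "\<lambda>\<omega>. h (L t \<omega> - L s \<omega>)"
  have [measurable]: "L s \<in> borel_measurable M" "L t \<in> borel_measurable M"
    using st by (auto intro!: L_meas_M)
  have rv: "random_variable N Y" "random_variable N' ?D"
    using measurable_F_M[OF Y st(1)] h by auto
  have st': "Int_stable {X -` A \<inter> space M |A. A \<in> sets K}" for X :: "'a \<Rightarrow> 'b" and K
  proof (rule Int_stableI)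
    fix a b assume "a \<in> {X -` A \<inter> space M |A. A \<in> sets K}" "b \<in> {X -` A \<inter> space M |A. A \<in> sets K}"
    then obtain A B where "a = X -` A \<inter> space M" "b = X -` B \<inter> space M" "A \<in> sets K" "B \<in> sets K" by auto
    then show "a \<inter> b \<in> {X -` A \<inter> space M |A. A \<in> sets K}"
      by (auto intro!: exI[of _ "A \<inter> B"])
  qed
  have "indep_set {Y -` A \<inter> space M |A. A \<in> sets N} {?D -` A \<inter> space M |A. A \<in> sets N'}"
    unfolding indep_sets2_eq
  proof (intro conjI ballI)
    show "{Y -` A \<inter> space M |A. A \<in> sets N} \<subseteq> events"
      "{?D -` A \<inter> space M |A. A \<in> sets N'} \<subseteq> events"
      using rv by (auto intro: measurable_sets)
    fix a b assume "a \<in> {Y -` A \<inter> space M |A. A \<in> sets N}" "b \<in> {?D -` A \<inter> space M |A. A \<in> sets N'}"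
    then obtain A B where ab: "a = Y -` A \<inter> space M" "A \<in> sets N" "b = ?D -` B \<inter> space M" "B \<in> sets N'" by auto
    have "a \<in> sets (F s)" using measurable_sets[OF Y ab(2)] space_F[OF st(1)] ab(1) by simp
    moreover have "h -` B \<in> sets borel" using measurable_sets[OF h ab(4)] by simp
    moreover have "b = (\<lambda>\<omega>. L t \<omega> - L s \<omega>) -` (h -` B) \<inter> space M" using ab(3) by auto
    ultimately show "prob (a \<inter> b) = prob a * prob b"
      using levy st unfolding levy_process_from_def by blast
  qed
  then show ?thesis unfolding indep_var_eq using rv st' by (intro conjI indep_set_sigma_sets) auto
qed

lemma distr_increment:
  assumes "r0 \<le> s" "s < t"
  shows "distr M borel (\<lambda>\<omega>. L t \<omega> - L s \<omega>) = distr M borel (L (r0 + (t - s)))"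
  using levy assms unfolding levy_process_from_def by (metis add.commute)

text \<open>With values in \<open>ennreal\<close> the factorisation needs no integrability check.
  The condition h 0 = 0 settles s = t, where both sides vanish because \<open>L r0\<close> is
  0.\<close>

lemma nn_integral_increment:
  assumes st: "r0 \<le> s" "s \<le> t" and Y: "Y \<in> borel_measurable (F s)" and h: "h \<in> borel_measurable borel" "h 0 = 0"
  shows "(\<integral>\<^sup>+\<omega>. Y \<omega> * h (L t \<omega> - L s \<omega>) \<partial>M) = (\<integral>\<^sup>+\<omega>. Y \<omega> \<partial>M) * (\<integral>\<^sup>+\<omega>. h (L (r0 + (t - s)) \<omega>) \<partial>M)"
proof (cases "s = t")
  case True
  have "(\<integral>\<^sup>+\<omega>. h (L r0 \<omega>) \<partial>M) = (\<integral>\<^sup>+\<omega>. 0 \<partial>M)"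
    by (intro nn_integral_cong) (simp add: L_r0 h)
  then show ?thesis using True h by simp
next
  case False
  then have st': "s < t" using st by simp
  have [measurable]: "L s \<in> borel_measurable M" "L t \<in> borel_measurable M" "L (r0 + (t - s)) \<in> borel_measurable M"
    using st by (auto intro!: L_meas_M)
  note h[measurable]
  have "(\<integral>\<^sup>+\<omega>. Y \<omega> * h (L t \<omega> - L s \<omega>) \<partial>M) = (\<integral>\<^sup>+\<omega>. Y \<omega> \<partial>M) * (\<integral>\<^sup>+\<omega>. h (L t \<omega> - L s \<omega>) \<partial>M)"
    by (intro indep_var_nn_integral indep_increment[OF st(1) st' Y]) auto
  also have "(\<integral>\<^sup>+\<omega>. h (L t \<omega> - L s \<omega>) \<partial>M) = (\<integral>\<^sup>+x. h x \<partial>distr M borel (\<lambda>\<omega>. L t \<omega> - L s \<omega>))"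
    by (subst nn_integral_distr) auto
  also have "\<dots> = (\<integral>\<^sup>+\<omega>. h (L (r0 + (t - s)) \<omega>) \<partial>M)"
    unfolding distr_increment[OF st(1) st'] by (subst nn_integral_distr) auto
  finally show ?thesis .
qed

lemma L_integrable: "r0 \<le> t \<Longrightarrow> integrable M (L t)"
proof (rule Bochner_Integration.integrable_bound)
  assume t: "r0 \<le> t"
  show "integrable M (\<lambda>\<omega>. 1 + (L t \<omega>)\<^sup>2)" using square[OF t] by auto
  show "L t \<in> borel_measurable M" using L_meas_M[OF t] .
  have "\<bar>x\<bar> \<le> 1 + x\<^sup>2" for x :: real
  proof -
    have "0 \<le> (\<bar>x\<bar> - 1)\<^sup>2" "0 \<le> x\<^sup>2" by auto
    then have "2 * \<bar>x\<bar> \<le> 1 + x\<^sup>2" by (simp add: power2_diff)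
    then show ?thesis by linarith
  qed
  then show "AE \<omega> in M. norm (L t \<omega>) \<le> norm (1 + (L t \<omega>)\<^sup>2)" by (auto simp: abs_le_iff intro: order_trans)
qed

text \<open>The source of every vanishing cross term whose future factor is the increment itself: by
  independence the integral is E[Y] times the mean of the increment, which is 0.\<close>

lemma integral_F_increment:
  fixes Y :: "'a \<Rightarrow> real"
  assumes st: "r0 \<le> s" "s \<le> t" and Y: "Y \<in> borel_measurable (F s)" "integrable M Y"
  shows "integrable M (\<lambda>\<omega>. Y \<omega> * (L t \<omega> - L s \<omega>))" "(\<integral>\<omega>. Y \<omega> * (L t \<omega> - L s \<omega>) \<partial>M) = 0"
proof -
  have D: "integrable M (\<lambda>\<omega>. L t \<omega> - L s \<omega>)" "(\<integral>\<omega>. L t \<omega> - L s \<omega> \<partial>M) = 0"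
    using st L_integrable by (auto simp: centred)
  show "integrable M (\<lambda>\<omega>. Y \<omega> * (L t \<omega> - L s \<omega>))" "(\<integral>\<omega>. Y \<omega> * (L t \<omega> - L s \<omega>) \<partial>M) = 0"
    using indep_var_integrable[OF indep_increment[OF st(1) _ Y(1) measurable_ident] Y(2)]
      indep_var_lebesgue_integral[OF indep_increment[OF st(1) _ Y(1) measurable_ident] Y(2)] D st
    by (cases "s = t", auto)+
qed

definition moment2 :: "real \<Rightarrow> real" where "moment2 h = (\<integral>\<omega>. (L (r0 + h) \<omega>)\<^sup>2 \<partial>M)"
definition moment4 :: "real \<Rightarrow> real" where "moment4 h = (\<integral>\<omega>. (L (r0 + h) \<omega>)^4 \<partial>M)"

text \<open>Truncating \<open>L\<^sub>s\<close> makes the cross term \<open>E[L\<^sub>s\<^sup>3 (L\<^sub>t - L\<^sub>s)]\<close> meaningful, and it vanishes.\<close>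

lemma fourth_downwards:
  assumes st: "r0 \<le> s" "s \<le> t" and t: "integrable M (\<lambda>\<omega>. (L t \<omega>)^4)"
  shows "integrable M (\<lambda>\<omega>. (L s \<omega>)^4)"
proof -
  have [measurable]: "L s \<in> borel_measurable M" "L t \<in> borel_measurable M" "L s \<in> borel_measurable (F s)"
    using st by (auto intro!: L_meas_M L_meas)
  define I :: "nat \<Rightarrow> 'a \<Rightarrow> real" where "I n \<omega> = indicator {x. \<bar>x\<bar> \<le> real n} (L s \<omega>)" for n :: nat and \<omega> 
  have [measurable]: "{x::real. \<bar>x\<bar> \<le> real n} \<in> sets borel" for n by measurable
  have I[measurable]: "I n \<in> borel_measurable M" "I n \<in> borel_measurable (F s)" for n
    unfolding I_def by measurable
  have I01: "0 \<le> I n \<omega>" "I n \<omega> \<le> 1" for n \<omega> by (auto simp: I_def split: split_indicator)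
  have bd: "\<bar>I n \<omega> * (L s \<omega>)^k\<bar> \<le> real n ^ k" for n \<omega> k
    by (auto simp: I_def power_abs abs_mult intro!: power_mono split: split_indicator)
  have int: "integrable M (\<lambda>\<omega>. I n \<omega> * (L s \<omega>)^k)" for n k
    using bd by (intro integrable_const_bound[where B="real n ^ k"]) auto
  have est: "(\<integral>\<^sup>+\<omega>. ennreal (I n \<omega> * (L s \<omega>)^4) \<partial>M) \<le> ennreal (\<integral>\<omega>. (L t \<omega>)^4 \<partial>M)" for n
  proof -
    have cross: "integrable M (\<lambda>\<omega>. (I n \<omega> * (L s \<omega>)^3) * (L t \<omega> - L s \<omega>))"
      "(\<integral>\<omega>. (I n \<omega> * (L s \<omega>)^3) * (L t \<omega> - L s \<omega>) \<partial>M) = 0"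
      by (rule integral_F_increment[OF st _ int], measurable)+
    have "(\<integral>\<omega>. I n \<omega> * (L s \<omega>)^4 \<partial>M) =
        (\<integral>\<omega>. I n \<omega> * (L s \<omega>)^4 + 4 * ((I n \<omega> * (L s \<omega>)^3) * (L t \<omega> - L s \<omega>)) \<partial>M)"
      using cross int[of n 4] by simp
    \<comment> \<open>The tangent inequality multiplied by the truncation; bounding the truncation
      by 1 only at the end makes the estimate uniform in n, so that Fatou can remove it.\<close>
    also have "\<dots> \<le> (\<integral>\<omega>. (L t \<omega>)^4 \<partial>M)"
    proof (rule integral_mono)
      fix \<omega>
      have "I n \<omega> * (L s \<omega>)^4 + 4 * ((I n \<omega> * (L s \<omega>)^3) * (L t \<omega> - L s \<omega>)) =
         I n \<omega> * ((L s \<omega>)^4 + 4 * ((L s \<omega>)^3 * (L t \<omega> - L s \<omega>)))" by (simp add: algebra_simps)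
      also have "\<dots> \<le> I n \<omega> * (L t \<omega>)^4"
        using fourth_power_tangent[of "L s \<omega>" "L t \<omega> - L s \<omega>"] I01 by (intro mult_left_mono) auto
      also have "\<dots> \<le> 1 * (L t \<omega>)^4" using I01 by (intro mult_right_mono) auto
      finally show "I n \<omega> * (L s \<omega>)^4 + 4 * ((I n \<omega> * (L s \<omega>)^3) * (L t \<omega> - L s \<omega>)) \<le> (L t \<omega>)^4" by simp
    qed (use cross(1) int t in auto)
    finally show ?thesis
      using int[of n 4] I01 by (subst nn_integral_eq_integral) (auto intro!: ennreal_leI)
  qed
  have "(\<integral>\<^sup>+\<omega>. ennreal ((L s \<omega>)^4) \<partial>M) = (\<integral>\<^sup>+\<omega>. liminf (\<lambda>n. ennreal (I n \<omega> * (L s \<omega>)^4)) \<partial>M)"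
  proof (intro nn_integral_cong lim_imp_Liminf[symmetric] tendsto_ennrealI)
    fix \<omega>
    obtain N :: nat where N: "\<bar>L s \<omega>\<bar> \<le> real N" using real_arch_simple by blast
    have "eventually (\<lambda>n. (L s \<omega>)^4 = I n \<omega> * (L s \<omega>)^4) sequentially"
      using eventually_ge_at_top[of N] by eventually_elim (use N in \<open>auto simp: I_def\<close>)
    then show "(\<lambda>n. I n \<omega> * (L s \<omega>)^4) \<longlonglongrightarrow> (L s \<omega>)^4"
      by (rule Lim_transform_eventually[OF tendsto_const])
  qed simp
  also have "\<dots> \<le> liminf (\<lambda>n. \<integral>\<^sup>+\<omega>. ennreal (I n \<omega> * (L s \<omega>)^4) \<partial>M)"
    by (rule nn_integral_liminf) measurable
  also have "\<dots> \<le> ennreal (\<integral>\<omega>. (L t \<omega>)^4 \<partial>M)"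
    using est by (intro Liminf_le) auto
  also have "\<dots> < \<infinity>" by simp
  finally show ?thesis by (intro integrableI_nonneg) auto
qed

text \<open>The value at span 2h is the value at span h plus an increment of the same law; convexity
  of the fourth power bounds the sum.\<close>

lemma fourth_doubling:
  assumes h: "0 \<le> h" and i: "integrable M (\<lambda>\<omega>. (L (r0 + h) \<omega>)^4)"
  shows "integrable M (\<lambda>\<omega>. (L (r0 + 2 * h) \<omega>)^4)"
proof -
  have [measurable]: "L (r0 + h) \<in> borel_measurable M" "L (r0 + 2 * h) \<in> borel_measurable M"
    using h by (auto intro!: L_meas_M)
  have "(\<integral>\<^sup>+\<omega>. ennreal ((L (r0 + 2*h) \<omega> - L (r0 + h) \<omega>)^4) \<partial>M) = (\<integral>\<^sup>+\<omega>. ennreal ((L (r0 + h) \<omega>)^4) \<partial>M)"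
    using nn_integral_increment[of "r0 + h" "r0 + 2*h" "\<lambda>_. 1" "\<lambda>x. ennreal (x^4)"] h emeasure_space_1 by simp
  also have "\<dots> < \<infinity>" using i by (auto simp: integrable_iff_bounded power_abs)
  finally have i2: "integrable M (\<lambda>\<omega>. (L (r0 + 2*h) \<omega> - L (r0 + h) \<omega>)^4)"
    by (intro integrableI_nonneg) auto
  show ?thesis
  proof (rule Bochner_Integration.integrable_bound)
    show "integrable M (\<lambda>\<omega>. 8 * ((L (r0 + h) \<omega>)^4 + (L (r0 + 2*h) \<omega> - L (r0 + h) \<omega>)^4))"
      using i i2 by auto
    show "AE \<omega> in M. norm ((L (r0 + 2 * h) \<omega>)^4) \<le> norm (8 * ((L (r0 + h) \<omega>)^4 + (L (r0 + 2*h) \<omega> - L (r0 + h) \<omega>)^4))"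
    proof (rule AE_I2)
      fix \<omega>
      show "norm ((L (r0 + 2 * h) \<omega>)^4) \<le> norm (8 * ((L (r0 + h) \<omega>)^4 + (L (r0 + 2*h) \<omega> - L (r0 + h) \<omega>)^4))"
        using fourth_power_convex[of "L (r0 + h) \<omega>" "L (r0 + 2*h) \<omega> - L (r0 + h) \<omega>"]
        by (simp add: abs_mult add_nonneg_nonneg)
    qed
  qed auto
qed

text \<open>Repeated doubling of the span T0 - r0 passes beyond t, and
  \<open>fourth_downwards\<close> comes back to t.\<close>

lemma fourth_moment: "r0 \<le> t \<Longrightarrow> integrable M (\<lambda>\<omega>. (L t \<omega>)^4)"
proof -
  assume t: "r0 \<le> t"
  have *: "integrable M (\<lambda>\<omega>. (L (r0 + 2^n * (T0 - r0)) \<omega>)^4)" for n :: nat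
  proof (induction n)
    case (Suc n)
    then show ?case using fourth_doubling[OF _ Suc] T0 by (simp add: mult.assoc)
  qed (simp add: fourth)
  obtain n :: nat where "(t - r0) / (T0 - r0) < 2^n" using real_arch_pow[of 2 "(t - r0) / (T0 - r0)"] by auto
  then have "t \<le> r0 + 2^n * (T0 - r0)" using T0 by (simp add: field_simps)
  then show ?thesis by (rule fourth_downwards[OF t _ *])
qed

lemma moment2_nonneg: "0 \<le> moment2 h" and moment4_nonneg: "0 \<le> moment4 h"
  unfolding moment2_def moment4_def by (auto intro!: integral_nonneg)

lemma nn_integral_increment2:
  assumes st: "r0 \<le> s" "s \<le> t" and Y: "Y \<in> borel_measurable (F s)"
  shows "(\<integral>\<^sup>+\<omega>. Y \<omega> * ennreal ((L t \<omega> - L s \<omega>)\<^sup>2) \<partial>M) = (\<integral>\<^sup>+\<omega>. Y \<omega> \<partial>M) * ennreal (moment2 (t - s))"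
proof -
  have "(\<integral>\<^sup>+\<omega>. ennreal ((L (r0 + (t - s)) \<omega>)\<^sup>2) \<partial>M) = ennreal (moment2 (t - s))"
    unfolding moment2_def using square st by (intro nn_integral_eq_integral) auto
  then show ?thesis using nn_integral_increment[OF st Y, of "\<lambda>x. ennreal (x\<^sup>2)"] by simp
qed

lemma nn_integral_increment4:
  assumes st: "r0 \<le> s" "s \<le> t" and Y: "Y \<in> borel_measurable (F s)"
  shows "(\<integral>\<^sup>+\<omega>. Y \<omega> * ennreal ((L t \<omega> - L s \<omega>)^4) \<partial>M) = (\<integral>\<^sup>+\<omega>. Y \<omega> \<partial>M) * ennreal (moment4 (t - s))"
proof -
  have "(\<integral>\<^sup>+\<omega>. ennreal ((L (r0 + (t - s)) \<omega>)^4) \<partial>M) = ennreal (moment4 (t - s))"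
    unfolding moment4_def using fourth_moment st by (intro nn_integral_eq_integral) auto
  then show ?thesis using nn_integral_increment[OF st Y, of "\<lambda>x. ennreal (x^4)"] by simp
qed

lemma increment_moments:
  assumes st: "r0 \<le> s" "s \<le> t"
  shows "integrable M (\<lambda>\<omega>. (L t \<omega> - L s \<omega>)\<^sup>2)" "(\<integral>\<omega>. (L t \<omega> - L s \<omega>)\<^sup>2 \<partial>M) = moment2 (t - s)"
    "integrable M (\<lambda>\<omega>. (L t \<omega> - L s \<omega>)^4)" "(\<integral>\<omega>. (L t \<omega> - L s \<omega>)^4 \<partial>M) = moment4 (t - s)"
proof -
  have [measurable]: "L s \<in> borel_measurable M" "L t \<in> borel_measurable M" using st by (auto intro!: L_meas_M)
  have 2: "(\<integral>\<^sup>+\<omega>. ennreal ((L t \<omega> - L s \<omega>)\<^sup>2) \<partial>M) = ennreal (moment2 (t - s))"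
    using nn_integral_increment2[OF st, of "\<lambda>_. 1"] emeasure_space_1 by simp
  then show "integrable M (\<lambda>\<omega>. (L t \<omega> - L s \<omega>)\<^sup>2)" by (intro integrableI_nonneg) auto
  show "(\<integral>\<omega>. (L t \<omega> - L s \<omega>)\<^sup>2 \<partial>M) = moment2 (t - s)"
    using 2 moment2_nonneg by (subst integral_eq_nn_integral) auto
  have 4: "(\<integral>\<^sup>+\<omega>. ennreal ((L t \<omega> - L s \<omega>)^4) \<partial>M) = ennreal (moment4 (t - s))"
    using nn_integral_increment4[OF st, of "\<lambda>_. 1"] emeasure_space_1 by simp
  then show "integrable M (\<lambda>\<omega>. (L t \<omega> - L s \<omega>)^4)" by (intro integrableI_nonneg) auto
  show "(\<integral>\<omega>. (L t \<omega> - L s \<omega>)^4 \<partial>M) = moment4 (t - s)"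
    using 4 moment4_nonneg by (subst integral_eq_nn_integral) auto
qed

text \<open>Orthogonality of successive increments, which in fact gives equality; superadditivity is
  the form shared with the fourth moment.\<close>

lemma moment2_superadd: "0 \<le> h \<Longrightarrow> 0 \<le> k \<Longrightarrow> moment2 h + moment2 k \<le> moment2 (h + k)"
proof -
  assume hk: "0 \<le> h" "0 \<le> k"
  let ?X = "L (r0 + h)" and ?D = "\<lambda>\<omega>. L (r0 + (h + k)) \<omega> - L (r0 + h) \<omega>"
  have st: "r0 \<le> r0 + h" "r0 + h \<le> r0 + (h + k)" using hk by auto
  note c = integral_F_increment[OF st L_meas[OF st(1) order_refl] L_integrable[OF st(1)]]
  note d = increment_moments[OF st]
  have "moment2 (h + k) = (\<integral>\<omega>. (?X \<omega>)\<^sup>2 + (?D \<omega>)\<^sup>2 + 2 * (?X \<omega> * ?D \<omega>) \<partial>M)"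
    unfolding moment2_def by (intro Bochner_Integration.integral_cong refl) (simp add: power2_eq_square algebra_simps)
  also have "\<dots> = moment2 h + moment2 k"
    using c d square[OF st(1)] by (simp add: moment2_def)
  finally show ?thesis by simp
qed

lemma moment4_superadd: "0 \<le> h \<Longrightarrow> 0 \<le> k \<Longrightarrow> moment4 h + moment4 k \<le> moment4 (h + k)"
proof -
  assume hk: "0 \<le> h" "0 \<le> k"
  let ?X = "L (r0 + h)" and ?D = "\<lambda>\<omega>. L (r0 + (h + k)) \<omega> - L (r0 + h) \<omega>"
  have st: "r0 \<le> r0 + h" "r0 + h \<le> r0 + (h + k)" using hk by auto
  note d = increment_moments[OF st]
  have [measurable]: "L (r0 + h) \<in> borel_measurable M" "L (r0 + (h + k)) \<in> borel_measurable M"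
    "L (r0 + h) \<in> borel_measurable (F (r0 + h))"
    using st by (auto intro!: L_meas_M L_meas)
  have X4: "integrable M (\<lambda>\<omega>. (?X \<omega>)^4)" using fourth_moment st by auto
  have X3: "integrable M (\<lambda>\<omega>. (?X \<omega>)^3)"
  proof (rule Bochner_Integration.integrable_bound)
    show "integrable M (\<lambda>\<omega>. 1 + (?X \<omega>)^4)" using X4 by auto
    show "AE \<omega> in M. norm ((?X \<omega>)^3) \<le> norm (1 + (?X \<omega>)^4)"
      using abs_cube_le[of "?X _"] by (auto simp: power_abs add_nonneg_nonneg)
  qed auto
  have D3: "integrable M (\<lambda>\<omega>. (?D \<omega>)^3)"
  proof (rule Bochner_Integration.integrable_bound)
    show "integrable M (\<lambda>\<omega>. 1 + (?D \<omega>)^4)" using d(3) by auto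
    show "AE \<omega> in M. norm ((?D \<omega>)^3) \<le> norm (1 + (?D \<omega>)^4)"
      using abs_cube_le[of "?D _"] by (auto simp: power_abs add_nonneg_nonneg)
  qed auto
  have c: "integrable M (\<lambda>\<omega>. (?X \<omega>)^3 * ?D \<omega>)" "(\<integral>\<omega>. (?X \<omega>)^3 * ?D \<omega> \<partial>M) = 0"
    by (rule integral_F_increment[OF st _ X3], measurable)+
  \<comment> \<open>Here it is the past factor that has mean zero: independence gives E[X] E[D^3]
    with E[X] = 0. For k = 0 the increment vanishes identically.\<close>
  have e: "integrable M (\<lambda>\<omega>. ?X \<omega> * (?D \<omega>)^3) \<and> (\<integral>\<omega>. ?X \<omega> * (?D \<omega>)^3 \<partial>M) = 0"
  proof (cases "k = 0")
    case False
    then have st': "r0 + h < r0 + (h + k)" using hk by simp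
    have i: "indep_var borel ?X borel (\<lambda>\<omega>. (?D \<omega>)^3)"
      by (rule indep_increment[OF st(1) st']) auto
    show ?thesis
      using indep_var_integrable[OF i L_integrable[OF st(1)] D3]
        indep_var_lebesgue_integral[OF i L_integrable[OF st(1)] D3] centred[OF st(1)] by simp
  qed simp
  have "moment4 h + moment4 k = (\<integral>\<omega>. (?X \<omega>)^4 + (?D \<omega>)^4 + 4 * ((?X \<omega>)^3 * ?D \<omega>) + 4 * (?X \<omega> * (?D \<omega>)^3) \<partial>M)"
    using c e d X4 by (simp add: moment4_def)
  also have "\<dots> \<le> (\<integral>\<omega>. (L (r0 + (h + k)) \<omega>)^4 \<partial>M)"
  proof (rule integral_mono)
    show "integrable M (\<lambda>\<omega>. (L (r0 + (h + k)) \<omega>)^4)" using fourth_moment hk by auto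
    show "(?X \<omega>)^4 + (?D \<omega>)^4 + 4 * ((?X \<omega>)^3 * ?D \<omega>) + 4 * (?X \<omega> * (?D \<omega>)^3) \<le> (L (r0 + (h + k)) \<omega>)^4" for \<omega>
      using fourth_power_superadd[of "?X \<omega>" "?D \<omega>"] by simp
  qed (use c e d X4 in auto)
  finally show ?thesis by (simp add: moment4_def)
qed

end

section \<open>The quadratic variation clock\<close>

lemma nn_integral_limit_le:
  assumes [measurable]: "\<And>n. u n \<in> borel_measurable M"
    and lim: "AE x in M. (\<lambda>n. u n x) \<longlonglongrightarrow> v x" and le: "\<And>n. (\<integral>\<^sup>+x. u n x \<partial>M) \<le> C"
  shows "(\<integral>\<^sup>+x. v x \<partial>M) \<le> (C::ennreal)"
proof -
  have "(\<integral>\<^sup>+x. v x \<partial>M) = (\<integral>\<^sup>+x. liminf (\<lambda>n. u n x) \<partial>M)"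
    using lim by (intro nn_integral_cong_AE) (auto elim!: eventually_mono dest: lim_imp_Liminf[rotated])
  also have "\<dots> \<le> liminf (\<lambda>n. \<integral>\<^sup>+x. u n x \<partial>M)" by (rule nn_integral_liminf) measurable
  also have "\<dots> \<le> C" using le by (intro Liminf_le) auto
  finally show ?thesis .
qed

text \<open>A finite set K carries the sum up to e, and for t' below all points of K only the
  remainder is left. This yields right continuity of the sum of squared jumps.\<close>

lemma infsum_at_right_tendsto_0:
  fixes f :: "real \<Rightarrow> real"
  assumes s: "f summable_on {t<..T}" and t: "t < T" and nn: "\<And>u. 0 \<le> f u"
  shows "((\<lambda>t'. \<Sum>\<^sub>\<infinity>u\<in>{t<..t'}. f u) \<longlongrightarrow> 0) (at_right t)"
proof (rule order_tendstoI)
  fix e :: real assume "e < 0"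
  moreover have "0 \<le> (\<Sum>\<^sub>\<infinity>u\<in>{t<..t'}. f u)" for t' by (intro infsum_nonneg nn)
  ultimately show "eventually (\<lambda>t'. e < (\<Sum>\<^sub>\<infinity>u\<in>{t<..t'}. f u)) (at_right t)"
    by (intro always_eventually) (auto intro: less_le_trans)
next
  fix e :: real assume e: "0 < e"
  let ?I = "{t<..T}"
  have "(SUP K\<in>{K. finite K \<and> K \<subseteq> ?I}. \<Sum>u\<in>K. f u) > (\<Sum>\<^sub>\<infinity>u\<in>?I. f u) - e"
    using infsum_nonneg_is_SUPREMUM_real[OF s] nn e by auto
  then obtain K where K: "finite K" "K \<subseteq> ?I" "(\<Sum>\<^sub>\<infinity>u\<in>?I. f u) - e < (\<Sum>u\<in>K. f u)"
    by (subst (asm) less_cSUP_iff) (auto intro!: bdd_aboveI2 finite_sum_le_infsum[OF s] nn)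
  \<comment> \<open>T is inserted so that the minimum exists for empty K and lies in (t, T].\<close>
  define m where "m = Min (insert T K)"
  have m: "t < m" "m \<le> T" "\<And>u. u \<in> K \<Longrightarrow> m \<le> u"
    using K t unfolding m_def by (auto simp: Min_gr_iff)
  have "eventually (\<lambda>t'. t' \<in> {t<..<m}) (at_right t)" using m(1) by (rule eventually_at_right_real)
  then show "eventually (\<lambda>t'. (\<Sum>\<^sub>\<infinity>u\<in>{t<..t'}. f u) < e) (at_right t)"
  proof eventually_elim
    case (elim t')
    have sub: "{t<..t'} \<subseteq> ?I - K" using elim m by force
    have s2: "f summable_on (?I - K)" by (rule summable_on_subset_banach[OF s]) auto
    have "(\<Sum>\<^sub>\<infinity>u\<in>{t<..t'}. f u) \<le> (\<Sum>\<^sub>\<infinity>u\<in>?I - K. f u)"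
      by (intro infsum_mono_neutral summable_on_subset_banach[OF s2 sub] s2) (use sub nn in auto)
    also have "\<dots> = (\<Sum>\<^sub>\<infinity>u\<in>?I. f u) - (\<Sum>\<^sub>\<infinity>u\<in>K. f u)"
      by (rule infsum_Diff[OF s]) (use K in auto)
    finally show ?case using K by simp
  qed
qed

text \<open>In other words, the conditional first and second moments of an increment given the past
  are at most C (t - s), with C uniform up to the horizon T; testing against nonnegative
  past-measurable Y replaces conditional expectations. Both powers are linear in t - s, which is
  what a Gronwall recursion over small cells requires.\<close>

definition moment_clock :: "'a measure \<Rightarrow> real \<Rightarrow> (real \<Rightarrow> 'a measure) \<Rightarrow> ('a \<Rightarrow> real \<Rightarrow> real) \<Rightarrow> bool" where
  "moment_clock M r0 F A \<longleftrightarrow>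
     (\<forall>\<omega>\<in>space M. stieltjes (A \<omega>)) \<and>
     (\<forall>t\<ge>r0. (\<lambda>\<omega>. A \<omega> t) \<in> borel_measurable (F t)) \<and>
     (\<forall>T. \<exists>C\<ge>0. \<forall>s t Y. r0 \<le> s \<longrightarrow> s \<le> t \<longrightarrow> t \<le> T \<longrightarrow> Y \<in> borel_measurable (F s) \<longrightarrow> (\<forall>\<omega>. 0 \<le> Y \<omega>) \<longrightarrow>
       (\<integral>\<^sup>+\<omega>. ennreal (Y \<omega> * (A \<omega> t - A \<omega> s)) \<partial>M) \<le> ennreal (C * (t - s)) * (\<integral>\<^sup>+\<omega>. ennreal (Y \<omega>) \<partial>M) \<and>
       (\<integral>\<^sup>+\<omega>. ennreal (Y \<omega> * (A \<omega> t - A \<omega> s)\<^sup>2) \<partial>M) \<le> ennreal (C * (t - s)) * (\<integral>\<^sup>+\<omega>. ennreal (Y \<omega>) \<partial>M))"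

context levy_fourth_moment
begin

section \<open>Squared increments along a grid\<close>

definition qsum :: "real \<Rightarrow> real \<Rightarrow> nat \<Rightarrow> nat \<Rightarrow> 'a \<Rightarrow> real" where
  "qsum s t n k \<omega> = (\<Sum>i<k. (L (grid s t n (Suc i)) \<omega> - L (grid s t n i) \<omega>)\<^sup>2)"

lemma qsum_nonneg [simp]: "0 \<le> qsum s t n k \<omega>"
  unfolding qsum_def by (intro sum_nonneg) auto

lemma qsum_Suc: "qsum s t n (Suc k) \<omega> = qsum s t n k \<omega> + (L (grid s t n (Suc k)) \<omega> - L (grid s t n k) \<omega>)\<^sup>2"
  by (simp add: qsum_def)

context
  fixes s t :: real
  assumes st: "r0 \<le> s" "s \<le> t"
begin

lemma r0_le_grid: "r0 \<le> grid s t n k"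
  using grid_mono[OF st(2), of 0 k n] st by simp

lemma qsum_meas: "qsum s t n k \<in> borel_measurable (F (grid s t n k))"
  unfolding qsum_def
  by (intro borel_measurable_sum borel_measurable_power borel_measurable_diff L_meas r0_le_grid grid_mono st)
     (auto simp del: grid_last)

lemma F_grid: "Y \<in> borel_measurable (F s) \<Longrightarrow> Y \<in> borel_measurable (F (grid s t n k))"
  by (erule measurable_F_mono) (use st grid_mono[OF st(2), of 0 k n] in auto)

context
  fixes Y :: "'a \<Rightarrow> ennreal" and n :: nat and d :: real
  assumes Y: "Y \<in> borel_measurable (F s)" and d: "d = (t - s) / real (Suc n)"
begin

lemma grid_step: "grid s t n (Suc k) - grid s t n k = d"
  unfolding grid_Suc d by simp

text \<open>Induction over the cells: the next squared increment is independent of the past at its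
  left grid point, to which Y belongs.\<close>

lemma nn_integral_qsum: "(\<integral>\<^sup>+\<omega>. Y \<omega> * ennreal (qsum s t n k \<omega>) \<partial>M) = (\<integral>\<^sup>+\<omega>. Y \<omega> \<partial>M) * ennreal (real k * moment2 d)"
proof (induction k)
  case (Suc k)
  let ?g = "grid s t n"
  have [measurable]: "Y \<in> borel_measurable M" "qsum s t n k \<in> borel_measurable M"
    "L (?g k) \<in> borel_measurable M" "L (?g (Suc k)) \<in> borel_measurable M"
    using measurable_F_M[OF Y st(1)] measurable_F_M[OF qsum_meas r0_le_grid] L_meas_M[OF r0_le_grid] by auto
  have "(\<integral>\<^sup>+\<omega>. Y \<omega> * ennreal (qsum s t n (Suc k) \<omega>) \<partial>M) =
     (\<integral>\<^sup>+\<omega>. Y \<omega> * ennreal (qsum s t n k \<omega>) + Y \<omega> * ennreal ((L (?g (Suc k)) \<omega> - L (?g k) \<omega>)\<^sup>2) \<partial>M)"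
    by (intro nn_integral_cong) (simp add: qsum_Suc ennreal_plus distrib_left)
  also have "\<dots> = (\<integral>\<^sup>+\<omega>. Y \<omega> \<partial>M) * ennreal (real k * moment2 d) + (\<integral>\<^sup>+\<omega>. Y \<omega> \<partial>M) * ennreal (moment2 d)"
    using nn_integral_increment2[OF r0_le_grid grid_mono[OF st(2)] F_grid[OF Y], of k "Suc k" n]
    by (subst nn_integral_add) (auto simp: Suc grid_step)
  also have "\<dots> = (\<integral>\<^sup>+\<omega>. Y \<omega> \<partial>M) * ennreal (real (Suc k) * moment2 d)"
    unfolding distrib_left[symmetric]
    by (subst ennreal_plus[symmetric]) (auto simp: moment2_nonneg algebra_simps)
  finally show ?case .
qed (simp add: qsum_def)

text \<open>Expanding (Q + D^2)^2, the cross term 2 Q D^2 splits by independence, with E[Y Q] known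
  from \<open>nn_integral_qsum\<close>, and D^4 produces the fourth moment. No Gronwall factor
  appears because the cross term is linear in Q.\<close>

lemma nn_integral_qsum_sq: "(\<integral>\<^sup>+\<omega>. Y \<omega> * ennreal ((qsum s t n k \<omega>)\<^sup>2) \<partial>M) \<le>
    (\<integral>\<^sup>+\<omega>. Y \<omega> \<partial>M) * ennreal (real k * moment4 d + (real k * moment2 d)\<^sup>2)"
proof (induction k)
  case (Suc k)
  let ?g = "grid s t n" and ?E = "\<integral>\<^sup>+\<omega>. Y \<omega> \<partial>M"
  let ?D = "\<lambda>\<omega>. L (?g (Suc k)) \<omega> - L (?g k) \<omega>" and ?Q = "qsum s t n k"
  have [measurable]: "Y \<in> borel_measurable M" "?Q \<in> borel_measurable M"
    "L (?g k) \<in> borel_measurable M" "L (?g (Suc k)) \<in> borel_measurable M"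
    using measurable_F_M[OF Y st(1)] measurable_F_M[OF qsum_meas r0_le_grid] L_meas_M[OF r0_le_grid] by auto
  have YF: "Y \<in> borel_measurable (F (?g k))" by (rule F_grid[OF Y])
  have YQ: "(\<lambda>\<omega>. 2 * (Y \<omega> * ennreal (?Q \<omega>))) \<in> borel_measurable (F (?g k))"
    using YF qsum_meas[of n k] by measurable
  have le: "?g k \<le> ?g (Suc k)" by (rule grid_mono[OF st(2)]) simp
  have sq: "(?Q \<omega> + (?D \<omega>)\<^sup>2)\<^sup>2 = (?Q \<omega>)\<^sup>2 + (2 * ?Q \<omega> * (?D \<omega>)\<^sup>2 + (?D \<omega>)^4)" for \<omega>
    by (simp add: power2_eq_square power4_eq_xxxx algebra_simps)
  have "(\<integral>\<^sup>+\<omega>. Y \<omega> * ennreal ((qsum s t n (Suc k) \<omega>)\<^sup>2) \<partial>M) =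
     (\<integral>\<^sup>+\<omega>. Y \<omega> * ennreal ((?Q \<omega>)\<^sup>2) + ((2 * (Y \<omega> * ennreal (?Q \<omega>))) * ennreal ((?D \<omega>)\<^sup>2) + Y \<omega> * ennreal ((?D \<omega>)^4)) \<partial>M)"
    unfolding qsum_Suc sq
    by (intro nn_integral_cong) (simp add: ennreal_plus distrib_left ennreal_mult mult_ac)
  also have "\<dots> = (\<integral>\<^sup>+\<omega>. Y \<omega> * ennreal ((?Q \<omega>)\<^sup>2) \<partial>M) +
      ((\<integral>\<^sup>+\<omega>. (2 * (Y \<omega> * ennreal (?Q \<omega>))) * ennreal ((?D \<omega>)\<^sup>2) \<partial>M) + (\<integral>\<^sup>+\<omega>. Y \<omega> * ennreal ((?D \<omega>)^4) \<partial>M))"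
    by (subst nn_integral_add, measurable, subst nn_integral_add, measurable)
  also have "\<dots> = (\<integral>\<^sup>+\<omega>. Y \<omega> * ennreal ((?Q \<omega>)\<^sup>2) \<partial>M) +
      ((2 * (?E * ennreal (real k * moment2 d))) * ennreal (moment2 d) + ?E * ennreal (moment4 d))"
    unfolding nn_integral_increment2[OF r0_le_grid le YQ] nn_integral_increment4[OF r0_le_grid le YF] grid_step
    by (subst nn_integral_cmult) (auto simp: nn_integral_qsum)
  also have "\<dots> \<le> ?E * ennreal (real k * moment4 d + (real k * moment2 d)\<^sup>2) +
      ((2 * (?E * ennreal (real k * moment2 d))) * ennreal (moment2 d) + ?E * ennreal (moment4 d))"
    by (intro add_right_mono Suc)
  also have "\<dots> = ?E * ennreal (real k * moment4 d + (real k * moment2 d)\<^sup>2 + (2 * (real k * moment2 d) * moment2 d + moment4 d))"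
    using moment2_nonneg[of d] moment4_nonneg[of d] by (simp add: ennreal_plus ennreal_mult distrib_left mult_ac)
  \<comment> \<open>The cross term 2 k fits into (k + 1)^2 - k^2 = 2 k + 1.\<close>
  also have "\<dots> \<le> ?E * ennreal (real (Suc k) * moment4 d + (real (Suc k) * moment2 d)\<^sup>2)"
    using moment2_nonneg[of d] moment4_nonneg[of d]
    by (intro mult_left_mono ennreal_leI) (auto simp: power2_eq_square algebra_simps)
  finally show ?case .
qed (simp add: qsum_def)

text \<open>Superadditivity turns \<open>Suc n\<close> moments of the mesh width into one moment of
  t - s, so the bounds no longer depend on the grid.\<close>

lemma nn_integral_qsum_le:
  shows "(\<integral>\<^sup>+\<omega>. Y \<omega> * ennreal (qsum s t n (Suc n) \<omega>) \<partial>M) \<le> (\<integral>\<^sup>+\<omega>. Y \<omega> \<partial>M) * ennreal (moment2 (t - s))"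
    and "(\<integral>\<^sup>+\<omega>. Y \<omega> * ennreal ((qsum s t n (Suc n) \<omega>)\<^sup>2) \<partial>M) \<le>
      (\<integral>\<^sup>+\<omega>. Y \<omega> \<partial>M) * ennreal (moment4 (t - s) + (moment2 (t - s))\<^sup>2)"
proof -
  have dn: "real (Suc n) * d = t - s" and d0: "0 \<le> d" using st unfolding d by auto
  have 2: "real (Suc n) * moment2 d \<le> moment2 (t - s)" and 4: "real (Suc n) * moment4 d \<le> moment4 (t - s)"
    using superadditive_multiple[of moment2 d "Suc n"] superadditive_multiple[of moment4 d "Suc n"]
      moment2_nonneg moment4_nonneg moment2_superadd moment4_superadd d0 unfolding dn by auto
  show "(\<integral>\<^sup>+\<omega>. Y \<omega> * ennreal (qsum s t n (Suc n) \<omega>) \<partial>M) \<le> (\<integral>\<^sup>+\<omega>. Y \<omega> \<partial>M) * ennreal (moment2 (t - s))"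
    unfolding nn_integral_qsum using 2 by (intro mult_left_mono ennreal_leI) auto
  have "(real (Suc n) * moment2 d)\<^sup>2 \<le> (moment2 (t - s))\<^sup>2" using 2 moment2_nonneg[of d] by (intro power_mono) auto
  then show "(\<integral>\<^sup>+\<omega>. Y \<omega> * ennreal ((qsum s t n (Suc n) \<omega>)\<^sup>2) \<partial>M) \<le>
      (\<integral>\<^sup>+\<omega>. Y \<omega> \<partial>M) * ennreal (moment4 (t - s) + (moment2 (t - s))\<^sup>2)"
    using 4 by (intro order_trans[OF nn_integral_qsum_sq] mult_left_mono ennreal_leI) auto
qed

end

end

section \<open>Sums of squared jumps\<close>

definition jump :: "'a \<Rightarrow> real \<Rightarrow> real" where
  "jump \<omega> u = L u \<omega> - left_lim (\<lambda>v. L v \<omega>) u"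

text \<open>The thresholded counterpart of \<open>jumpsq\<close>: only finitely many terms are
  nonzero, and it is a limit of grid sums, hence adapted. It increases with k.\<close>

definition jcut :: "nat \<Rightarrow> real \<Rightarrow> real \<Rightarrow> 'a \<Rightarrow> real" where
  "jcut k s t \<omega> = (\<Sum>\<^sub>\<infinity>u\<in>{s<..t}. soft_sq (1 / real (Suc k)) (jump \<omega> u))"

lemma jumpsq_eq: "jumpsq L \<omega> s t = (\<Sum>\<^sub>\<infinity>u\<in>{s<..t}. (jump \<omega> u)\<^sup>2)"
  unfolding jumpsq_def jump_def ..

lemma jumpsq_nonneg [simp]: "0 \<le> jumpsq L \<omega> s t"
  unfolding jumpsq_eq by (intro infsum_nonneg) auto

lemma jcut_nonneg [simp]: "0 \<le> jcut k s t \<omega>"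
  unfolding jcut_def by (intro infsum_nonneg) auto

lemma
  assumes \<omega>: "\<omega> \<in> space M" and st: "r0 \<le> s" "s < t"
  shows jcut_finite': "finite {u\<in>{s<..t}. soft_sq (1 / real (Suc k)) (jump \<omega> u) \<noteq> 0}"
    and jcut_limit: "(\<lambda>n. \<Sum>i<Suc n. soft_sq (1 / real (Suc k)) (L (grid s t n (Suc i)) \<omega> - L (grid s t n i) \<omega>))
      \<longlonglongrightarrow> jcut k s t \<omega>"
proof -
  have c: "cadlag_on s t (\<lambda>u. L u \<omega>)" by (rule cadlag_from_imp_on[OF L_cadlag[OF \<omega>] st(1)])
  have e: "0 < 1 / real (Suc k)" by simp
  note l = cadlag_jump_sum_limit[OF c st(2) continuous_on_soft_sq e soft_sq_small]
  show "finite {u\<in>{s<..t}. soft_sq (1 / real (Suc k)) (jump \<omega> u) \<noteq> 0}" unfolding jump_def by (rule l(1))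
  show "(\<lambda>n. \<Sum>i<Suc n. soft_sq (1 / real (Suc k)) (L (grid s t n (Suc i)) \<omega> - L (grid s t n i) \<omega>))
      \<longlonglongrightarrow> jcut k s t \<omega>" unfolding jcut_def jump_def by (rule l(2))
qed

lemma jcut_finite:
  assumes \<omega>: "\<omega> \<in> space M" and st: "r0 \<le> s"
  shows "finite {u\<in>{s<..t}. soft_sq (1 / real (Suc k)) (jump \<omega> u) \<noteq> 0}"
  using jcut_finite'[OF assms] by (cases "s < t") auto

lemma jcut_meas:
  assumes st: "r0 \<le> s" "s \<le> t"
  shows "jcut k s t \<in> borel_measurable (F t)"
proof (cases "s = t")
  case True
  then have "jcut k s t = (\<lambda>_. 0)" unfolding jcut_def by auto
  then show ?thesis by simp
next
  case False
  then have s: "s < t" using st by simp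
  show ?thesis
  proof (rule borel_measurable_LIMSEQ_real)
    show "(\<lambda>n. \<Sum>i<Suc n. soft_sq (1 / real (Suc k)) (L (grid s t n (Suc i)) \<omega> - L (grid s t n i) \<omega>))
      \<longlonglongrightarrow> jcut k s t \<omega>" if "\<omega> \<in> space (F t)" for \<omega>
      using that st by (intro jcut_limit s) (auto simp: space_F)
    have L: "L (grid s t n i) \<in> borel_measurable (F t)" if "i \<le> Suc n" for n i
      using grid_bounds[OF st(2) that] st by (intro L_meas) auto
    have "(\<lambda>\<omega>. soft_sq (1 / real (Suc k)) (L (grid s t n (Suc i)) \<omega> - L (grid s t n i) \<omega>)) \<in> borel_measurable (F t)"
      if "i < Suc n" for i n
      using that by (intro measurable_compose[OF _ soft_sq_measurable] borel_measurable_diff L) auto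
    then show "(\<lambda>\<omega>. \<Sum>i<Suc n. soft_sq (1 / real (Suc k)) (L (grid s t n (Suc i)) \<omega> - L (grid s t n i) \<omega>))
       \<in> borel_measurable (F t)" for n
      by (intro borel_measurable_sum) auto
  qed
qed

text \<open>The thresholded grid sums lie below the sums of squared increments, so the grid-free
  bounds pass to the limit by Fatou. The comparison is one-sided: a Gaussian part only enlarges the
  upper bound.\<close>

lemma nn_integral_jcut:
  assumes st: "r0 \<le> s" "s \<le> t" and Y: "Y \<in> borel_measurable (F s)" "\<And>\<omega>. 0 \<le> Y \<omega>"
  shows "(\<integral>\<^sup>+\<omega>. ennreal (Y \<omega> * jcut k s t \<omega>) \<partial>M) \<le> (\<integral>\<^sup>+\<omega>. ennreal (Y \<omega>) \<partial>M) * ennreal (moment2 (t - s))"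
    and "(\<integral>\<^sup>+\<omega>. ennreal (Y \<omega> * (jcut k s t \<omega>)\<^sup>2) \<partial>M) \<le>
      (\<integral>\<^sup>+\<omega>. ennreal (Y \<omega>) \<partial>M) * ennreal (moment4 (t - s) + (moment2 (t - s))\<^sup>2)"
proof -
  have YM[measurable]: "Y \<in> borel_measurable M" using measurable_F_M[OF Y(1) st(1)] .
  have eY: "(\<lambda>\<omega>. ennreal (Y \<omega>)) \<in> borel_measurable (F s)" using Y(1) by measurable
  define W where "W n \<omega> = (\<Sum>i<Suc n. soft_sq (1 / real (Suc k)) (L (grid s t n (Suc i)) \<omega> - L (grid s t n i) \<omega>))" for n \<omega>
  have [measurable]: "L (grid s t n i) \<in> borel_measurable M" for n i by (intro L_meas_M r0_le_grid st)
  have [measurable]: "W n \<in> borel_measurable M" for n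
    unfolding W_def by measurable
  have W0: "0 \<le> W n \<omega>" for n \<omega> unfolding W_def by (intro sum_nonneg) auto
  have WQ: "W n \<omega> \<le> qsum s t n (Suc n) \<omega>" for n \<omega>
    unfolding W_def qsum_def by (intro sum_mono soft_sq_le) simp
  have lim: "(\<lambda>n. W n \<omega>) \<longlonglongrightarrow> jcut k s t \<omega>" if "\<omega> \<in> space M" for \<omega>
  proof (cases "s = t")
    case True
    then show ?thesis by (auto simp: W_def jcut_def grid_def soft_sq_small)
  next
    case False
    then show ?thesis unfolding W_def using st by (intro jcut_limit that) auto
  qed
  show "(\<integral>\<^sup>+\<omega>. ennreal (Y \<omega> * jcut k s t \<omega>) \<partial>M) \<le> (\<integral>\<^sup>+\<omega>. ennreal (Y \<omega>) \<partial>M) * ennreal (moment2 (t - s))"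
  proof (rule nn_integral_limit_le)
    show "(\<lambda>\<omega>. ennreal (Y \<omega> * W n \<omega>)) \<in> borel_measurable M" for n by measurable
    show "AE \<omega> in M. (\<lambda>n. ennreal (Y \<omega> * W n \<omega>)) \<longlonglongrightarrow> ennreal (Y \<omega> * jcut k s t \<omega>)"
      by (intro AE_I2 tendsto_ennrealI tendsto_mult_left lim)
    have "(\<integral>\<^sup>+\<omega>. ennreal (Y \<omega> * W n \<omega>) \<partial>M) \<le> (\<integral>\<^sup>+\<omega>. ennreal (Y \<omega>) * ennreal (qsum s t n (Suc n) \<omega>) \<partial>M)" for n
      unfolding ennreal_mult[OF Y(2) W0] by (intro nn_integral_mono mult_left_mono ennreal_leI WQ) auto
    then show "(\<integral>\<^sup>+\<omega>. ennreal (Y \<omega> * W n \<omega>) \<partial>M) \<le> (\<integral>\<^sup>+\<omega>. ennreal (Y \<omega>) \<partial>M) * ennreal (moment2 (t - s))" for n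
      using nn_integral_qsum_le(1)[OF st eY refl] order_trans by blast
  qed
  show "(\<integral>\<^sup>+\<omega>. ennreal (Y \<omega> * (jcut k s t \<omega>)\<^sup>2) \<partial>M) \<le>
      (\<integral>\<^sup>+\<omega>. ennreal (Y \<omega>) \<partial>M) * ennreal (moment4 (t - s) + (moment2 (t - s))\<^sup>2)"
  proof (rule nn_integral_limit_le)
    show "(\<lambda>\<omega>. ennreal (Y \<omega> * (W n \<omega>)\<^sup>2)) \<in> borel_measurable M" for n by measurable
    show "AE \<omega> in M. (\<lambda>n. ennreal (Y \<omega> * (W n \<omega>)\<^sup>2)) \<longlonglongrightarrow> ennreal (Y \<omega> * (jcut k s t \<omega>)\<^sup>2)"
      by (intro AE_I2 tendsto_ennrealI tendsto_mult_left tendsto_power lim)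
    have "(\<integral>\<^sup>+\<omega>. ennreal (Y \<omega> * (W n \<omega>)\<^sup>2) \<partial>M) \<le> (\<integral>\<^sup>+\<omega>. ennreal (Y \<omega>) * ennreal ((qsum s t n (Suc n) \<omega>)\<^sup>2) \<partial>M)" for n
      unfolding ennreal_mult[OF Y(2) zero_le_power2]
      by (intro nn_integral_mono mult_left_mono ennreal_leI power_mono WQ W0) auto
    then show "(\<integral>\<^sup>+\<omega>. ennreal (Y \<omega> * (W n \<omega>)\<^sup>2) \<partial>M) \<le>
        (\<integral>\<^sup>+\<omega>. ennreal (Y \<omega>) \<partial>M) * ennreal (moment4 (t - s) + (moment2 (t - s))\<^sup>2)" for n
      using nn_integral_qsum_le(2)[OF st eY refl] order_trans by blast
  qed
qed

text \<open>An infinite sum that does not converge has the default value 0, so off this event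
  \<open>jumpsq\<close> may drop back to 0 and S may fail to be monotone. Integer horizons make the
  event a countable intersection.\<close>

definition jumps_summable :: "'a \<Rightarrow> bool" where
  "jumps_summable \<omega> \<longleftrightarrow> (\<forall>n::nat. (\<lambda>u. (jump \<omega> u)\<^sup>2) summable_on {r0<..r0 + real n})"

text \<open>Monotone convergence in the threshold: the supremum of the thresholded sums has finite
  expectation, hence is almost surely finite, and it bounds all finite sums of squared
  jumps.\<close>

lemma AE_jumps_summable: "AE \<omega> in M. jumps_summable \<omega>"
  unfolding jumps_summable_def AE_all_countable
proof
  fix n :: nat
  let ?t = "r0 + real n"
  have [measurable]: "jcut k r0 ?t \<in> borel_measurable M" for k
    by (rule measurable_F_M[OF jcut_meas]) auto
  have "(\<integral>\<^sup>+\<omega>. (SUP k. ennreal (jcut k r0 ?t \<omega>)) \<partial>M) = (SUP k. \<integral>\<^sup>+\<omega>. ennreal (jcut k r0 ?t \<omega>) \<partial>M)"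
  proof (rule nn_integral_monotone_convergence_SUP_AE)
    have "jcut k r0 ?t \<omega> \<le> jcut (Suc k) r0 ?t \<omega>" if "\<omega> \<in> space M" for \<omega> k
      unfolding jcut_def using that by (intro soft_infsum_mono jcut_finite) (auto simp: field_simps)
    then show "AE \<omega> in M. ennreal (jcut k r0 ?t \<omega>) \<le> ennreal (jcut (Suc k) r0 ?t \<omega>)" for k
      by (intro AE_I2 ennreal_leI)
  qed auto
  also have "\<dots> \<le> ennreal (moment2 (real n))"
    using nn_integral_jcut(1)[of r0 ?t "\<lambda>_. 1"] emeasure_space_1 by (intro SUP_least) auto
  also have "\<dots> < \<infinity>" by simp
  finally have "AE \<omega> in M. (SUP k. ennreal (jcut k r0 ?t \<omega>)) \<noteq> \<infinity>"
    by (intro nn_integral_noteq_infinite) auto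
  then show "AE \<omega> in M. (\<lambda>u. (jump \<omega> u)\<^sup>2) summable_on {r0<..?t}"
  proof (rule AE_mp, intro AE_I2 impI)
    fix \<omega> assume \<omega>: "\<omega> \<in> space M" and f: "(SUP k. ennreal (jcut k r0 ?t \<omega>)) \<noteq> \<infinity>"
    then obtain B where B: "0 \<le> B" "(SUP k. ennreal (jcut k r0 ?t \<omega>)) = ennreal B"
      by (metis ennreal_cases infinity_ennreal_def)
    have "jcut k r0 ?t \<omega> \<le> B" for k
      using SUP_upper[of k UNIV "\<lambda>k. ennreal (jcut k r0 ?t \<omega>)"] B by simp
    then show "(\<lambda>u. (jump \<omega> u)\<^sup>2) summable_on {r0<..?t}"
      unfolding jcut_def by (intro soft_sum_bounded_imp_summable jcut_finite[OF \<omega>]) auto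
  qed
qed

lemma jumps_summable_Ioc:
  assumes "jumps_summable \<omega>" "r0 \<le> s"
  shows "(\<lambda>u. (jump \<omega> u)\<^sup>2) summable_on {s<..t}"
proof -
  obtain n :: nat where "t - r0 \<le> real n" using real_arch_simple by blast
  then have "{s<..t} \<subseteq> {r0<..r0 + real n}" using assms(2) by auto
  moreover have "(\<lambda>u. (jump \<omega> u)\<^sup>2) summable_on {r0<..r0 + real n}" using assms(1) unfolding jumps_summable_def by blast
  ultimately show ?thesis using summable_on_subset_banach by blast
qed

lemma jumpsq_combine:
  assumes "jumps_summable \<omega>" "r0 \<le> s" "s \<le> t"
  shows "jumpsq L \<omega> r0 t = jumpsq L \<omega> r0 s + jumpsq L \<omega> s t"
proof -
  have "{r0<..t} = {r0<..s} \<union> {s<..t}" using assms by auto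
  then show ?thesis unfolding jumpsq_eq
    using infsum_Un_disjoint[OF jumps_summable_Ioc[OF assms(1) order_refl, of s] jumps_summable_Ioc[OF assms(1,2), of t]] by auto
qed

lemma jcut_tendsto:
  assumes "\<omega> \<in> space M" "jumps_summable \<omega>" "r0 \<le> s"
  shows "(\<lambda>k. jcut k s t \<omega>) \<longlonglongrightarrow> jumpsq L \<omega> s t"
  unfolding jcut_def jumpsq_eq using assms by (intro soft_infsum_tendsto jcut_finite jumps_summable_Ioc)

text \<open>A second passage through Fatou, now with the threshold tending to 0.\<close>

lemma nn_integral_jumpsq:
  assumes st: "r0 \<le> s" "s \<le> t" and Y: "Y \<in> borel_measurable (F s)" "\<And>\<omega>. 0 \<le> Y \<omega>"
  shows "(\<integral>\<^sup>+\<omega>. ennreal (Y \<omega> * jumpsq L \<omega> s t) \<partial>M) \<le> (\<integral>\<^sup>+\<omega>. ennreal (Y \<omega>) \<partial>M) * ennreal (moment2 (t - s))"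
    and "(\<integral>\<^sup>+\<omega>. ennreal (Y \<omega> * (jumpsq L \<omega> s t)\<^sup>2) \<partial>M) \<le>
      (\<integral>\<^sup>+\<omega>. ennreal (Y \<omega>) \<partial>M) * ennreal (moment4 (t - s) + (moment2 (t - s))\<^sup>2)"
proof -
  have [measurable]: "Y \<in> borel_measurable M" using measurable_F_M[OF Y(1) st(1)] .
  have [measurable]: "jcut k s t \<in> borel_measurable M" for k
    by (rule measurable_F_M[OF jcut_meas]) (use st in auto)
  have lim: "AE \<omega> in M. (\<lambda>k. jcut k s t \<omega>) \<longlonglongrightarrow> jumpsq L \<omega> s t"
    using AE_jumps_summable AE_space by eventually_elim (use jcut_tendsto st in auto)
  show "(\<integral>\<^sup>+\<omega>. ennreal (Y \<omega> * jumpsq L \<omega> s t) \<partial>M) \<le> (\<integral>\<^sup>+\<omega>. ennreal (Y \<omega>) \<partial>M) * ennreal (moment2 (t - s))"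
  proof (rule nn_integral_limit_le[OF _ _ nn_integral_jcut(1)[OF st Y]])
    show "AE \<omega> in M. (\<lambda>k. ennreal (Y \<omega> * jcut k s t \<omega>)) \<longlonglongrightarrow> ennreal (Y \<omega> * jumpsq L \<omega> s t)"
      using lim by eventually_elim (intro tendsto_ennrealI tendsto_mult_left)
  qed measurable
  show "(\<integral>\<^sup>+\<omega>. ennreal (Y \<omega> * (jumpsq L \<omega> s t)\<^sup>2) \<partial>M) \<le>
      (\<integral>\<^sup>+\<omega>. ennreal (Y \<omega>) \<partial>M) * ennreal (moment4 (t - s) + (moment2 (t - s))\<^sup>2)"
  proof (rule nn_integral_limit_le[OF _ _ nn_integral_jcut(2)[OF st Y]])
    show "AE \<omega> in M. (\<lambda>k. ennreal (Y \<omega> * (jcut k s t \<omega>)\<^sup>2)) \<longlonglongrightarrow> ennreal (Y \<omega> * (jumpsq L \<omega> s t)\<^sup>2)"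
      using lim by eventually_elim (intro tendsto_ennrealI tendsto_mult_left tendsto_power)
  qed measurable
qed

text \<open>The comparison of jumps with increments for Y = 1 on a unit interval. It makes the
  linear part of S nondecreasing.\<close>

lemma gauss_var_nonneg: "0 \<le> gauss_var M r0 L"
proof -
  have "(\<integral>\<omega>. jumpsq L \<omega> r0 (r0 + 1) \<partial>M) \<le> moment2 1"
  proof (cases "integrable M (\<lambda>\<omega>. jumpsq L \<omega> r0 (r0 + 1))")
    case True
    then have "ennreal (\<integral>\<omega>. jumpsq L \<omega> r0 (r0 + 1) \<partial>M) = (\<integral>\<^sup>+\<omega>. ennreal (jumpsq L \<omega> r0 (r0 + 1)) \<partial>M)"
      by (intro nn_integral_eq_integral[symmetric]) auto
    also have "\<dots> \<le> ennreal (moment2 1)"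
      using nn_integral_jumpsq(1)[of r0 "r0 + 1" "\<lambda>_. 1"] emeasure_space_1 by simp
    finally show ?thesis using moment2_nonneg by simp
  next
    \<comment> \<open>The integral of a non-integrable function is 0 by default.\<close>
    case False
    then show ?thesis using moment2_nonneg by (simp add: not_integrable_integral_eq)
  qed
  then show ?thesis unfolding gauss_var_def moment2_def by simp
qed

text \<open>Monotonicity is additivity of the jump sum over adjacent intervals; right continuity
  holds because the sum over (x, y] tends to 0 as y decreases to x. To the left of \<open>r0\<close>
  the path is constantly 0.\<close>

lemma qv_path_stieltjes:
  assumes g: "jumps_summable \<omega>"
  shows "stieltjes (qv_path M r0 L \<omega>)"
proof
  let ?S = "qv_path M r0 L \<omega>"
  have z: "jumpsq L \<omega> r0 x = 0" if "x \<le> r0" for x using that by (simp add: jumpsq_def)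
  fix x y :: real
  {
    assume "x \<le> y"
    then have "jumpsq L \<omega> r0 x \<le> jumpsq L \<omega> r0 y"
      using jumpsq_combine[OF g, of x y] z[of x] by (cases "r0 \<le> x") auto
    moreover have "gauss_var M r0 L * max 0 (x - r0) \<le> gauss_var M r0 L * max 0 (y - r0)"
      using \<open>x \<le> y\<close> gauss_var_nonneg by (intro mult_left_mono) auto
    ultimately show "?S x \<le> ?S y" unfolding qv_path_def by (rule add_mono[rotated])
  }
  have "((\<lambda>y. jumpsq L \<omega> r0 y) \<longlongrightarrow> jumpsq L \<omega> r0 x) (at_right x)"
  proof (cases "r0 \<le> x")
    case True
    have "((\<lambda>y. jumpsq L \<omega> r0 x + jumpsq L \<omega> x y) \<longlongrightarrow> jumpsq L \<omega> r0 x + 0) (at_right x)"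
      unfolding jumpsq_eq
      by (intro tendsto_add tendsto_const infsum_at_right_tendsto_0[where T="x+1"] jumps_summable_Ioc[OF g True]) auto
    moreover have "eventually (\<lambda>y. jumpsq L \<omega> r0 x + jumpsq L \<omega> x y = jumpsq L \<omega> r0 y) (at_right x)"
      using eventually_at_right_less[of x]
      by eventually_elim (rule jumpsq_combine[OF g True less_imp_le, symmetric])
    ultimately have "((\<lambda>y. jumpsq L \<omega> r0 y) \<longlongrightarrow> jumpsq L \<omega> r0 x + 0) (at_right x)"
      by (rule Lim_transform_eventually)
    then show ?thesis by simp
  next
    case False
    have "eventually (\<lambda>y. y \<in> {x<..<r0}) (at_right x)" using False by (intro eventually_at_right_real) auto
    then have "eventually (\<lambda>y. 0 = jumpsq L \<omega> r0 y) (at_right x)" by eventually_elim (auto simp: z)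
    then have "((\<lambda>y. jumpsq L \<omega> r0 y) \<longlongrightarrow> 0) (at_right x)"
      by (rule Lim_transform_eventually[OF tendsto_const])
    then show ?thesis using False z[of x] by simp
  qed
  then show "continuous (at_right x) ?S"
    unfolding continuous_within qv_path_def by (intro tendsto_add tendsto_mult_left) (auto intro!: tendsto_intros)
qed

text \<open>S on the event of summable jumps and the identity elsewhere, so that every path defines
  a measure with mass A b - A a on (a, b]; it coincides almost surely with the S of the
  equation.\<close>

definition qclock :: "'a \<Rightarrow> real \<Rightarrow> real" where
  "qclock \<omega> = (if jumps_summable \<omega> then qv_path M r0 L \<omega> else (\<lambda>t. t))"

lemma qclock_stieltjes: "stieltjes (qclock \<omega>)"
  using qv_path_stieltjes stieltjes_id.stieltjes_axioms unfolding qclock_def by simp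

lemma qclock_meas:
  assumes t: "r0 \<le> t"
  shows "(\<lambda>\<omega>. qclock \<omega> t) \<in> borel_measurable (F t)"
proof -
  define G where "G = {\<omega>\<in>space M. jumps_summable \<omega>}"
  have G[measurable]: "G \<in> sets (F t)" unfolding G_def by (rule AE_sets_F[OF AE_jumps_summable t])
  have [measurable]: "jcut k r0 t \<in> borel_measurable (F t)" for k by (rule jcut_meas[OF order_refl t])
  \<comment> \<open>Multiplying by the indicator of the good event turns the almost sure limit into
    a limit at every sample point, and that event belongs to F t.\<close>
  have J: "(\<lambda>\<omega>. indicator G \<omega> * jumpsq L \<omega> r0 t) \<in> borel_measurable (F t)"
  proof (rule borel_measurable_LIMSEQ_real)
    show "(\<lambda>\<omega>. indicator G \<omega> * jcut k r0 t \<omega>) \<in> borel_measurable (F t)" for k by measurable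
    show "(\<lambda>k. indicator G \<omega> * jcut k r0 t \<omega>) \<longlonglongrightarrow> indicator G \<omega> * jumpsq L \<omega> r0 t" for \<omega>
      using jcut_tendsto[of \<omega> r0 t] by (cases "\<omega> \<in> G") (auto simp: G_def)
  qed
  have "(\<lambda>\<omega>. indicator G \<omega> * (gauss_var M r0 L * max 0 (t - r0)) + indicator G \<omega> * jumpsq L \<omega> r0 t
     + (1 - indicator G \<omega>) * t) \<in> borel_measurable (F t)"
    using J by measurable
  moreover have "indicator G \<omega> * (gauss_var M r0 L * max 0 (t - r0)) + indicator G \<omega> * jumpsq L \<omega> r0 t
     + (1 - indicator G \<omega>) * t = qclock \<omega> t" if "\<omega> \<in> space (F t)" for \<omega>
    using that space_F[OF t] by (auto simp: G_def qclock_def qv_path_def indicator_def)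
  ultimately show ?thesis by (rule measurable_cong[THEN iffD1, rotated])
qed

lemma qclock_moment_clock: "moment_clock M r0 F qclock"
  unfolding moment_clock_def
proof (intro conjI ballI allI impI)
  show "stieltjes (qclock \<omega>)" for \<omega> by (rule qclock_stieltjes)
  show "(\<lambda>\<omega>. qclock \<omega> t) \<in> borel_measurable (F t)" if "r0 \<le> t" for t by (rule qclock_meas[OF that])
  fix T :: real
  \<comment> \<open>Bounds every time span up to T and is positive also when T lies before
    \<open>r0\<close>, as the linear moment bounds require.\<close>
  define H where "H = max 1 (T - r0)"
  define \<gamma> where "\<gamma> = gauss_var M r0 L"
  define C2 where "C2 = 2 * moment2 H / H"
  define C4 where "C4 = 2 * moment4 H / H"
  \<comment> \<open>The first two summands serve the first moment of \<gamma> h + J. The others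
    serve its second moment, split as 2 (\<gamma> h)^2 + 2 J^2, with one factor h of each h^2
    replaced by H.\<close>
  define C where "C = \<gamma> + C2 + 2 * \<gamma>\<^sup>2 * H + 2 * (C4 + C2\<^sup>2 * H)"
  have H: "1 \<le> H" "0 < H" by (auto simp: H_def)
  have nn: "0 \<le> C2" "0 \<le> C4" "0 \<le> \<gamma>"
    using moment2_nonneg moment4_nonneg gauss_var_nonneg H by (auto simp: C2_def C4_def \<gamma>_def)
  have C: "0 \<le> C" unfolding C_def using nn H by auto
  have main: "(\<integral>\<^sup>+\<omega>. ennreal (Y \<omega> * (qclock \<omega> t - qclock \<omega> s)) \<partial>M) \<le> ennreal (C * (t - s)) * (\<integral>\<^sup>+\<omega>. ennreal (Y \<omega>) \<partial>M) \<and>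
       (\<integral>\<^sup>+\<omega>. ennreal (Y \<omega> * (qclock \<omega> t - qclock \<omega> s)\<^sup>2) \<partial>M) \<le> ennreal (C * (t - s)) * (\<integral>\<^sup>+\<omega>. ennreal (Y \<omega>) \<partial>M)"
    if st: "r0 \<le> s" "s \<le> t" "t \<le> T" and Y: "Y \<in> borel_measurable (F s)" "\<forall>\<omega>. 0 \<le> Y \<omega>" for s t Y
  proof -
    define h where "h = t - s"
    have h: "0 \<le> h" "h \<le> H" using st by (auto simp: h_def H_def)
    have Y0: "0 \<le> Y \<omega>" for \<omega> using Y(2) by blast
    have [measurable]: "Y \<in> borel_measurable M" using measurable_F_M[OF Y(1) st(1)] .
    let ?E = "\<integral>\<^sup>+\<omega>. ennreal (Y \<omega>) \<partial>M"
    have b2: "moment2 h \<le> C2 * h" and b4: "moment4 h \<le> C4 * h"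
      using superadditive_linear_bound[of moment2 H h] superadditive_linear_bound[of moment4 H h]
        moment2_nonneg moment4_nonneg moment2_superadd moment4_superadd H h by (auto simp: C2_def C4_def)
    let ?J = "\<lambda>\<omega>. jumpsq L \<omega> s t"
    have incr: "qclock \<omega> t - qclock \<omega> s = \<gamma> * h + ?J \<omega>" if "jumps_summable \<omega>" for \<omega>
      using jumpsq_combine[OF that st(1,2)] that st
      by (simp add: qclock_def qv_path_def \<gamma>_def h_def algebra_simps)
    have G: "{\<omega>\<in>space M. jumps_summable \<omega>} \<in> sets M"
      using AE_sets_F[OF AE_jumps_summable order_refl] sets_F_subset by auto
    have D[measurable]: "(\<lambda>\<omega>. qclock \<omega> t - qclock \<omega> s) \<in> borel_measurable M"
      using measurable_F_M[OF qclock_meas[of t]] measurable_F_M[OF qclock_meas[of s]] st by auto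
    have J1: "(\<integral>\<^sup>+\<omega>. ennreal (Y \<omega> * ?J \<omega>) \<partial>M) \<le> ?E * ennreal (C2 * h)"
      using b2 by (intro order_trans[OF nn_integral_jumpsq(1)[OF st(1,2) Y(1) Y0]] mult_left_mono ennreal_leI)
        (auto simp: h_def)
    have "(moment2 h)\<^sup>2 \<le> (C2 * h)\<^sup>2" using b2 moment2_nonneg by (intro power_mono) auto
    also have "\<dots> \<le> C2\<^sup>2 * H * h"
      using mult_right_mono[OF h(2) h(1)] mult_left_mono[of "h * h" "H * h" "C2\<^sup>2"] by (simp add: power2_eq_square mult_ac)
    finally have q: "moment4 h + (moment2 h)\<^sup>2 \<le> (C4 + C2\<^sup>2 * H) * h" using b4 by (simp add: distrib_right)
    have J2: "(\<integral>\<^sup>+\<omega>. ennreal (Y \<omega> * (?J \<omega>)\<^sup>2) \<partial>M) \<le> ?E * ennreal ((C4 + C2\<^sup>2 * H) * h)"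
      using q by (intro order_trans[OF nn_integral_jumpsq(2)[OF st(1,2) Y(1) Y0]] mult_left_mono ennreal_leI)
        (auto simp: h_def)
    \<comment> \<open>\<open>jumpsq\<close> is only an almost sure limit of measurable functions.
      This version of it is built from the measurable clock and agrees with it almost
      surely.\<close>
    let ?J' = "\<lambda>\<omega>. indicator {\<omega>\<in>space M. jumps_summable \<omega>} \<omega> * (qclock \<omega> t - qclock \<omega> s - \<gamma> * h)"
    have J'm[measurable]: "?J' \<in> borel_measurable M" using G by measurable
    have J': "AE \<omega> in M. ?J' \<omega> = ?J \<omega>"
      using AE_jumps_summable AE_space by eventually_elim (simp add: incr)
    have incr': "AE \<omega> in M. qclock \<omega> t - qclock \<omega> s = \<gamma> * h + ?J' \<omega> \<and> 0 \<le> ?J' \<omega>"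
      using AE_jumps_summable AE_space by eventually_elim (simp add: incr)
    have J'1: "(\<integral>\<^sup>+\<omega>. ennreal (Y \<omega> * ?J' \<omega>) \<partial>M) \<le> ?E * ennreal (C2 * h)"
      using J1 J' by (subst nn_integral_cong_AE[where v="\<lambda>\<omega>. ennreal (Y \<omega> * ?J \<omega>)"]) auto
    have J'2: "(\<integral>\<^sup>+\<omega>. ennreal (Y \<omega> * (?J' \<omega>)\<^sup>2) \<partial>M) \<le> ?E * ennreal ((C4 + C2\<^sup>2 * H) * h)"
      using J2 J' by (subst nn_integral_cong_AE[where v="\<lambda>\<omega>. ennreal (Y \<omega> * (?J \<omega>)\<^sup>2)"]) auto
    have "(\<integral>\<^sup>+\<omega>. ennreal (Y \<omega> * (qclock \<omega> t - qclock \<omega> s)) \<partial>M) \<le>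
       (\<integral>\<^sup>+\<omega>. ennreal (\<gamma> * h) * ennreal (Y \<omega>) + ennreal (Y \<omega> * ?J' \<omega>) \<partial>M)"
    proof (rule nn_integral_mono_AE, use incr' in eventually_elim)
      fix \<omega> assume a: "qclock \<omega> t - qclock \<omega> s = \<gamma> * h + ?J' \<omega> \<and> 0 \<le> ?J' \<omega>"
      have "Y \<omega> * (qclock \<omega> t - qclock \<omega> s) = (\<gamma> * h) * Y \<omega> + Y \<omega> * ?J' \<omega>"
        unfolding mult.commute[of "\<gamma> * h"] distrib_left[symmetric] using a by (intro arg_cong[where f="(*) (Y \<omega>)"]) blast
      then show "ennreal (Y \<omega> * (qclock \<omega> t - qclock \<omega> s)) \<le> ennreal (\<gamma> * h) * ennreal (Y \<omega>) + ennreal (Y \<omega> * ?J' \<omega>)"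
        using a Y0[of \<omega>] nn h by (simp add: ennreal_plus ennreal_mult)
    qed
    also have "\<dots> = ennreal (\<gamma> * h) * ?E + (\<integral>\<^sup>+\<omega>. ennreal (Y \<omega> * ?J' \<omega>) \<partial>M)"
      by (subst nn_integral_add) (auto simp: nn_integral_cmult)
    also have "\<dots> \<le> ennreal (\<gamma> * h) * ?E + ?E * ennreal (C2 * h)" by (intro add_left_mono J'1)
    also have "\<dots> = ennreal (\<gamma> * h + C2 * h) * ?E"
      using nn h by (subst ennreal_plus) (auto simp: distrib_right mult.commute[of ?E])
    also have "\<dots> \<le> ennreal (C * h) * ?E"
      using nn h H by (intro mult_right_mono ennreal_leI) (auto simp: C_def algebra_simps intro!: add_nonneg_nonneg)
    finally have 1: "(\<integral>\<^sup>+\<omega>. ennreal (Y \<omega> * (qclock \<omega> t - qclock \<omega> s)) \<partial>M) \<le> ennreal (C * h) * ?E" .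
    have "(\<integral>\<^sup>+\<omega>. ennreal (Y \<omega> * (qclock \<omega> t - qclock \<omega> s)\<^sup>2) \<partial>M) \<le>
       (\<integral>\<^sup>+\<omega>. ennreal (2 * \<gamma>\<^sup>2 * H * h) * ennreal (Y \<omega>) + 2 * ennreal (Y \<omega> * (?J' \<omega>)\<^sup>2) \<partial>M)"
    proof (rule nn_integral_mono_AE, use incr' in eventually_elim)
      fix \<omega> assume a: "qclock \<omega> t - qclock \<omega> s = \<gamma> * h + ?J' \<omega> \<and> 0 \<le> ?J' \<omega>"
      have "(\<gamma> * h + ?J' \<omega>)\<^sup>2 \<le> 2 * (\<gamma> * h)\<^sup>2 + 2 * (?J' \<omega>)\<^sup>2"
        using zero_le_power2[of "\<gamma> * h - ?J' \<omega>"] unfolding power2_sum power2_diff by linarith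
      moreover have "(\<gamma> * h)\<^sup>2 \<le> \<gamma>\<^sup>2 * H * h"
        using mult_left_mono[OF mult_right_mono[OF h(2) h(1)], of "\<gamma>\<^sup>2"] by (simp add: power2_eq_square mult_ac)
      ultimately have "(qclock \<omega> t - qclock \<omega> s)\<^sup>2 \<le> 2 * \<gamma>\<^sup>2 * H * h + 2 * (?J' \<omega>)\<^sup>2"
        using a by (simp del: mult_cancel_left)
      then have "Y \<omega> * (qclock \<omega> t - qclock \<omega> s)\<^sup>2 \<le> Y \<omega> * (2 * \<gamma>\<^sup>2 * H * h + 2 * (?J' \<omega>)\<^sup>2)"
        by (rule mult_left_mono[OF _ Y0])
      also have "\<dots> = (2 * \<gamma>\<^sup>2 * H * h) * Y \<omega> + 2 * (Y \<omega> * (?J' \<omega>)\<^sup>2)"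
        unfolding distrib_left by (simp only: mult_ac)
      finally have "ennreal (Y \<omega> * (qclock \<omega> t - qclock \<omega> s)\<^sup>2) \<le> ennreal ((2 * \<gamma>\<^sup>2 * H * h) * Y \<omega> + 2 * (Y \<omega> * (?J' \<omega>)\<^sup>2))"
        by (rule ennreal_leI)
      also have "\<dots> = ennreal (2 * \<gamma>\<^sup>2 * H * h) * ennreal (Y \<omega>) + 2 * ennreal (Y \<omega> * (?J' \<omega>)\<^sup>2)"
        using Y0[of \<omega>] nn h H by (subst ennreal_plus) (auto simp: ennreal_mult)
      finally show "ennreal (Y \<omega> * (qclock \<omega> t - qclock \<omega> s)\<^sup>2) \<le>
          ennreal (2 * \<gamma>\<^sup>2 * H * h) * ennreal (Y \<omega>) + 2 * ennreal (Y \<omega> * (?J' \<omega>)\<^sup>2)" .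
    qed
    also have "\<dots> = ennreal (2 * \<gamma>\<^sup>2 * H * h) * ?E + 2 * (\<integral>\<^sup>+\<omega>. ennreal (Y \<omega> * (?J' \<omega>)\<^sup>2) \<partial>M)"
      by (subst nn_integral_add) (auto simp: nn_integral_cmult)
    also have "\<dots> \<le> ennreal (2 * \<gamma>\<^sup>2 * H * h) * ?E + 2 * (?E * ennreal ((C4 + C2\<^sup>2 * H) * h))"
      by (intro add_left_mono mult_left_mono J'2) auto
    also have "\<dots> = ennreal (2 * \<gamma>\<^sup>2 * H * h + 2 * ((C4 + C2\<^sup>2 * H) * h)) * ?E"
    proof -
      have "ennreal x * e + 2 * (e * ennreal y) = ennreal (x + 2 * y) * e" if "0 \<le> x" "0 \<le> y" for x y e
        using that by (simp add: ennreal_plus ennreal_mult distrib_left distrib_right mult_ac)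
      then show ?thesis using nn h H by simp
    qed
    also have "\<dots> \<le> ennreal (C * h) * ?E"
      using nn h H by (intro mult_right_mono ennreal_leI) (auto simp: C_def distrib_right)
    finally show ?thesis using 1 unfolding h_def by blast
  qed
  show "\<exists>C\<ge>0. \<forall>s t Y. r0 \<le> s \<longrightarrow> s \<le> t \<longrightarrow> t \<le> T \<longrightarrow> Y \<in> borel_measurable (F s) \<longrightarrow> (\<forall>\<omega>. 0 \<le> Y \<omega>) \<longrightarrow>
       (\<integral>\<^sup>+\<omega>. ennreal (Y \<omega> * (qclock \<omega> t - qclock \<omega> s)) \<partial>M) \<le> ennreal (C * (t - s)) * (\<integral>\<^sup>+\<omega>. ennreal (Y \<omega>) \<partial>M) \<and>
       (\<integral>\<^sup>+\<omega>. ennreal (Y \<omega> * (qclock \<omega> t - qclock \<omega> s)\<^sup>2) \<partial>M) \<le> ennreal (C * (t - s)) * (\<integral>\<^sup>+\<omega>. ennreal (Y \<omega>) \<partial>M)"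
    using main C by blast
qed

end

section \<open>Second moments of Stieltjes integrals\<close>

text \<open>The outer absolute value makes the function nonnegative everywhere, including times
  before a and unbounded paths, where the real supremum is unspecified. On cadlag paths it changes
  nothing.\<close>

definition run_sup :: "real \<Rightarrow> (real \<Rightarrow> 'a \<Rightarrow> real) \<Rightarrow> real \<Rightarrow> 'a \<Rightarrow> real" where
  "run_sup a Z t \<omega> = \<bar>SUP s\<in>{a..t}. \<bar>Z s \<omega>\<bar>\<bar>"

lemma run_sup_nonneg [simp]: "0 \<le> run_sup a Z t \<omega>"
  by (simp add: run_sup_def)

lemma cadlag_bdd_above:
  assumes "cadlag_from a f"
  shows "bdd_above ((\<lambda>s. \<bar>f s\<bar>) ` {a..t})"
proof -
  obtain B where "\<And>x. x \<in> {a..t} \<Longrightarrow> \<bar>f x\<bar> \<le> B"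
    using cadlag_on_bounded[OF cadlag_from_imp_on[OF assms order_refl]] by metis
  then show ?thesis by (intro bdd_aboveI2)
qed

lemma run_sup_upper:
  assumes "cadlag_from a (\<lambda>t. Z t \<omega>)" "s \<in> {a..t}"
  shows "\<bar>Z s \<omega>\<bar> \<le> run_sup a Z t \<omega>"
  using cSUP_upper[OF assms(2) cadlag_bdd_above[OF assms(1)]] unfolding run_sup_def by linarith

lemma run_sup_eq:
  assumes "cadlag_from a (\<lambda>t. Z t \<omega>)" "a \<le> t"
  shows "run_sup a Z t \<omega> = (SUP s\<in>{a..t}. \<bar>Z s \<omega>\<bar>)"
  using cSUP_upper[OF _ cadlag_bdd_above[OF assms(1)], of a t] assms(2) unfolding run_sup_def by fastforce

lemma run_sup_least:
  assumes "cadlag_from a (\<lambda>t. Z t \<omega>)" "a \<le> t" "\<And>s. s \<in> {a..t} \<Longrightarrow> \<bar>Z s \<omega>\<bar> \<le> B"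
  shows "run_sup a Z t \<omega> \<le> B"
  unfolding run_sup_eq[of a Z \<omega> t, OF assms(1,2)] using assms(2,3) by (intro cSUP_least) auto

lemma run_sup_mono:
  assumes "cadlag_from a (\<lambda>t. Z t \<omega>)" "a \<le> s" "s \<le> t"
  shows "run_sup a Z s \<omega> \<le> run_sup a Z t \<omega>"
  using assms by (intro run_sup_least run_sup_upper) auto

lemma run_sup_left_regular:
  assumes "cadlag_from a (\<lambda>t. Z t \<omega>)"
  shows "left_regular a b (\<lambda>t. run_sup a Z t \<omega>)"
  using assms by (intro left_regular_mono mono_onI run_sup_mono) auto

text \<open>Translates the extended real supremum of squares in \<open>sup_norm2\<close> into the
  square of a real supremum, an integrand to which the moment estimates apply.\<close>

lemma run_sup_square:
  assumes "cadlag_from a (\<lambda>t. Z t \<omega>)" "a \<le> t"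
  shows "(SUP s\<in>{a..t}. ennreal ((Z s \<omega>)\<^sup>2)) = ennreal ((run_sup a Z t \<omega>)\<^sup>2)"
proof (rule antisym)
  show "(SUP s\<in>{a..t}. ennreal ((Z s \<omega>)\<^sup>2)) \<le> ennreal ((run_sup a Z t \<omega>)\<^sup>2)"
  proof (intro SUP_least ennreal_leI)
    fix s assume "s \<in> {a..t}"
    then show "(Z s \<omega>)\<^sup>2 \<le> (run_sup a Z t \<omega>)\<^sup>2"
      using power_mono[OF run_sup_upper[of a Z, OF assms(1)], of s t 2] by simp
  qed
  show "ennreal ((run_sup a Z t \<omega>)\<^sup>2) \<le> (SUP s\<in>{a..t}. ennreal ((Z s \<omega>)\<^sup>2))"
  proof (cases "(SUP s\<in>{a..t}. ennreal ((Z s \<omega>)\<^sup>2))")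
    case (real B)
    have "\<bar>Z s \<omega>\<bar> \<le> sqrt B" if "s \<in> {a..t}" for s
      using SUP_upper[OF that, of "\<lambda>s. ennreal ((Z s \<omega>)\<^sup>2)"] real by (simp add: real_le_rsqrt)
    then have "run_sup a Z t \<omega> \<le> sqrt B" using assms by (intro run_sup_least) auto
    then have "(run_sup a Z t \<omega>)\<^sup>2 \<le> (sqrt B)\<^sup>2" by (rule power_mono) simp
    then show ?thesis using real by (simp add: ennreal_leI)
  next
    case top
    then show ?thesis by (metis top_greatest)
  qed
qed

lemma sup_norm2_eq:
  assumes "\<And>\<omega>. \<omega> \<in> space M \<Longrightarrow> cadlag_from a (\<lambda>t. Z t \<omega>)" "a \<le> t"
  shows "sup_norm2 M a Z t = (\<integral>\<^sup>+\<omega>. ennreal ((run_sup a Z t \<omega>)\<^sup>2) \<partial>M)"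
  unfolding sup_norm2_def using assms by (intro nn_integral_cong run_sup_square)

lemma sup_norm2_mono: "s \<le> t \<Longrightarrow> sup_norm2 M a Z s \<le> sup_norm2 M a Z t"
  unfolding sup_norm2_def by (intro nn_integral_mono SUP_subset_mono) auto

text \<open>Right continuity reduces the supremum to rational times. The end point t is added, since
  nothing in the interval approaches it from the right.\<close>

lemma run_sup_measurable:
  assumes c: "\<And>\<omega>. \<omega> \<in> space N \<Longrightarrow> cadlag_from a (\<lambda>t. Z t \<omega>)" and t: "a \<le> t"
    and Z: "\<And>s. s \<in> {a..t} \<Longrightarrow> Z s \<in> borel_measurable N"
  shows "run_sup a Z t \<in> borel_measurable N"
proof -
  define D where "D = insert t ({a..t} \<inter> \<rat>)"
  have D: "countable D" "D \<subseteq> {a..t}" "t \<in> D" using t by (auto simp: D_def intro: countable_rat)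
  have eq: "run_sup a Z t \<omega> = (SUP s\<in>D. \<bar>Z s \<omega>\<bar>)" if \<omega>: "\<omega> \<in> space N" for \<omega>
  proof (rule antisym)
    note bdd = cadlag_bdd_above[OF c[OF \<omega>], of t]
    have bdd2: "bdd_above ((\<lambda>s. \<bar>Z s \<omega>\<bar>) ` D)" by (rule bdd_above_mono[OF bdd]) (use D in auto)
    show "(SUP s\<in>D. \<bar>Z s \<omega>\<bar>) \<le> run_sup a Z t \<omega>"
      using D by (intro cSUP_least run_sup_upper c \<omega>) auto
    show "run_sup a Z t \<omega> \<le> (SUP s\<in>D. \<bar>Z s \<omega>\<bar>)"
    proof (rule run_sup_least[where Z=Z, OF c[OF \<omega>] t], rule ccontr)
      fix s assume s: "s \<in> {a..t}" and n: "\<not> \<bar>Z s \<omega>\<bar> \<le> (SUP s\<in>D. \<bar>Z s \<omega>\<bar>)"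
      then have "s \<noteq> t" using cSUP_upper[OF D(3) bdd2] by auto
      then have st: "s < t" using s by auto
      have "((\<lambda>u. \<bar>Z u \<omega>\<bar>) \<longlongrightarrow> \<bar>Z s \<omega>\<bar>) (at_right s)"
        using c[OF \<omega>] s unfolding cadlag_from_def continuous_within by (intro tendsto_rabs) auto
      then have "eventually (\<lambda>u. (SUP s\<in>D. \<bar>Z s \<omega>\<bar>) < \<bar>Z u \<omega>\<bar>) (at_right s)"
        using n by (intro order_tendstoD) auto
      then obtain b where b: "b > s" "\<forall>u>s. u < b \<longrightarrow> (SUP s\<in>D. \<bar>Z s \<omega>\<bar>) < \<bar>Z u \<omega>\<bar>"
        unfolding eventually_at_right_field by auto
      obtain u where u: "u \<in> \<rat>" "s < u" "u < min b t"
        using Rats_dense_in_real[of s "min b t"] b st by auto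
      then have "u \<in> D" using s by (auto simp: D_def)
      then show False using b(2) u cSUP_upper[OF _ bdd2, of u] by force
    qed
  qed
  have "(\<lambda>\<omega>. SUP s\<in>D. \<bar>Z s \<omega>\<bar>) \<in> borel_measurable N"
  proof (rule borel_measurable_cSUP[OF D(1)])
    show "(\<lambda>\<omega>. \<bar>Z s \<omega>\<bar>) \<in> borel_measurable N" if "s \<in> D" for s
      using Z[of s] that D by (intro borel_measurable_abs) auto
    show "bdd_above ((\<lambda>s. \<bar>Z s \<omega>\<bar>) ` D)" if "\<omega> \<in> space N" for \<omega>
      by (rule bdd_above_mono[OF cadlag_bdd_above[OF c[OF that], of t]]) (use D in auto)
  qed
  then show ?thesis using eq by (subst measurable_cong[of N _ "\<lambda>\<omega>. SUP s\<in>D. \<bar>Z s \<omega>\<bar>"]) auto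
qed

text \<open>The estimate replacing the Burkholder--Davis--Gundy inequality: squares of left-point Riemann sums satisfy
  a discrete Gronwall recursion, because the increments of the clock are controlled given the past.\<close>

lemma (in levy_fourth_moment) stieltjes_second_moment:
  assumes A: "moment_clock M r0 F A"
  obtains K where "0 \<le> K"
    "\<And>H B \<beta> t. \<lbrakk>0 < \<beta>; r0 \<le> t; t \<le> T; \<And>s \<omega>. 0 \<le> H s \<omega>; \<And>s. r0 \<le> s \<Longrightarrow> H s \<in> borel_measurable (F s);
       \<And>\<omega>. \<omega> \<in> space M \<Longrightarrow> left_regular r0 t (\<lambda>s. H s \<omega>);
       \<And>s. s \<in> {r0..T} \<Longrightarrow> (\<integral>\<^sup>+\<omega>. ennreal ((H s \<omega>)\<^sup>2) \<partial>M) \<le> B * ennreal (exp (\<beta> * s))\<rbrakk> \<Longrightarrow>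
     (\<integral>\<^sup>+\<omega>. ennreal ((sint (A \<omega>) (\<lambda>s. H s \<omega>) r0 t)\<^sup>2) \<partial>M) \<le> ennreal (K / \<beta>) * (B * ennreal (exp (\<beta> * t)))"
proof -
  obtain C where C: "0 \<le> C" and mom: "\<And>s t Y. \<lbrakk>r0 \<le> s; s \<le> t; t \<le> T; Y \<in> borel_measurable (F s); \<And>\<omega>. 0 \<le> Y \<omega>\<rbrakk> \<Longrightarrow>
       (\<integral>\<^sup>+\<omega>. ennreal (Y \<omega> * (A \<omega> t - A \<omega> s)) \<partial>M) \<le> ennreal (C * (t - s)) * (\<integral>\<^sup>+\<omega>. ennreal (Y \<omega>) \<partial>M)"
      "\<And>s t Y. \<lbrakk>r0 \<le> s; s \<le> t; t \<le> T; Y \<in> borel_measurable (F s); \<And>\<omega>. 0 \<le> Y \<omega>\<rbrakk> \<Longrightarrow>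
       (\<integral>\<^sup>+\<omega>. ennreal (Y \<omega> * (A \<omega> t - A \<omega> s)\<^sup>2) \<partial>M) \<le> ennreal (C * (t - s)) * (\<integral>\<^sup>+\<omega>. ennreal (Y \<omega>) \<partial>M)"
    using A unfolding moment_clock_def by blast
  have As: "\<And>\<omega>. \<omega> \<in> space M \<Longrightarrow> stieltjes (A \<omega>)" and Am: "\<And>t. r0 \<le> t \<Longrightarrow> (\<lambda>\<omega>. A \<omega> t) \<in> borel_measurable (F t)"
    using A unfolding moment_clock_def by auto
  \<comment> \<open>The exponential accumulates the factors 1 + C d of the single steps; 2 C is the
    coefficient of the source term in each step.\<close>
  define K where "K = exp (C * (T - r0)) * (2 * C)"
  have K0: "0 \<le> K" using C by (simp add: K_def)
  have "(\<integral>\<^sup>+\<omega>. ennreal ((sint (A \<omega>) (\<lambda>s. H s \<omega>) r0 t)\<^sup>2) \<partial>M) \<le> ennreal (K / \<beta>) * (B * ennreal (exp (\<beta> * t)))"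
    if l: "0 < \<beta>" and t: "r0 \<le> t" "t \<le> T" and H0: "\<And>s \<omega>. 0 \<le> H s \<omega>" and Hm: "\<And>s. r0 \<le> s \<Longrightarrow> H s \<in> borel_measurable (F s)"
      and Hr: "\<And>\<omega>. \<omega> \<in> space M \<Longrightarrow> left_regular r0 t (\<lambda>s. H s \<omega>)"
      and HB: "\<And>s. s \<in> {r0..T} \<Longrightarrow> (\<integral>\<^sup>+\<omega>. ennreal ((H s \<omega>)\<^sup>2) \<partial>M) \<le> B * ennreal (exp (\<beta> * s))"
    for H B \<beta> t
  proof (cases "r0 = t")
    case True
    then show ?thesis by simp
  next
    case False
    then have t0: "r0 < t" using t by simp
    define R where "R n k \<omega> = (\<Sum>i<k. H (grid r0 t n i) \<omega> * (A \<omega> (grid r0 t n (Suc i)) - A \<omega> (grid r0 t n i)))" for n k \<omega>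
    have gr: "r0 \<le> grid r0 t n k" for n k using grid_mono[OF t(1), of 0 k n] by simp
    have gt: "grid r0 t n k \<le> T" if "k \<le> Suc n" for n k using grid_bounds(2)[OF t(1) that] t by simp
    have Rm: "R n k \<in> borel_measurable (F (grid r0 t n k))" for n k
      unfolding R_def
    proof (intro borel_measurable_sum borel_measurable_times borel_measurable_diff)
      fix i assume i: "i \<in> {..<k}"
      have *: "grid r0 t n i \<le> grid r0 t n k" "grid r0 t n (Suc i) \<le> grid r0 t n k"
        using i t by (auto intro!: grid_mono simp del: grid_last)
      show "H (grid r0 t n i) \<in> borel_measurable (F (grid r0 t n k))"
        by (rule measurable_F_mono[OF Hm[OF gr] gr *(1)])
      show "(\<lambda>\<omega>. A \<omega> (grid r0 t n (Suc i))) \<in> borel_measurable (F (grid r0 t n k))"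
        by (rule measurable_F_mono[OF Am[OF gr] gr *(2)])
      show "(\<lambda>\<omega>. A \<omega> (grid r0 t n i)) \<in> borel_measurable (F (grid r0 t n k))"
        by (rule measurable_F_mono[OF Am[OF gr] gr *(1)])
    qed
    have RM[measurable]: "R n k \<in> borel_measurable M" for n k by (rule measurable_F_M[OF Rm gr])
    have R0: "0 \<le> R n k \<omega>" if "\<omega> \<in> space M" for n k \<omega>
      unfolding R_def using stieltjes.mono[OF As[OF that] grid_mono[OF t(1)]]
      by (intro sum_nonneg mult_nonneg_nonneg H0) auto
    \<comment> \<open>The invariant of the Gronwall recursion, fitted to E[R^2] growing in a step by
      at most C d E[R^2] + 2 C d B exp(\<open>\<beta>\<close> g): the first factor absorbs the
      growth, the difference of exponentials collects the sources, and it is 0 at k = 0.\<close>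
    have est: "(\<integral>\<^sup>+\<omega>. ennreal ((R n k \<omega>)\<^sup>2) \<partial>M) \<le>
        ennreal (exp (C * (grid r0 t n k - r0)) * (2 * C / \<beta>) * (exp (\<beta> * grid r0 t n k) - exp (\<beta> * r0))) * B"
      if "k \<le> Suc n" for n k
      using that
    proof (induction k)
      case 0
      then show ?case by (simp add: R_def)
    next
      case (Suc k)
      define g where "g = grid r0 t n k"
      define g' where "g' = grid r0 t n (Suc k)"
      define d where "d = g' - g"
      have gs: "r0 \<le> g" "g \<le> g'" "g' \<le> T" "r0 \<le> g'"
        using gr gt[OF Suc.prems] grid_mono[OF t(1), of k "Suc k" n] by (auto simp: g_def g'_def simp del: grid_last)
      have d0: "0 \<le> d" using gs by (simp add: d_def)
      let ?x = "\<lambda>\<omega>. A \<omega> g' - A \<omega> g" and ?R = "R n k"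
      have RF[measurable]: "?R \<in> borel_measurable (F g)" using Rm by (simp add: g_def)
      have HF[measurable]: "H g \<in> borel_measurable (F g)" using Hm gs by simp
      have [measurable]: "?R \<in> borel_measurable M" "H g \<in> borel_measurable M"
        using measurable_F_M[OF HF gs(1)] by auto
      have [measurable]: "(\<lambda>\<omega>. A \<omega> g') \<in> borel_measurable M" "(\<lambda>\<omega>. A \<omega> g) \<in> borel_measurable M"
        using measurable_F_M[OF Am] gs by auto
      let ?a = "\<integral>\<^sup>+\<omega>. ennreal ((?R \<omega>)\<^sup>2) \<partial>M" and ?b = "\<integral>\<^sup>+\<omega>. ennreal ((H g \<omega>)\<^sup>2) \<partial>M"
      \<comment> \<open>Only E[R^2] and E[H^2] may appear in the recursion, hence 2 R H is bounded
        by R^2 + H^2. The absolute value is there because the clock bounds ask for a test function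
        that is nonnegative at every point, while R is known to be so only on the sample
        space.\<close>
      have "(\<integral>\<^sup>+\<omega>. ennreal (2 * \<bar>?R \<omega>\<bar> * H g \<omega>) \<partial>M) \<le> (\<integral>\<^sup>+\<omega>. ennreal ((?R \<omega>)\<^sup>2) + ennreal ((H g \<omega>)\<^sup>2) \<partial>M)"
      proof (intro nn_integral_mono)
        fix \<omega>
        have "2 * \<bar>?R \<omega>\<bar> * H g \<omega> \<le> (?R \<omega>)\<^sup>2 + (H g \<omega>)\<^sup>2"
          using zero_le_power2[of "\<bar>?R \<omega>\<bar> - H g \<omega>"] unfolding power2_diff by simp
        then show "ennreal (2 * \<bar>?R \<omega>\<bar> * H g \<omega>) \<le> ennreal ((?R \<omega>)\<^sup>2) + ennreal ((H g \<omega>)\<^sup>2)"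
          by (simp add: ennreal_plus[symmetric] ennreal_leI del: ennreal_plus)
      qed
      also have "(\<integral>\<^sup>+\<omega>. ennreal ((?R \<omega>)\<^sup>2) + ennreal ((H g \<omega>)\<^sup>2) \<partial>M) = ?a + ?b"
        by (rule nn_integral_add) measurable
      finally have cross: "(\<integral>\<^sup>+\<omega>. ennreal (2 * \<bar>?R \<omega>\<bar> * H g \<omega>) \<partial>M) \<le> ?a + ?b" .
      have "(\<integral>\<^sup>+\<omega>. ennreal ((R n (Suc k) \<omega>)\<^sup>2) \<partial>M) =
        (\<integral>\<^sup>+\<omega>. ennreal ((?R \<omega>)\<^sup>2) + (ennreal ((2 * \<bar>?R \<omega>\<bar> * H g \<omega>) * ?x \<omega>) + ennreal ((H g \<omega>)\<^sup>2 * (?x \<omega>)\<^sup>2)) \<partial>M)"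
      proof (intro nn_integral_cong)
        fix \<omega> assume \<omega>: "\<omega> \<in> space M"
        have x: "0 \<le> ?x \<omega>" using stieltjes.mono[OF As[OF \<omega>] gs(2)] by simp
        have RS: "R n (Suc k) \<omega> = ?R \<omega> + H g \<omega> * ?x \<omega>" by (simp add: R_def g_def g'_def)
        have "(R n (Suc k) \<omega>)\<^sup>2 = (?R \<omega>)\<^sup>2 + ((2 * \<bar>?R \<omega>\<bar> * H g \<omega>) * ?x \<omega> + (H g \<omega>)\<^sup>2 * (?x \<omega>)\<^sup>2)"
          unfolding RS abs_of_nonneg[OF R0[OF \<omega>]] by (simp add: power2_eq_square algebra_simps)
        then show "ennreal ((R n (Suc k) \<omega>)\<^sup>2) = ennreal ((?R \<omega>)\<^sup>2) + (ennreal ((2 * \<bar>?R \<omega>\<bar> * H g \<omega>) * ?x \<omega>) + ennreal ((H g \<omega>)\<^sup>2 * (?x \<omega>)\<^sup>2))"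
          using x H0[of g \<omega>] by (simp add: ennreal_plus[symmetric] del: ennreal_plus)
      qed
      also have "\<dots> = ?a + ((\<integral>\<^sup>+\<omega>. ennreal ((2 * \<bar>?R \<omega>\<bar> * H g \<omega>) * ?x \<omega>) \<partial>M) + (\<integral>\<^sup>+\<omega>. ennreal ((H g \<omega>)\<^sup>2 * (?x \<omega>)\<^sup>2) \<partial>M))"
        by (subst nn_integral_add, measurable, subst nn_integral_add, measurable)
      also have "\<dots> \<le> ?a + (ennreal (C * d) * (\<integral>\<^sup>+\<omega>. ennreal (2 * \<bar>?R \<omega>\<bar> * H g \<omega>) \<partial>M) + ennreal (C * d) * ?b)"
        unfolding d_def by (intro add_left_mono add_mono mom gs) (auto intro!: mult_nonneg_nonneg H0)
      also have "\<dots> \<le> ?a + (ennreal (C * d) * (?a + ?b) + ennreal (C * d) * ?b)"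
        by (intro add_left_mono add_right_mono mult_left_mono cross) simp
      also have "\<dots> = ennreal (1 + C * d) * ?a + ennreal (2 * C * d) * ?b"
      proof -
        have "ennreal (2 * C * d) = ennreal (C * d) + ennreal (C * d)"
          using C d0 by (simp add: ennreal_plus[symmetric] del: ennreal_plus)
        moreover have "ennreal (1 + C * d) = 1 + ennreal (C * d)" using C d0 by simp
        ultimately show ?thesis by (simp add: distrib_left distrib_right add_ac)
      qed
      also have "\<dots> \<le> ennreal (1 + C * d) * (ennreal (exp (C * (g - r0)) * (2 * C / \<beta>) * (exp (\<beta> * g) - exp (\<beta> * r0))) * B)
          + ennreal (2 * C * d) * (B * ennreal (exp (\<beta> * g)))"
        using Suc gs unfolding g_def by (intro add_mono mult_left_mono HB) auto
      also have "\<dots> = ennreal ((1 + C * d) * (exp (C * (g - r0)) * (2 * C / \<beta>) * (exp (\<beta> * g) - exp (\<beta> * r0)))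
          + 2 * C * d * exp (\<beta> * g)) * B"
      proof -
        have "0 \<le> exp (\<beta> * g) - exp (\<beta> * r0)" using gs l by simp
        then have nn: "0 \<le> exp (C * (g - r0)) * (2 * C / \<beta>) * (exp (\<beta> * g) - exp (\<beta> * r0))" (is "0 \<le> ?y")
          using C l by (intro mult_nonneg_nonneg) auto
        have eqn: "ennreal u * (ennreal y * B) + ennreal v * (B * ennreal e) = ennreal (u * y + v * e) * B"
          if "0 \<le> u" "0 \<le> y" "0 \<le> v" "0 \<le> e" for u y v e
          using that by (simp add: ennreal_plus ennreal_mult distrib_left distrib_right mult_ac)
        show ?thesis by (rule eqn) (use nn C d0 in auto)
      qed
      also have "\<dots> \<le> ennreal (exp (C * (g' - r0)) * (2 * C / \<beta>) * (exp (\<beta> * g') - exp (\<beta> * r0))) * B"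
      proof (intro mult_right_mono ennreal_leI)
        define E where "E = exp (C * (g - r0))"
        define E' where "E' = exp (C * (g' - r0))"
        have E'1: "1 \<le> E'" using C gs by (simp add: E'_def)
        have "E' = E * exp (C * d)" unfolding E_def E'_def d_def exp_add[symmetric] by (simp add: algebra_simps)
        moreover have "1 + C * d \<le> exp (C * d)" by (rule exp_ge_add_one_self)
        ultimately have EE: "(1 + C * d) * E \<le> E'" by (simp add: E_def mult.commute)
        \<comment> \<open>The source d exp(\<open>\<beta>\<close> g) of one step is at most the
          increment of exp(\<open>\<beta>\<close> s) over it, divided by \<open>\<beta>\<close>.
          This is the origin of the small factor 1 / \<open>\<beta>\<close>.\<close>
        have "\<beta> * d \<le> exp (\<beta> * d) - 1" using exp_ge_add_one_self[of "\<beta> * d"] by linarith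
        then have "exp (\<beta> * g) * (\<beta> * d) \<le> exp (\<beta> * g) * (exp (\<beta> * d) - 1)" by (intro mult_left_mono) auto
        also have "\<dots> = exp (\<beta> * g') - exp (\<beta> * g)" unfolding d_def right_diff_distrib exp_diff by simp
        finally have "2 * C / \<beta> * (exp (\<beta> * g) * (\<beta> * d)) \<le> 2 * C / \<beta> * (exp (\<beta> * g') - exp (\<beta> * g))"
          using C l by (intro mult_left_mono) auto
        also have "\<dots> \<le> E' * (2 * C / \<beta> * (exp (\<beta> * g') - exp (\<beta> * g)))"
          using E'1 C l gs mult_right_mono[OF E'1, of "2 * C / \<beta> * (exp (\<beta> * g') - exp (\<beta> * g))"] by simp
        finally have 1: "2 * C * d * exp (\<beta> * g) \<le> E' * (2 * C / \<beta> * (exp (\<beta> * g') - exp (\<beta> * g)))"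
          using l by (simp add: mult_ac)
        have "(1 + C * d) * E * (2 * C / \<beta> * (exp (\<beta> * g) - exp (\<beta> * r0))) \<le> E' * (2 * C / \<beta> * (exp (\<beta> * g) - exp (\<beta> * r0)))"
          using EE C l gs by (intro mult_right_mono mult_nonneg_nonneg) auto
        with 1 have "(1 + C * d) * E * (2 * C / \<beta> * (exp (\<beta> * g) - exp (\<beta> * r0))) + 2 * C * d * exp (\<beta> * g)
           \<le> E' * (2 * C / \<beta> * (exp (\<beta> * g) - exp (\<beta> * r0))) + E' * (2 * C / \<beta> * (exp (\<beta> * g') - exp (\<beta> * g)))"
          by (rule add_mono[rotated])
        also have "\<dots> = E' * (2 * C / \<beta>) * (exp (\<beta> * g') - exp (\<beta> * r0))"
          unfolding mult.assoc distrib_left[symmetric] by simp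
        finally show "(1 + C * d) * (exp (C * (g - r0)) * (2 * C / \<beta>) * (exp (\<beta> * g) - exp (\<beta> * r0))) + 2 * C * d * exp (\<beta> * g)
            \<le> exp (C * (g' - r0)) * (2 * C / \<beta>) * (exp (\<beta> * g') - exp (\<beta> * r0))"
          unfolding E_def E'_def by (simp only: mult.assoc)
      qed simp
      finally show ?case unfolding g'_def .
    qed
    show ?thesis
    proof (rule nn_integral_limit_le)
      show "(\<lambda>\<omega>. ennreal ((R n (Suc n) \<omega>)\<^sup>2)) \<in> borel_measurable M" for n by measurable
      show "AE \<omega> in M. (\<lambda>n. ennreal ((R n (Suc n) \<omega>)\<^sup>2)) \<longlonglongrightarrow> ennreal ((sint (A \<omega>) (\<lambda>s. H s \<omega>) r0 t)\<^sup>2)"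
        unfolding R_def
        by (intro AE_I2 tendsto_ennrealI tendsto_power stieltjes.sint_riemann As t0 Hr)
      have "exp (C * (t - r0)) * (2 * C / \<beta>) * (exp (\<beta> * t) - exp (\<beta> * r0)) \<le> K / \<beta> * exp (\<beta> * t)"
      proof -
        have "exp (C * (t - r0)) * (2 * C / \<beta>) \<le> K / \<beta>"
          unfolding K_def using C l t by (auto intro!: divide_right_mono mult_right_mono mult_left_mono)
        then show ?thesis using C l t t0 K0 by (intro mult_mono) auto
      qed
      then have "ennreal (exp (C * (t - r0)) * (2 * C / \<beta>) * (exp (\<beta> * t) - exp (\<beta> * r0))) * B \<le> ennreal (K / \<beta> * exp (\<beta> * t)) * B"
        by (intro mult_right_mono ennreal_leI) auto
      also have "\<dots> = ennreal (K / \<beta>) * (B * ennreal (exp (\<beta> * t)))"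
        using K0 l by (subst ennreal_mult) (auto simp: mult_ac)
      finally show "(\<integral>\<^sup>+\<omega>. ennreal ((R n (Suc n) \<omega>)\<^sup>2) \<partial>M) \<le> ennreal (K / \<beta>) * (B * ennreal (exp (\<beta> * t)))" for n
        using est[of "Suc n" n] by simp
    qed
  qed
  then show ?thesis using that K0 by blast
qed

lemma (in levy_fourth_moment) id_moment_clock: "moment_clock M r0 F (\<lambda>\<omega> t. t)"
  unfolding moment_clock_def
proof (intro conjI ballI allI impI)
  show "stieltjes (\<lambda>t. t)" by (rule stieltjes_id.stieltjes_axioms)
  fix T :: real
  show "\<exists>C\<ge>0. \<forall>s t Y. r0 \<le> s \<longrightarrow> s \<le> t \<longrightarrow> t \<le> T \<longrightarrow> Y \<in> borel_measurable (F s) \<longrightarrow> (\<forall>\<omega>. 0 \<le> Y \<omega>) \<longrightarrow>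
       (\<integral>\<^sup>+\<omega>. ennreal (Y \<omega> * (t - s)) \<partial>M) \<le> ennreal (C * (t - s)) * (\<integral>\<^sup>+\<omega>. ennreal (Y \<omega>) \<partial>M) \<and>
       (\<integral>\<^sup>+\<omega>. ennreal (Y \<omega> * (t - s)\<^sup>2) \<partial>M) \<le> ennreal (C * (t - s)) * (\<integral>\<^sup>+\<omega>. ennreal (Y \<omega>) \<partial>M)"
  \<comment> \<open>The 1 handles the first power; T - r0 bounds one factor of the square.\<close>
  proof (intro exI[of _ "max 1 (T - r0)"] conjI allI impI)
    fix s t :: real and Y :: "'a \<Rightarrow> real"
    assume st: "r0 \<le> s" "s \<le> t" "t \<le> T" and Y: "Y \<in> borel_measurable (F s)" "\<forall>\<omega>. 0 \<le> Y \<omega>"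
    have [measurable]: "Y \<in> borel_measurable M" using measurable_F_M[OF Y(1) st(1)] .
    have eq: "(\<integral>\<^sup>+\<omega>. ennreal (Y \<omega> * c) \<partial>M) = ennreal c * (\<integral>\<^sup>+\<omega>. ennreal (Y \<omega>) \<partial>M)" if "0 \<le> c" for c
      using that Y(2) by (subst nn_integral_cmult[symmetric]) (auto simp: ennreal_mult mult_ac)
    have "t - s \<le> max 1 (T - r0) * (t - s)" using mult_right_mono[of 1 "max 1 (T - r0)" "t - s"] st by simp
    then show "(\<integral>\<^sup>+\<omega>. ennreal (Y \<omega> * (t - s)) \<partial>M) \<le> ennreal (max 1 (T - r0) * (t - s)) * (\<integral>\<^sup>+\<omega>. ennreal (Y \<omega>) \<partial>M)"
      using st by (subst eq) (auto intro!: mult_right_mono ennreal_leI)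
    have "(t - s)\<^sup>2 \<le> max 1 (T - r0) * (t - s)" using st unfolding power2_eq_square by (intro mult_right_mono) auto
    then show "(\<integral>\<^sup>+\<omega>. ennreal (Y \<omega> * (t - s)\<^sup>2) \<partial>M) \<le> ennreal (max 1 (T - r0) * (t - s)) * (\<integral>\<^sup>+\<omega>. ennreal (Y \<omega>) \<partial>M)"
      by (subst eq) (auto intro!: mult_right_mono ennreal_leI)
  qed auto
qed auto

section \<open>Picard iteration\<close>

text \<open>Interchange of a locally uniform limit with one-sided limits. The hypothesis asks for
  error sequences, which is how the tails of the Picard series present themselves.\<close>

lemma cadlag_from_uniform_limit:
  assumes z: "\<And>n. cadlag_from a (z n)"
    and u: "\<And>T. \<exists>e. e \<longlonglongrightarrow> 0 \<and> (\<forall>n. \<forall>t\<in>{a..T}. \<bar>x t - z n t\<bar> \<le> e n)"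
  shows "cadlag_from a x"
proof -
  have ul: "uniform_limit {a..T} z x sequentially" for T
  proof (rule uniform_limitI)
    fix d :: real assume d: "0 < d"
    obtain e where e: "e \<longlonglongrightarrow> 0" "\<forall>n. \<forall>t\<in>{a..T}. \<bar>x t - z n t\<bar> \<le> e n" using u by blast
    have "eventually (\<lambda>n. e n < d) sequentially" using order_tendstoD(2)[OF e(1) d] .
    then show "eventually (\<lambda>n. \<forall>t\<in>{a..T}. dist (z n t) (x t) < d) sequentially"
    proof (eventually_elim, intro ballI)
      fix n s assume "e n < d" "s \<in> {a..T}"
      then have "\<bar>x s - z n s\<bar> < d" using e(2) by (metis le_less_trans)
      then show "dist (z n s) (x s) < d" by (simp add: dist_real_def abs_minus_commute)
    qed
  qed
  have "(x \<longlongrightarrow> x t) (at_right t)" if t: "a \<le> t" for t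
  proof (rule swap_uniform_limit'[where f=z and S="{a..t+1}" and F=sequentially])
    show "eventually (\<lambda>n. (z n \<longlongrightarrow> z n t) (at_right t)) sequentially"
      using z t unfolding cadlag_from_def continuous_within by auto
    show "(\<lambda>n. z n t) \<longlonglongrightarrow> x t" using tendsto_uniform_limitI[OF ul[of t]] t by auto
    have "eventually (\<lambda>s. s \<in> {t<..<t+1}) (at_right t)" by (rule eventually_at_right_real) simp
    then show "eventually (\<lambda>s. s \<in> {a..t+1}) (at_right t)" by eventually_elim (use t in auto)
  qed (use ul in auto)
  moreover have "\<exists>l. (x \<longlongrightarrow> l) (at_left t)" if t: "a < t" for t
  proof -
    define g where "g n = left_lim (z n) t" for n
    have g: "(z n \<longlongrightarrow> g n) (at_left t)" for n
      unfolding g_def using t by (intro cadlag_on_tendsto_left_lim[OF cadlag_from_imp_on[OF z order_refl, of t]]) auto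
    have ev: "eventually (\<lambda>s. s \<in> {a..t}) (at_left t)"
      using eventually_at_left_real[OF t] by eventually_elim auto
    obtain e where e: "e \<longlonglongrightarrow> 0" "\<And>n s. s \<in> {a..t} \<Longrightarrow> \<bar>x s - z n s\<bar> \<le> e n" using u by blast
    \<comment> \<open>The left limits of the approximants inherit the uniform error bounds, so they
      form a Cauchy sequence; its limit is the left limit of x.\<close>
    have gd: "\<bar>g n - g m\<bar> \<le> e n + e m" for n m
    proof (rule tendsto_upperbound)
      show "((\<lambda>s. \<bar>z n s - z m s\<bar>) \<longlongrightarrow> \<bar>g n - g m\<bar>) (at_left t)" by (intro tendsto_intros g)
      show "eventually (\<lambda>s. \<bar>z n s - z m s\<bar> \<le> e n + e m) (at_left t)"
        using ev
      proof eventually_elim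
        case (elim s)
        then show ?case using e(2)[of s n] e(2)[of s m] by linarith
      qed
    qed simp
    have "Cauchy g"
    proof (rule metric_CauchyI)
      fix d :: real assume "0 < d"
      then have "eventually (\<lambda>n. e n < d/2) sequentially" using order_tendstoD(2)[OF e(1), of "d/2"] by simp
      then obtain N where N: "\<And>n. n \<ge> N \<Longrightarrow> e n < d/2" unfolding eventually_sequentially by blast
      have "dist (g m) (g n) < d" if "m \<ge> N" "n \<ge> N" for m n
        using gd[of m n] N[OF that(1)] N[OF that(2)] by (simp add: dist_real_def)
      then show "\<exists>N. \<forall>m\<ge>N. \<forall>n\<ge>N. dist (g m) (g n) < d" by blast
    qed
    then obtain l where l: "g \<longlonglongrightarrow> l" using Cauchy_convergent convergentD by blast
    have "(x \<longlongrightarrow> l) (at_left t)"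
      by (rule swap_uniform_limit'[where f=z and S="{a..t}" and F=sequentially, OF _ l ul ev]) (use g in auto)
    then show ?thesis ..
  qed
  ultimately show ?thesis unfolding cadlag_from_def continuous_within by blast
qed

text \<open>Cauchy-Schwarz for the product of (1/2)^n and 2^n a_n; the geometric series of ratio 1/4
  has sum 4/3, rounded up to 2. It turns a bound in square mean into pathwise summability together
  with a square integrable bound for the sum.\<close>

lemma weighted_square_summable:
  fixes a :: "nat \<Rightarrow> real"
  assumes a: "\<And>n. 0 \<le> a n" and w: "\<And>N. (\<Sum>n<N. 4^n * (a n)\<^sup>2) \<le> w"
  shows "summable a" "suminf a \<le> sqrt (2 * w)"
proof -
  have fin: "(\<Sum>n<N. a n) \<le> sqrt (2 * w)" for N
  proof (rule real_le_rsqrt)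
    have "(\<Sum>n<N. a n)\<^sup>2 = (\<Sum>n<N. (1/2)^n * (2^n * a n))\<^sup>2" by (simp add: power_divide)
    also have "\<dots> \<le> (\<Sum>n<N. ((1/2)^n)\<^sup>2) * (\<Sum>n<N. (2^n * a n)\<^sup>2)" by (rule Cauchy_Schwarz_ineq_sum)
    also have "(\<Sum>n<N. ((1/2)^n)\<^sup>2) = (\<Sum>n<N. (1/4::real)^n)"
      by (intro sum.cong refl) (simp add: power2_eq_square power_mult_distrib[symmetric])
    also have "(\<Sum>n<N. (2^n * a n)\<^sup>2) = (\<Sum>n<N. 4^n * (a n)\<^sup>2)"
      by (intro sum.cong refl) (simp add: power2_eq_square power_mult_distrib[symmetric] mult_ac flip: mult.assoc)
    also have "(\<Sum>n<N. (1/4::real)^n) * (\<Sum>n<N. 4^n * (a n)\<^sup>2) \<le> 2 * w"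
    proof (intro mult_mono w)
      have "(\<Sum>n<N. (1/4::real)^n) \<le> (\<Sum>n. (1/4)^n)" by (intro sum_le_suminf summable_geometric) auto
      also have "\<dots> \<le> 2" by (subst suminf_geometric) auto
      finally show "(\<Sum>n<N. (1/4::real)^n) \<le> 2" .
    qed (auto intro!: sum_nonneg)
    finally show "(\<Sum>n<N. a n)\<^sup>2 \<le> 2 * w" .
  qed
  show s: "summable a" using fin a by (rule summableI_nonneg_bounded[rotated])
  show "suminf a \<le> sqrt (2 * w)" using fin by (rule suminf_le_const[OF s])
qed

lemma cadlag_from_glue:
  assumes \<phi>: "cadlag_on (-r) 0 \<phi>" and g: "cadlag_from 0 g" "g 0 = \<phi> 0"
  shows "cadlag_from (-r) (\<lambda>t. if t \<le> 0 then \<phi> t else g t)" (is "cadlag_from _ ?h")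
proof -
  have "(?h \<longlongrightarrow> ?h t) (at_right t)" if t: "-r \<le> t" for t
  proof (cases "t < 0")
    case True
    have "eventually (\<lambda>s. s \<in> {t<..<0}) (at_right t)" using True by (rule eventually_at_right_real)
    then have "eventually (\<lambda>s. \<phi> s = ?h s) (at_right t)" by eventually_elim auto
    moreover have "(\<phi> \<longlongrightarrow> \<phi> t) (at_right t)" using \<phi> True t unfolding cadlag_on_def continuous_within by auto
    ultimately have "(?h \<longlongrightarrow> \<phi> t) (at_right t)" by (rule Lim_transform_eventually[rotated])
    then show ?thesis using True by simp
  next
    case False
    have "eventually (\<lambda>s. g s = ?h s) (at_right t)"
      using eventually_at_right_less[of t] by eventually_elim (use False in auto)
    moreover have "(g \<longlongrightarrow> g t) (at_right t)" using g False unfolding cadlag_from_def continuous_within by auto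
    ultimately have "(?h \<longlongrightarrow> g t) (at_right t)" by (rule Lim_transform_eventually[rotated])
    moreover have "g t = ?h t" using False g(2) by auto
    ultimately show ?thesis by simp
  qed
  moreover have "\<exists>l. (?h \<longlongrightarrow> l) (at_left t)" if t: "-r < t" for t
  proof (cases "t \<le> 0")
    case True
    obtain l where l: "(\<phi> \<longlongrightarrow> l) (at_left t)" using \<phi> t True unfolding cadlag_on_def
      by (meson greaterThanAtMost_iff)
    have "eventually (\<lambda>s. s < t) (at_left t)" by (simp add: eventually_at_filter)
    then have "eventually (\<lambda>s. \<phi> s = ?h s) (at_left t)" by eventually_elim (use True in auto)
    then show ?thesis by (intro exI) (rule Lim_transform_eventually[OF l])
  next
    case False
    obtain l where l: "(g \<longlongrightarrow> l) (at_left t)" using g(1) False unfolding cadlag_from_def by (meson not_le)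
    have "eventually (\<lambda>s. s \<in> {0<..<t}) (at_left t)" using False by (intro eventually_at_left_real) auto
    then have "eventually (\<lambda>s. g s = ?h s) (at_left t)" by eventually_elim auto
    then show ?thesis by (intro exI) (rule Lim_transform_eventually[OF l])
  qed
  ultimately show ?thesis unfolding cadlag_from_def continuous_within by blast
qed

lemma square_sum_le: "((x::real) + y)\<^sup>2 \<le> 2 * x\<^sup>2 + 2 * y\<^sup>2"
  using zero_le_power2[of "x - y"] unfolding power2_sum power2_diff by linarith

section \<open>The right-hand side as an operator, and its contraction\<close>

locale cdgarch = levy_fourth_moment M "-r" F L T0 for M :: "'a measure" and r F L T0 +
  fixes p q \<eta> c\<^sub>\<mu> c\<^sub>\<nu> :: real and f\<^sub>\<mu> f\<^sub>\<nu> :: "real \<Rightarrow> real" and \<Phi> :: "real \<Rightarrow> 'a \<Rightarrow> real"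
  assumes pq: "0 \<le> p" "p \<le> r" "0 \<le> q" "q \<le> r"
    and f: "continuous_on {-p..0} f\<^sub>\<mu>" "continuous_on {-q..0} f\<^sub>\<nu>"
    and \<Phi>_cadlag: "\<And>\<omega>. \<omega> \<in> space M \<Longrightarrow> cadlag_on (-r) 0 (\<lambda>t. \<Phi> t \<omega>)"
    and \<Phi>_adapted: "\<And>t. t \<in> {-r..0} \<Longrightarrow> \<Phi> t \<in> borel_measurable (F t)"
    and \<Phi>_finite: "sup_norm2 M (-r) \<Phi> 0 < \<infinity>"
begin

lemma r0: "0 \<le> r" using pq by simp

text \<open>The linear part of the right-hand side, driven by \<open>qclock\<close> rather than S:
  it is then linear, cadlag in t and bounded for every sample point.\<close>

definition memory_op :: "(real \<Rightarrow> real) \<Rightarrow> 'a \<Rightarrow> real \<Rightarrow> real" where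
  "memory_op z \<omega> t = delay_op (\<lambda>x. x) f\<^sub>\<mu> p (-c\<^sub>\<mu>) z t + delay_op (qclock \<omega>) f\<^sub>\<nu> q c\<^sub>\<nu> z t"

definition K1 :: real where "K1 = delay_mass f\<^sub>\<mu> p (-c\<^sub>\<mu>)"
definition K2 :: real where "K2 = delay_mass f\<^sub>\<nu> q c\<^sub>\<nu>"

lemma K_nonneg: "0 \<le> K1" "0 \<le> K2"
  unfolding K1_def K2_def by (auto intro: delay_mass_nonneg)

text \<open>Dominates the memory of D by two integrals over the whole past. The integrand is
  nonnegative, adapted and nondecreasing, so the second moment estimate applies to it, and the
  majorant itself is nondecreasing in t.\<close>

definition majorant :: "(real \<Rightarrow> 'a \<Rightarrow> real) \<Rightarrow> real \<Rightarrow> 'a \<Rightarrow> real" where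
  "majorant D t \<omega> = K1 * sint (\<lambda>x. x) (\<lambda>s. run_sup (-r) D s \<omega>) (-r) t
     + K2 * sint (qclock \<omega>) (\<lambda>s. run_sup (-r) D s \<omega>) (-r) t"

definition cadlag_adapted :: "(real \<Rightarrow> 'a \<Rightarrow> real) \<Rightarrow> bool" where
  "cadlag_adapted Z \<longleftrightarrow> (\<forall>\<omega>\<in>space M. cadlag_from (-r) (\<lambda>t. Z t \<omega>)) \<and> adapted_from (-r) F Z"

lemma cadlag_adapted_cadlag: "cadlag_adapted Z \<Longrightarrow> \<omega> \<in> space M \<Longrightarrow> cadlag_from (-r) (\<lambda>t. Z t \<omega>)"
  unfolding cadlag_adapted_def by blast

lemma cadlag_adapted_left_regular: "cadlag_adapted Z \<Longrightarrow> \<omega> \<in> space M \<Longrightarrow> left_regular (-r) b (\<lambda>t. Z t \<omega>)"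
  by (intro cadlag_from_left_regular cadlag_adapted_cadlag)

lemma cadlag_adapted_meas: "cadlag_adapted Z \<Longrightarrow> -r \<le> s \<Longrightarrow> s \<le> t \<Longrightarrow> Z s \<in> borel_measurable (F t)"
  unfolding cadlag_adapted_def adapted_from_def using measurable_F_mono by blast

lemma cadlag_adapted_diff: "cadlag_adapted Z \<Longrightarrow> cadlag_adapted Y \<Longrightarrow> cadlag_adapted (\<lambda>t \<omega>. Z t \<omega> - Y t \<omega>)"
  unfolding cadlag_adapted_def adapted_from_def by (auto intro!: cadlag_from_diff borel_measurable_diff)

lemma cadlag_adapted_run_sup_meas: "cadlag_adapted Z \<Longrightarrow> -r \<le> t \<Longrightarrow> run_sup (-r) Z t \<in> borel_measurable (F t)"
  by (intro run_sup_measurable) (auto simp: space_F cadlag_adapted_cadlag intro: cadlag_adapted_meas)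

lemma cadlag_adapted_sup_norm2: "cadlag_adapted Z \<Longrightarrow> -r \<le> t \<Longrightarrow> sup_norm2 M (-r) Z t = (\<integral>\<^sup>+\<omega>. ennreal ((run_sup (-r) Z t \<omega>)\<^sup>2) \<partial>M)"
  by (intro sup_norm2_eq cadlag_adapted_cadlag)

lemma memory_op_diff:
  assumes "\<And>b. left_regular (-r) b z" "\<And>b. left_regular (-r) b y" "0 \<le> t"
  shows "memory_op (\<lambda>x. z x - y x) \<omega> t = memory_op z \<omega> t - memory_op y \<omega> t"
  unfolding memory_op_def stieltjes_id.delay_op_diff[OF f(1) pq(1,2) assms]
    stieltjes.delay_op_diff[OF qclock_stieltjes f(2) pq(3,4) assms] by simp

lemma memory_op_cadlag:
  assumes "\<And>b. left_regular (-r) b z"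
  shows "cadlag_from 0 (memory_op z \<omega>)"
  unfolding memory_op_def
  by (intro cadlag_from_add stieltjes_id.delay_op_cadlag[OF f(1) pq(1,2) assms]
      stieltjes.delay_op_cadlag[OF qclock_stieltjes f(2) pq(3,4) assms])

lemma memory_op_0: "memory_op z \<omega> 0 = 0"
  by (simp add: memory_op_def delay_op_def)

lemma memory_op_meas:
  assumes Z: "cadlag_adapted Z" and t: "0 \<le> t"
  shows "(\<lambda>\<omega>. memory_op (\<lambda>s. Z s \<omega>) \<omega> t) \<in> borel_measurable (F t)"
proof -
  have sp: "space (F t) = space M" using t r0 by (intro space_F) auto
  have q: "(\<lambda>\<omega>. qclock \<omega> s) \<in> borel_measurable (F t)" if "s \<in> {-r..t}" for s
    using measurable_F_mono[OF qclock_meas] that by auto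
  show ?thesis unfolding memory_op_def
    by (intro borel_measurable_add
        delay_op_measurable[where A="\<lambda>_ x. x", OF f(1) pq(1,2) t stieltjes_id.stieltjes_axioms]
        delay_op_measurable[where A=qclock, OF f(2) pq(3,4) t qclock_stieltjes q])
       (auto simp: sp cadlag_adapted_left_regular[OF Z] intro: cadlag_adapted_meas[OF Z])
qed

lemma run_sup_regular: "cadlag_adapted D \<Longrightarrow> \<omega> \<in> space M \<Longrightarrow> left_regular (-r) b (\<lambda>s. run_sup (-r) D s \<omega>)"
  by (intro run_sup_left_regular cadlag_adapted_cadlag)

lemma memory_op_bound:
  assumes z: "\<And>b. left_regular (-r) b z" and y: "left_regular (-r) t y" and t: "0 \<le> t"
    and le: "\<And>x. x \<in> {-r..t} \<Longrightarrow> \<bar>z x\<bar> \<le> y x"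
  shows "\<bar>memory_op z \<omega> t\<bar> \<le> K1 * sint (\<lambda>x. x) y (-r) t + K2 * sint (qclock \<omega>) y (-r) t"
  using stieltjes_id.delay_op_bound[OF f(1) pq(1,2) z y t le, of "-c\<^sub>\<mu>"]
    stieltjes.delay_op_bound[OF qclock_stieltjes f(2) pq(3,4) z y t le, of \<omega> c\<^sub>\<nu>]
  unfolding memory_op_def K1_def K2_def by linarith

lemma memory_op_le_majorant:
  assumes D: "cadlag_adapted D" and \<omega>: "\<omega> \<in> space M" and t: "0 \<le> t"
  shows "\<bar>memory_op (\<lambda>s. D s \<omega>) \<omega> t\<bar> \<le> majorant D t \<omega>"
  unfolding majorant_def
  by (intro memory_op_bound cadlag_adapted_left_regular[OF D \<omega>] run_sup_regular[OF D \<omega>] t run_sup_upper cadlag_adapted_cadlag[OF D \<omega>]) auto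

lemma majorant_mono:
  assumes D: "cadlag_adapted D" and \<omega>: "\<omega> \<in> space M" and st: "-r \<le> s" "s \<le> t"
  shows "majorant D s \<omega> \<le> majorant D t \<omega>"
  unfolding majorant_def using st K_nonneg
  by (intro add_mono mult_left_mono stieltjes_id.sint_mono_upper stieltjes.sint_mono_upper[OF qclock_stieltjes]
      run_sup_regular[OF D \<omega>]) auto

lemma majorant_nonneg:
  assumes D: "cadlag_adapted D" and \<omega>: "\<omega> \<in> space M"
  shows "0 \<le> majorant D t \<omega>"
  unfolding majorant_def using K_nonneg
  by (intro add_nonneg_nonneg mult_nonneg_nonneg stieltjes_id.sint_nonneg stieltjes.sint_nonneg[OF qclock_stieltjes]
      run_sup_regular[OF D \<omega>]) auto

lemma majorant_meas:
  assumes D: "cadlag_adapted D"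
  shows "(\<lambda>\<omega>. sint (\<lambda>x. x) (\<lambda>s. run_sup (-r) D s \<omega>) (-r) t) \<in> borel_measurable M" (is "?I \<in> _")
    and "(\<lambda>\<omega>. sint (qclock \<omega>) (\<lambda>s. run_sup (-r) D s \<omega>) (-r) t) \<in> borel_measurable M" (is "?J \<in> _")
    and "majorant D t \<in> borel_measurable M"
proof -
  have HM: "run_sup (-r) D s \<in> borel_measurable M" if "-r \<le> s" for s
    using measurable_F_M[OF cadlag_adapted_run_sup_meas[OF D that] that] .
  show I[measurable]: "?I \<in> borel_measurable M"
    by (rule sint_measurable[where A="\<lambda>_ x. x"]) (auto intro: HM stieltjes_id.stieltjes_axioms run_sup_regular[OF D])
  show J[measurable]: "?J \<in> borel_measurable M"
    by (rule sint_measurable[where A=qclock])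
       (auto intro: HM qclock_stieltjes run_sup_regular[OF D] measurable_F_M[OF qclock_meas])
  have "majorant D t = (\<lambda>\<omega>. K1 * ?I \<omega> + K2 * ?J \<omega>)" by (intro ext) (simp add: majorant_def)
  then show "majorant D t \<in> borel_measurable M" by simp
qed

text \<open>The factor 1/8 leaves room: squares that decay like 8^(-n) remain summable when weighted
  with 4^n, and this weighting gives convergence of paths. B is extended real, so no finiteness has
  to be checked beforehand.\<close>

definition contracting :: "real \<Rightarrow> real \<Rightarrow> bool" where
  "contracting T \<beta> \<longleftrightarrow> (\<forall>D B. \<forall>t\<in>{-r..T}. cadlag_adapted D \<longrightarrow>
     (\<forall>s\<in>{-r..T}. sup_norm2 M (-r) D s \<le> B * ennreal (exp (\<beta> * s))) \<longrightarrow>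
     (\<integral>\<^sup>+\<omega>. ennreal ((majorant D t \<omega>)\<^sup>2) \<partial>M) \<le> ennreal (1/8) * (B * ennreal (exp (\<beta> * t))))"

lemma contractingD:
  assumes "contracting T \<beta>" "cadlag_adapted D" "t \<in> {-r..T}"
    "\<And>s. s \<in> {-r..T} \<Longrightarrow> sup_norm2 M (-r) D s \<le> B * ennreal (exp (\<beta> * s))"
  shows "(\<integral>\<^sup>+\<omega>. ennreal ((majorant D t \<omega>)\<^sup>2) \<partial>M) \<le> ennreal (1/8) * (B * ennreal (exp (\<beta> * t)))"
  using assms unfolding contracting_def by blast

lemma majorant_estimate:
  obtains \<beta> where "0 < \<beta>" "contracting T \<beta>"
proof -
  obtain Ka where Ka: "0 \<le> Ka" "\<And>H B \<beta> t. \<lbrakk>0 < \<beta>; -r \<le> t; t \<le> T; \<And>s \<omega>. 0 \<le> H s \<omega>; \<And>s. -r \<le> s \<Longrightarrow> H s \<in> borel_measurable (F s);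
       \<And>\<omega>. \<omega> \<in> space M \<Longrightarrow> left_regular (-r) t (\<lambda>s. H s \<omega>);
       \<And>s. s \<in> {-r..T} \<Longrightarrow> (\<integral>\<^sup>+\<omega>. ennreal ((H s \<omega>)\<^sup>2) \<partial>M) \<le> B * ennreal (exp (\<beta> * s))\<rbrakk> \<Longrightarrow>
     (\<integral>\<^sup>+\<omega>. ennreal ((sint (\<lambda>x. x) (\<lambda>s. H s \<omega>) (-r) t)\<^sup>2) \<partial>M) \<le> ennreal (Ka / \<beta>) * (B * ennreal (exp (\<beta> * t)))"
    using stieltjes_second_moment[OF id_moment_clock, where T=T] by blast
  obtain Kb where Kb: "0 \<le> Kb" "\<And>H B \<beta> t. \<lbrakk>0 < \<beta>; -r \<le> t; t \<le> T; \<And>s \<omega>. 0 \<le> H s \<omega>; \<And>s. -r \<le> s \<Longrightarrow> H s \<in> borel_measurable (F s);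
       \<And>\<omega>. \<omega> \<in> space M \<Longrightarrow> left_regular (-r) t (\<lambda>s. H s \<omega>);
       \<And>s. s \<in> {-r..T} \<Longrightarrow> (\<integral>\<^sup>+\<omega>. ennreal ((H s \<omega>)\<^sup>2) \<partial>M) \<le> B * ennreal (exp (\<beta> * s))\<rbrakk> \<Longrightarrow>
     (\<integral>\<^sup>+\<omega>. ennreal ((sint (qclock \<omega>) (\<lambda>s. H s \<omega>) (-r) t)\<^sup>2) \<partial>M) \<le> ennreal (Kb / \<beta>) * (B * ennreal (exp (\<beta> * t)))"
    using stieltjes_second_moment[OF qclock_moment_clock, where T=T] by blast
  \<comment> \<open>The estimate below produces 2 (\<open>K1\<^sup>2 * Ka + K2\<^sup>2 * Kb\<close>)
    / \<open>\<beta>\<close>; the factor 16 brings it under 1/8, and the summand 1 makes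
    \<open>\<beta>\<close> positive.\<close>
  define \<beta> where "\<beta> = 16 * (K1\<^sup>2 * Ka + K2\<^sup>2 * Kb) + 1"
  have S0: "0 \<le> K1\<^sup>2 * Ka + K2\<^sup>2 * Kb" using Ka Kb by auto
  then have b: "0 < \<beta>" unfolding \<beta>_def by (intro add_nonneg_pos mult_nonneg_nonneg) auto
  have "(\<integral>\<^sup>+\<omega>. ennreal ((majorant D t \<omega>)\<^sup>2) \<partial>M) \<le> ennreal (1/8) * (B * ennreal (exp (\<beta> * t)))"
    if D: "cadlag_adapted D" and t: "t \<in> {-r..T}"
      and B: "\<And>s. s \<in> {-r..T} \<Longrightarrow> sup_norm2 M (-r) D s \<le> B * ennreal (exp (\<beta> * s))" for D B t
  proof -
    let ?H = "run_sup (-r) D"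
    let ?I = "\<lambda>\<omega>. sint (\<lambda>x. x) (\<lambda>s. ?H s \<omega>) (-r) t" and ?J = "\<lambda>\<omega>. sint (qclock \<omega>) (\<lambda>s. ?H s \<omega>) (-r) t"
    let ?X = "B * ennreal (exp (\<beta> * t))"
    have HB: "(\<integral>\<^sup>+\<omega>. ennreal ((?H s \<omega>)\<^sup>2) \<partial>M) \<le> B * ennreal (exp (\<beta> * s))" if "s \<in> {-r..T}" for s
      using B[OF that] cadlag_adapted_sup_norm2[OF D, of s] that by simp
    have I: "(\<integral>\<^sup>+\<omega>. ennreal ((?I \<omega>)\<^sup>2) \<partial>M) \<le> ennreal (Ka / \<beta>) * ?X"
      using t by (intro Ka(2)[OF b] HB cadlag_adapted_run_sup_meas[OF D] run_sup_regular[OF D]) auto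
    have J: "(\<integral>\<^sup>+\<omega>. ennreal ((?J \<omega>)\<^sup>2) \<partial>M) \<le> ennreal (Kb / \<beta>) * ?X"
      using t by (intro Kb(2)[OF b] HB cadlag_adapted_run_sup_meas[OF D] run_sup_regular[OF D]) auto
    note [measurable] = majorant_meas(1,2)[OF D, of t]
    have "(\<integral>\<^sup>+\<omega>. ennreal ((majorant D t \<omega>)\<^sup>2) \<partial>M) \<le>
      (\<integral>\<^sup>+\<omega>. ennreal (2 * K1\<^sup>2) * ennreal ((?I \<omega>)\<^sup>2) + ennreal (2 * K2\<^sup>2) * ennreal ((?J \<omega>)\<^sup>2) \<partial>M)"
    proof (intro nn_integral_mono)
      fix \<omega>
      have "(majorant D t \<omega>)\<^sup>2 \<le> 2 * (K1 * ?I \<omega>)\<^sup>2 + 2 * (K2 * ?J \<omega>)\<^sup>2"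
        unfolding majorant_def by (rule square_sum_le)
      then have "ennreal ((majorant D t \<omega>)\<^sup>2) \<le> ennreal ((2 * K1\<^sup>2) * (?I \<omega>)\<^sup>2 + (2 * K2\<^sup>2) * (?J \<omega>)\<^sup>2)"
        by (intro ennreal_leI) (simp add: power_mult_distrib)
      also have "\<dots> = ennreal (2 * K1\<^sup>2) * ennreal ((?I \<omega>)\<^sup>2) + ennreal (2 * K2\<^sup>2) * ennreal ((?J \<omega>)\<^sup>2)"
        by (subst ennreal_plus) (auto simp: ennreal_mult)
      finally show "ennreal ((majorant D t \<omega>)\<^sup>2) \<le> ennreal (2 * K1\<^sup>2) * ennreal ((?I \<omega>)\<^sup>2) + ennreal (2 * K2\<^sup>2) * ennreal ((?J \<omega>)\<^sup>2)" .
    qed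
    also have "\<dots> = ennreal (2 * K1\<^sup>2) * (\<integral>\<^sup>+\<omega>. ennreal ((?I \<omega>)\<^sup>2) \<partial>M) + ennreal (2 * K2\<^sup>2) * (\<integral>\<^sup>+\<omega>. ennreal ((?J \<omega>)\<^sup>2) \<partial>M)"
      by (subst nn_integral_add) (auto simp: nn_integral_cmult)
    also have "\<dots> \<le> ennreal (2 * K1\<^sup>2) * (ennreal (Ka / \<beta>) * ?X) + ennreal (2 * K2\<^sup>2) * (ennreal (Kb / \<beta>) * ?X)"
      by (intro add_mono mult_left_mono I J) auto
    also have "\<dots> = ennreal ((2 * K1\<^sup>2) * (Ka / \<beta>) + (2 * K2\<^sup>2) * (Kb / \<beta>)) * ?X"
    proof -
      have e: "ennreal u * (ennreal y * X) + ennreal v * (ennreal e * X) = ennreal (u * y + v * e) * X"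
        if "0 \<le> u" "0 \<le> y" "0 \<le> v" "0 \<le> e" for u y v e X
        using that by (simp add: ennreal_plus ennreal_mult distrib_left distrib_right mult_ac)
      show ?thesis by (rule e) (use Ka(1) Kb(1) b in auto)
    qed
    also have "\<dots> \<le> ennreal (1/8) * ?X"
    proof (intro mult_right_mono ennreal_leI)
      have "(2 * K1\<^sup>2) * (Ka / \<beta>) + (2 * K2\<^sup>2) * (Kb / \<beta>) = 2 * (K1\<^sup>2 * Ka + K2\<^sup>2 * Kb) / \<beta>"
        by (simp add: add_divide_distrib)
      also have "\<dots> \<le> 1/8" using b unfolding pos_divide_le_eq[OF b] by (simp add: \<beta>_def)
      finally show "(2 * K1\<^sup>2) * (Ka / \<beta>) + (2 * K2\<^sup>2) * (Kb / \<beta>) \<le> 1/8" .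
    qed simp
    finally show ?thesis .
  qed
  then show ?thesis using that b unfolding contracting_def by blast
qed

text \<open>Because the majorant is nondecreasing, its value at t bounds V at all earlier times, and
  the supremum costs nothing.\<close>

lemma sup_norm2_le_majorant:
  assumes D: "cadlag_adapted D" and V: "AE \<omega> in M. \<forall>s\<in>{-r..t}. \<bar>V s \<omega>\<bar> \<le> majorant D s \<omega>"
  shows "sup_norm2 M (-r) V t \<le> (\<integral>\<^sup>+\<omega>. ennreal ((majorant D t \<omega>)\<^sup>2) \<partial>M)"
  unfolding sup_norm2_def
proof (rule nn_integral_mono_AE, use V AE_space in eventually_elim)
  case (elim \<omega>)
  show ?case
  proof (intro SUP_least ennreal_leI)
    fix s assume s: "s \<in> {-r..t}"
    have "\<bar>V s \<omega>\<bar> \<le> majorant D t \<omega>" using elim(1) s majorant_mono[OF D elim(2), of s t] by force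
    then have "\<bar>V s \<omega>\<bar>\<^sup>2 \<le> (majorant D t \<omega>)\<^sup>2" by (intro power_mono) auto
    then show "(V s \<omega>)\<^sup>2 \<le> (majorant D t \<omega>)\<^sup>2" by simp
  qed
qed

text \<open>Brings the norm at T into exponentially weighted form. The factor
  exp(\<open>\<beta>\<close> r) compensates for times down to -r, where the weight is smaller than
  1.\<close>

lemma sup_norm2_exp:
  assumes s: "s \<in> {-r..T}" and "0 < \<beta>"
  shows "sup_norm2 M (-r) V s \<le> (sup_norm2 M (-r) V T * ennreal (exp (\<beta> * r))) * ennreal (exp (\<beta> * s))"
proof -
  have "sup_norm2 M (-r) V s \<le> sup_norm2 M (-r) V T * 1" using s by (simp add: sup_norm2_mono)
  also have "\<dots> \<le> sup_norm2 M (-r) V T * ennreal (exp (\<beta> * r) * exp (\<beta> * s))"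
  proof (intro mult_left_mono)
    have "0 \<le> \<beta> * (r + s)" using assms by (intro mult_nonneg_nonneg) auto
    then have "1 \<le> exp (\<beta> * r) * exp (\<beta> * s)" unfolding exp_add[symmetric] distrib_left[symmetric] by simp
    then show "1 \<le> ennreal (exp (\<beta> * r) * exp (\<beta> * s))" by simp
  qed simp
  finally show ?thesis by (simp add: ennreal_mult mult.assoc)
qed

section \<open>The iterates and their geometric decay\<close>

definition start :: "real \<Rightarrow> 'a \<Rightarrow> real" where
  "start t \<omega> = (if t \<le> 0 then \<Phi> t \<omega> else \<Phi> 0 \<omega>)"

definition step :: "(real \<Rightarrow> 'a \<Rightarrow> real) \<Rightarrow> real \<Rightarrow> 'a \<Rightarrow> real" where
  "step Z t \<omega> = (if t \<le> 0 then \<Phi> t \<omega> else \<Phi> 0 \<omega> + (\<eta> * t + memory_op (\<lambda>s. Z s \<omega>) \<omega> t))"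

lemma cadlag_adapted_extend:
  assumes G: "\<And>\<omega>. \<omega> \<in> space M \<Longrightarrow> cadlag_from 0 (\<lambda>t. G t \<omega>)" "\<And>\<omega>. \<omega> \<in> space M \<Longrightarrow> G 0 \<omega> = 0"
    and Gm: "\<And>t. 0 \<le> t \<Longrightarrow> G t \<in> borel_measurable (F t)"
  shows "cadlag_adapted (\<lambda>t \<omega>. if t \<le> 0 then \<Phi> t \<omega> else \<Phi> 0 \<omega> + G t \<omega>)"
  unfolding cadlag_adapted_def
proof (intro conjI ballI)
  fix \<omega> assume \<omega>: "\<omega> \<in> space M"
  show "cadlag_from (-r) (\<lambda>t. if t \<le> 0 then \<Phi> t \<omega> else \<Phi> 0 \<omega> + G t \<omega>)"
    by (rule cadlag_from_glue[OF \<Phi>_cadlag[OF \<omega>]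
          cadlag_from_add[OF cadlag_from_continuous[OF continuous_on_const] G(1)[OF \<omega>]]])
       (simp add: G(2)[OF \<omega>])
next
  show "adapted_from (-r) F (\<lambda>t \<omega>. if t \<le> 0 then \<Phi> t \<omega> else \<Phi> 0 \<omega> + G t \<omega>)"
    unfolding adapted_from_def
  proof (intro allI impI)
    fix t assume t: "-r \<le> t"
    show "(\<lambda>\<omega>. if t \<le> 0 then \<Phi> t \<omega> else \<Phi> 0 \<omega> + G t \<omega>) \<in> borel_measurable (F t)"
    proof (cases "t \<le> 0")
      case True
      then show ?thesis using \<Phi>_adapted[of t] t by simp
    next
      case False
      then have "\<Phi> 0 \<in> borel_measurable (F t)" using measurable_F_mono[OF \<Phi>_adapted[of 0], of t] r0 by simp
      then show ?thesis using False Gm[of t] by simp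
    qed
  qed
qed

lemma cadlag_adapted_start: "cadlag_adapted start"
proof -
  have "cadlag_adapted (\<lambda>t \<omega>. if t \<le> 0 then \<Phi> t \<omega> else \<Phi> 0 \<omega> + 0)"
    by (rule cadlag_adapted_extend) (auto intro!: cadlag_from_continuous)
  also have "(\<lambda>t \<omega>. if t \<le> 0 then \<Phi> t \<omega> else \<Phi> 0 \<omega> + 0) = start" by (intro ext) (simp add: start_def)
  finally show ?thesis .
qed

lemma cadlag_adapted_step:
  assumes Z: "cadlag_adapted Z"
  shows "cadlag_adapted (step Z)"
proof -
  have "cadlag_adapted (\<lambda>t \<omega>. if t \<le> 0 then \<Phi> t \<omega> else \<Phi> 0 \<omega> + (\<eta> * t + memory_op (\<lambda>s. Z s \<omega>) \<omega> t))"
  proof (rule cadlag_adapted_extend)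
    fix \<omega> assume \<omega>: "\<omega> \<in> space M"
    have "cadlag_from 0 (\<lambda>t. \<eta> * t)" by (intro cadlag_from_continuous continuous_intros)
    from cadlag_from_add[OF this memory_op_cadlag[OF cadlag_adapted_left_regular[OF Z \<omega>]]]
    show "cadlag_from 0 (\<lambda>t. \<eta> * t + memory_op (\<lambda>s. Z s \<omega>) \<omega> t)" .
  qed (auto simp: memory_op_0 intro!: borel_measurable_add memory_op_meas Z)
  also have "(\<lambda>t \<omega>. if t \<le> 0 then \<Phi> t \<omega> else \<Phi> 0 \<omega> + (\<eta> * t + memory_op (\<lambda>s. Z s \<omega>) \<omega> t)) = step Z"
    by (intro ext) (simp add: step_def)
  finally show ?thesis .
qed

primrec iter :: "nat \<Rightarrow> real \<Rightarrow> 'a \<Rightarrow> real" where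
  "iter 0 = start"
| "iter (Suc n) = step (iter n)"

lemma cadlag_adapted_iter: "cadlag_adapted (iter n)"
  by (induction n) (auto intro: cadlag_adapted_start cadlag_adapted_step)

definition incr :: "nat \<Rightarrow> real \<Rightarrow> 'a \<Rightarrow> real" where
  "incr n t \<omega> = iter (Suc n) t \<omega> - iter n t \<omega>"

lemma cadlag_adapted_incr: "cadlag_adapted (incr n)"
proof -
  have eq: "incr n = (\<lambda>t \<omega>. iter (Suc n) t \<omega> - iter n t \<omega>)" by (intro ext) (simp add: incr_def)
  show ?thesis unfolding eq by (rule cadlag_adapted_diff[OF cadlag_adapted_iter cadlag_adapted_iter])
qed

lemma step_diff_le_majorant:
  assumes Z: "cadlag_adapted Z" and Y: "cadlag_adapted Y" and \<omega>: "\<omega> \<in> space M"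
  shows "\<bar>step Z t \<omega> - step Y t \<omega>\<bar> \<le> majorant (\<lambda>t \<omega>. Z t \<omega> - Y t \<omega>) t \<omega>"
proof (cases "t \<le> 0")
  case True
  then show ?thesis using majorant_nonneg[OF cadlag_adapted_diff[OF Z Y] \<omega>] by (simp add: step_def)
next
  case False
  then have "step Z t \<omega> - step Y t \<omega> = memory_op (\<lambda>s. Z s \<omega> - Y s \<omega>) \<omega> t"
    using memory_op_diff[of "\<lambda>s. Z s \<omega>" "\<lambda>s. Y s \<omega>" t \<omega>] cadlag_adapted_left_regular[OF Z \<omega>] cadlag_adapted_left_regular[OF Y \<omega>]
    by (simp add: step_def)
  then show ?thesis using memory_op_le_majorant[OF cadlag_adapted_diff[OF Z Y] \<omega>, of t] False by simp
qed

lemma incr_Suc_le_majorant: "\<omega> \<in> space M \<Longrightarrow> \<bar>incr (Suc n) t \<omega>\<bar> \<le> majorant (incr n) t \<omega>"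
proof -
  have "incr n = (\<lambda>t \<omega>. iter (Suc n) t \<omega> - iter n t \<omega>)" by (intro ext) (simp add: incr_def)
  then show "\<omega> \<in> space M \<Longrightarrow> \<bar>incr (Suc n) t \<omega>\<bar> \<le> majorant (incr n) t \<omega>"
    using step_diff_le_majorant[OF cadlag_adapted_iter[of "Suc n"] cadlag_adapted_iter[of n], of \<omega> t] by (simp add: incr_def)
qed

lemma sup_norm2_start: "sup_norm2 M (-r) start t < \<infinity>"
proof -
  have "sup_norm2 M (-r) start t \<le> sup_norm2 M (-r) \<Phi> 0"
    unfolding sup_norm2_def
  proof (intro nn_integral_mono SUP_least)
    fix \<omega> s assume "s \<in> {-r..t}"
    then have "min s 0 \<in> {-r..0}" using r0 by auto
    moreover have "start s \<omega> = \<Phi> (min s 0) \<omega>" by (simp add: start_def min_def)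
    ultimately show "ennreal ((start s \<omega>)\<^sup>2) \<le> (SUP s\<in>{-r..0}. ennreal ((\<Phi> s \<omega>)\<^sup>2))"
      using SUP_upper[of "min s 0" "{-r..0}" "\<lambda>s. ennreal ((\<Phi> s \<omega>)\<^sup>2)"] by simp
  qed
  then show ?thesis using \<Phi>_finite by (rule le_less_trans)
qed

lemma sup_norm2_add_finite:
  assumes "\<And>s \<omega>. \<omega> \<in> space M \<Longrightarrow> s \<in> {-r..t} \<Longrightarrow> \<bar>V s \<omega>\<bar> \<le> X \<omega> + Y \<omega>"
    and [measurable]: "X \<in> borel_measurable M" "Y \<in> borel_measurable M"
    and fin: "(\<integral>\<^sup>+\<omega>. ennreal ((X \<omega>)\<^sup>2) \<partial>M) < \<infinity>" "(\<integral>\<^sup>+\<omega>. ennreal ((Y \<omega>)\<^sup>2) \<partial>M) < \<infinity>"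
  shows "sup_norm2 M (-r) V t < \<infinity>"
proof -
  have "sup_norm2 M (-r) V t \<le> (\<integral>\<^sup>+\<omega>. 2 * ennreal ((X \<omega>)\<^sup>2) + 2 * ennreal ((Y \<omega>)\<^sup>2) \<partial>M)"
    unfolding sup_norm2_def
  proof (intro nn_integral_mono SUP_least)
    fix \<omega> s assume \<omega>: "\<omega> \<in> space M" "s \<in> {-r..t}"
    have "\<bar>V s \<omega>\<bar>\<^sup>2 \<le> (X \<omega> + Y \<omega>)\<^sup>2" using assms(1)[OF \<omega>] by (intro power_mono) auto
    also have "\<dots> \<le> 2 * (X \<omega>)\<^sup>2 + 2 * (Y \<omega>)\<^sup>2" by (rule square_sum_le)
    finally have "ennreal ((V s \<omega>)\<^sup>2) \<le> ennreal (2 * (X \<omega>)\<^sup>2 + 2 * (Y \<omega>)\<^sup>2)" by (intro ennreal_leI) simp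
    then show "ennreal ((V s \<omega>)\<^sup>2) \<le> 2 * ennreal ((X \<omega>)\<^sup>2) + 2 * ennreal ((Y \<omega>)\<^sup>2)"
      by (simp add: ennreal_mult)
  qed
  also have "\<dots> = 2 * (\<integral>\<^sup>+\<omega>. ennreal ((X \<omega>)\<^sup>2) \<partial>M) + 2 * (\<integral>\<^sup>+\<omega>. ennreal ((Y \<omega>)\<^sup>2) \<partial>M)"
    by (subst nn_integral_add) (auto simp: nn_integral_cmult)
  also have "\<dots> < \<infinity>" using fin by (simp add: ennreal_mult_less_top)
  finally show ?thesis .
qed

lemma sup_norm2_incr_0:
  assumes T: "0 \<le> T"
  shows "sup_norm2 M (-r) (incr 0) T < \<infinity>"
proof -
  obtain \<beta> where b: "0 < \<beta>" "contracting T \<beta>" using majorant_estimate by blast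
  have TT: "T \<in> {-r..T}" using T r0 by auto
  have "(\<integral>\<^sup>+\<omega>. ennreal ((majorant start T \<omega>)\<^sup>2) \<partial>M) \<le> ennreal (1/8) *
      ((sup_norm2 M (-r) start T * ennreal (exp (\<beta> * r))) * ennreal (exp (\<beta> * T)))"
    by (rule contractingD[OF b(2) cadlag_adapted_start TT sup_norm2_exp[OF _ b(1)]])
  also have "\<dots> < \<infinity>" using sup_norm2_start[of T] by (simp add: ennreal_mult_less_top)
  finally have fin: "(\<integral>\<^sup>+\<omega>. ennreal ((majorant start T \<omega>)\<^sup>2) \<partial>M) < \<infinity>" .
  show ?thesis
  proof (rule sup_norm2_add_finite[where X="\<lambda>_. \<bar>\<eta>\<bar> * T" and Y="majorant start T"])
    fix s \<omega> assume \<omega>: "\<omega> \<in> space M" and s: "s \<in> {-r..T}"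
    have d0: "0 \<le> majorant start T \<omega>" by (rule majorant_nonneg[OF cadlag_adapted_start \<omega>])
    show "\<bar>incr 0 s \<omega>\<bar> \<le> \<bar>\<eta>\<bar> * T + majorant start T \<omega>"
    proof (cases "s \<le> 0")
      case True
      then show ?thesis using d0 T by (simp add: incr_def step_def start_def)
    next
      case False
      have "\<bar>incr 0 s \<omega>\<bar> = \<bar>\<eta> * s + memory_op (\<lambda>s. start s \<omega>) \<omega> s\<bar>"
        using False by (simp add: incr_def step_def start_def)
      also have "\<dots> \<le> \<bar>\<eta>\<bar> * \<bar>s\<bar> + \<bar>memory_op (\<lambda>s. start s \<omega>) \<omega> s\<bar>"
        using abs_triangle_ineq[of "\<eta> * s"] by (simp add: abs_mult)
      also have "\<bar>\<eta>\<bar> * \<bar>s\<bar> \<le> \<bar>\<eta>\<bar> * T" using s False by (intro mult_left_mono) auto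
      also have "\<bar>memory_op (\<lambda>s. start s \<omega>) \<omega> s\<bar> \<le> majorant start s \<omega>"
        using False by (intro memory_op_le_majorant cadlag_adapted_start \<omega>) auto
      also have "\<dots> \<le> majorant start T \<omega>" using s by (intro majorant_mono cadlag_adapted_start \<omega>) auto
      finally show ?thesis by simp
    qed
  qed (use fin majorant_meas(3)[OF cadlag_adapted_start] emeasure_space_1 in auto)
qed

text \<open>Serves existence, with the increments of the iteration, and uniqueness, with the
  constant sequence given by the difference of two solutions. The latter satisfies the domination
  only almost surely, hence the form of the hypothesis.\<close>

lemma geometric_decay:
  assumes T: "0 \<le> T" and D: "\<And>n. cadlag_adapted (D n)" and fin: "sup_norm2 M (-r) (D 0) T < \<infinity>"
    and le: "\<And>n. AE \<omega> in M. \<forall>t\<ge>-r. \<bar>D (Suc n) t \<omega>\<bar> \<le> majorant (D n) t \<omega>"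
  obtains B where "B < \<infinity>" "\<And>n. sup_norm2 M (-r) (D n) T \<le> ennreal ((1/8)^n) * B"
proof -
  obtain \<beta> where b: "0 < \<beta>" "contracting T \<beta>" using majorant_estimate by blast
  define B0 where "B0 = sup_norm2 M (-r) (D 0) T * ennreal (exp (\<beta> * r))"
  have B0: "B0 < \<infinity>" using fin by (simp add: B0_def ennreal_mult_less_top)
  have main: "sup_norm2 M (-r) (D n) t \<le> (ennreal ((1/8)^n) * B0) * ennreal (exp (\<beta> * t))" if "t \<in> {-r..T}" for n t
    using that
  proof (induction n arbitrary: t)
    case 0
    then show ?case using sup_norm2_exp[OF _ b(1), of t T "D 0"] by (simp add: B0_def)
  next
    case (Suc n)
    have "sup_norm2 M (-r) (D (Suc n)) t \<le> (\<integral>\<^sup>+\<omega>. ennreal ((majorant (D n) t \<omega>)\<^sup>2) \<partial>M)"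
      by (rule sup_norm2_le_majorant[OF D], use le[of n] in eventually_elim) auto
    also have "\<dots> \<le> ennreal (1/8) * ((ennreal ((1/8)^n) * B0) * ennreal (exp (\<beta> * t)))"
      by (rule contractingD[OF b(2) D Suc.prems Suc.IH])
    also have "\<dots> = (ennreal (1/8 * (1/8)^n) * B0) * ennreal (exp (\<beta> * t))"
      by (subst ennreal_mult) (auto simp: mult_ac)
    finally show ?case by simp
  qed
  show ?thesis
  proof (rule that)
    show "B0 * ennreal (exp (\<beta> * T)) < \<infinity>" using B0 by (simp add: ennreal_mult_less_top)
    show "sup_norm2 M (-r) (D n) T \<le> ennreal ((1/8)^n) * (B0 * ennreal (exp (\<beta> * T)))" for n
      using main[of T n] T r0 by (simp add: mult.assoc)
  qed
qed

text \<open>Its expectation is at most a constant times the sum of 4^n 8^(-n), hence finite.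
  Finiteness at a sample point gives uniform convergence of the iterates there, and integrability
  bounds the limit in square mean.\<close>

definition incr_weight :: "real \<Rightarrow> 'a \<Rightarrow> ennreal" where
  "incr_weight T \<omega> = (\<Sum>n. ennreal (4^n * (run_sup (-r) (incr n) T \<omega>)\<^sup>2))"

lemma incr_run_sup_meas [measurable]: "-r \<le> T \<Longrightarrow> run_sup (-r) (incr n) T \<in> borel_measurable M"
  using measurable_F_M[OF cadlag_adapted_run_sup_meas[OF cadlag_adapted_incr]] by simp

lemma incr_weight_finite:
  assumes T: "0 \<le> T"
  shows "(\<integral>\<^sup>+\<omega>. incr_weight T \<omega> \<partial>M) < \<infinity>"
proof -
  obtain B where B: "B < \<infinity>" "\<And>n. sup_norm2 M (-r) (incr n) T \<le> ennreal ((1/8)^n) * B"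
  proof (rule geometric_decay[of T incr])
    show "AE \<omega> in M. \<forall>t\<ge>-r. \<bar>incr (Suc n) t \<omega>\<bar> \<le> majorant (incr n) t \<omega>" for n
      using incr_Suc_le_majorant by auto
  qed (use T cadlag_adapted_incr sup_norm2_incr_0[OF T] in auto)
  have rT: "-r \<le> T" using T r0 by simp
  note [measurable] = incr_run_sup_meas[OF rT]
  have "(\<integral>\<^sup>+\<omega>. incr_weight T \<omega> \<partial>M) = (\<Sum>n. \<integral>\<^sup>+\<omega>. ennreal (4^n * (run_sup (-r) (incr n) T \<omega>)\<^sup>2) \<partial>M)"
    unfolding incr_weight_def by (rule nn_integral_suminf) measurable
  also have "\<dots> = (\<Sum>n. ennreal (4^n) * sup_norm2 M (-r) (incr n) T)"
    unfolding cadlag_adapted_sup_norm2[OF cadlag_adapted_incr rT]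
    by (intro suminf_cong, subst nn_integral_cmult[symmetric]) (auto simp: ennreal_mult)
  also have "\<dots> \<le> (\<Sum>n. ennreal ((1/2)^n) * B)"
  proof (intro suminf_le summableI)
    fix n
    have "ennreal (4^n) * sup_norm2 M (-r) (incr n) T \<le> ennreal (4^n) * (ennreal ((1/8)^n) * B)"
      by (intro mult_left_mono B) simp
    also have "\<dots> = ennreal (4^n * (1/8)^n) * B" by (subst ennreal_mult) (auto simp: mult.assoc)
    also have "(4::real)^n * (1/8)^n = (1/2)^n" unfolding power_mult_distrib[symmetric] by simp
    finally show "ennreal (4^n) * sup_norm2 M (-r) (incr n) T \<le> ennreal ((1/2)^n) * B" .
  qed
  also have "\<dots> = (\<Sum>n. ennreal ((1/2)^n)) * B" by (rule ennreal_suminf_multc)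
  also have "(\<Sum>n. ennreal ((1/2)^n)) = ennreal (\<Sum>n. (1/2)^n)"
    by (intro suminf_ennreal2) (auto intro: summable_geometric)
  also have "ennreal (\<Sum>n. (1/2)^n) * B < \<infinity>" using B(1) by (simp add: ennreal_mult_less_top)
  finally show ?thesis .
qed

end

section \<open>Existence, uniqueness and moments\<close>

text \<open>For \<alpha> > 0 the power is continuous, also at 0. The case \<alpha> = 0 is separate
  because \<open>powr\<close> gives 0 at base 0, where \<open>abs_pow\<close> has the value
  1.\<close>

lemma abs_pow_tendsto:
  assumes "(f \<longlongrightarrow> l) G" "0 \<le> \<alpha>"
  shows "((\<lambda>x. abs_pow (f x) \<alpha>) \<longlongrightarrow> abs_pow l \<alpha>) G"
proof (cases "\<alpha> = 0")
  case False
  then show ?thesis unfolding abs_pow_def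
    using assms by (auto intro!: tendsto_powr' tendsto_rabs)
qed (simp add: abs_pow_def)

lemma abs_pow_le:
  assumes "\<alpha> \<in> {0..2}" "\<bar>x\<bar> \<le> y"
  shows "\<bar>abs_pow x \<alpha>\<bar> \<le> 1 + y\<^sup>2"
proof (cases "\<alpha> = 0")
  case False
  then have a: "0 < \<alpha>" "\<alpha> \<le> 2" using assms(1) by auto
  have "\<bar>x\<bar> powr \<alpha> \<le> 1 + x\<^sup>2"
  proof (cases "\<bar>x\<bar> \<le> 1")
    case True
    then have "\<bar>x\<bar> powr \<alpha> \<le> 1" using a by (intro powr_le1) auto
    then show ?thesis by (simp add: add_increasing2)
  next
    case False
    then have "\<bar>x\<bar> powr \<alpha> \<le> \<bar>x\<bar> powr 2" using a by (intro powr_mono) auto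
    also have "\<bar>x\<bar> powr 2 = x\<^sup>2" using False by simp
    finally show ?thesis by simp
  qed
  also have "\<dots> \<le> 1 + y\<^sup>2" using power_mono[OF assms(2), of 2] by simp
  finally show ?thesis using False by (simp add: abs_pow_def)
qed (simp add: abs_pow_def)

lemma abs_pow_measurable [measurable]: "(\<lambda>x. abs_pow x \<alpha>) \<in> borel_measurable borel"
  unfolding abs_pow_def by measurable

lemma ennreal_geometric_zero:
  assumes "\<And>n. x \<le> ennreal ((1/8)^n) * c" "c < \<infinity>"
  shows "x = 0"
proof -
  obtain c' where c: "0 \<le> c'" "c = ennreal c'" using assms(2) by (cases c) auto
  have "(\<lambda>n. (1/8)^n * c') \<longlonglongrightarrow> 0" by (intro tendsto_mult_left_zero LIMSEQ_power_zero) simp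
  then have "(\<lambda>n. ennreal ((1/8)^n * c')) \<longlonglongrightarrow> ennreal 0" by (rule tendsto_ennrealI)
  moreover have "x \<le> ennreal ((1/8)^n * c')" for n using assms(1)[of n] c by (simp add: ennreal_mult)
  ultimately have "x \<le> ennreal 0" by (intro LIMSEQ_le_const) auto
  then show ?thesis by simp
qed

context cdgarch
begin

text \<open>Integer horizons suffice, as the weights cover all earlier times, and they keep the
  almost sure statement countable.\<close>

definition increments_summable :: "'a \<Rightarrow> bool" where
  "increments_summable \<omega> \<longleftrightarrow> (\<forall>T::nat. incr_weight (real T) \<omega> \<noteq> \<infinity>)"

lemma incr_weight_meas: "0 \<le> T \<Longrightarrow> incr_weight T \<in> borel_measurable M"
proof -
  assume "0 \<le> T"
  then have "-r \<le> T" using r0 by simp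
  note [measurable] = incr_run_sup_meas[OF this]
  show ?thesis unfolding incr_weight_def by measurable
qed

lemma AE_increments_summable: "AE \<omega> in M. increments_summable \<omega>"
  unfolding increments_summable_def AE_all_countable
  using incr_weight_meas incr_weight_finite by (intro allI nn_integral_noteq_infinite) (auto simp: less_top)

lemma run_sup_incr_summable:
  assumes "increments_summable \<omega>"
  shows "summable (\<lambda>n. run_sup (-r) (incr n) (real T) \<omega>)"
    "(\<Sum>n. run_sup (-r) (incr n) (real T) \<omega>) \<le> sqrt (2 * enn2real (incr_weight (real T) \<omega>))"
proof -
  define w where "w = enn2real (incr_weight (real T) \<omega>)"
  have W: "incr_weight (real T) \<omega> = ennreal w" "0 \<le> w"
    using assms unfolding increments_summable_def w_def by (auto simp: less_top)
  have le: "(\<Sum>n<N. 4^n * (run_sup (-r) (incr n) (real T) \<omega>)\<^sup>2) \<le> w" for N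
  proof -
    have "ennreal (\<Sum>n<N. 4^n * (run_sup (-r) (incr n) (real T) \<omega>)\<^sup>2) = (\<Sum>n<N. ennreal (4^n * (run_sup (-r) (incr n) (real T) \<omega>)\<^sup>2))"
      by (rule sum_ennreal[symmetric]) simp
    also have "\<dots> \<le> incr_weight (real T) \<omega>"
      unfolding incr_weight_def by (intro sum_le_suminf summableI) auto
    finally show ?thesis using W by simp
  qed
  from weighted_square_summable[OF run_sup_nonneg le]
  show "summable (\<lambda>n. run_sup (-r) (incr n) (real T) \<omega>)"
    "(\<Sum>n. run_sup (-r) (incr n) (real T) \<omega>) \<le> sqrt (2 * enn2real (incr_weight (real T) \<omega>))"
    by (auto simp: w_def)
qed

lemma iter_eq_sum: "iter n t \<omega> = start t \<omega> + (\<Sum>k<n. incr k t \<omega>)"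
  by (induction n) (auto simp: incr_def)

text \<open>Off the event of convergence the value is \<open>start\<close>, since a strong solution
  must have cadlag paths and the prescribed initial segment at every sample point, not only almost
  surely.\<close>

definition sol :: "real \<Rightarrow> 'a \<Rightarrow> real" where
  "sol t \<omega> = (if increments_summable \<omega> then lim (\<lambda>n. iter n t \<omega>) else start t \<omega>)"

context
  fixes \<omega> assumes \<omega>: "\<omega> \<in> space M" and g2: "increments_summable \<omega>"
begin

lemma incr_bound: "t \<in> {-r..real T} \<Longrightarrow> \<bar>incr n t \<omega>\<bar> \<le> run_sup (-r) (incr n) (real T) \<omega>"
  by (rule run_sup_upper[where Z="incr n", OF cadlag_adapted_cadlag[OF cadlag_adapted_incr \<omega>]])

lemma incr_summable:
  assumes "t \<in> {-r..real T}"
  shows "summable (\<lambda>n. \<bar>incr n t \<omega>\<bar>)"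
  using incr_bound[OF assms] by (intro summable_comparison_test'[OF run_sup_incr_summable(1)[OF g2, of T]]) auto

lemma sol_eq_suminf:
  assumes t: "t \<in> {-r..real T}"
  shows "sol t \<omega> = start t \<omega> + (\<Sum>n. incr n t \<omega>)" "(\<lambda>n. iter n t \<omega>) \<longlonglongrightarrow> sol t \<omega>"
proof -
  have "(\<lambda>n. iter n t \<omega>) \<longlonglongrightarrow> start t \<omega> + (\<Sum>n. incr n t \<omega>)"
    unfolding iter_eq_sum
    by (rule tendsto_add[OF tendsto_const summable_LIMSEQ[OF summable_rabs_cancel[OF incr_summable[OF t]]]])
  moreover from this show "sol t \<omega> = start t \<omega> + (\<Sum>n. incr n t \<omega>)"
    unfolding sol_def using g2 limI by auto
  ultimately show "(\<lambda>n. iter n t \<omega>) \<longlonglongrightarrow> sol t \<omega>" by simp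
qed

lemma sol_error:
  assumes t: "t \<in> {-r..real T}"
  shows "\<bar>sol t \<omega> - iter n t \<omega>\<bar> \<le> (\<Sum>k. run_sup (-r) (incr (k + n)) (real T) \<omega>)"
proof -
  note s = incr_summable[OF t]
  have "sol t \<omega> - iter n t \<omega> = (\<Sum>k. incr (k + n) t \<omega>)"
    unfolding sol_eq_suminf(1)[OF t] iter_eq_sum
    using suminf_minus_initial_segment[OF summable_rabs_cancel[OF s], of n] by simp
  then have "\<bar>sol t \<omega> - iter n t \<omega>\<bar> = \<bar>\<Sum>k. incr (k + n) t \<omega>\<bar>" by (rule arg_cong)
  also have "\<dots> \<le> (\<Sum>k. \<bar>incr (k + n) t \<omega>\<bar>)"
    by (rule summable_rabs) (use s in \<open>simp add: summable_iff_shift[of "\<lambda>n. \<bar>incr n t \<omega>\<bar>"]\<close>)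
  also have "\<dots> \<le> (\<Sum>k. run_sup (-r) (incr (k + n)) (real T) \<omega>)"
    using s run_sup_incr_summable(1)[OF g2, of T]
    by (intro suminf_le incr_bound t)
       (simp_all add: summable_iff_shift[of "\<lambda>n. \<bar>incr n t \<omega>\<bar>"]
         summable_iff_shift[of "\<lambda>n. run_sup (-r) (incr n) (real T) \<omega>"])
  finally show ?thesis .
qed

text \<open>The error at time t is bounded by a tail of the series of running suprema, which does
  not depend on t up to the integer horizon.\<close>

lemma sol_uniform: "\<exists>e. e \<longlonglongrightarrow> 0 \<and> (\<forall>n. \<forall>t\<in>{-r..T}. \<bar>sol t \<omega> - iter n t \<omega>\<bar> \<le> e n)"
proof -
  obtain N :: nat where N: "T \<le> real N" using real_arch_simple by blast
  define e where "e n = (\<Sum>k. run_sup (-r) (incr (k + n)) (real N) \<omega>)" for n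
  have "e n = (\<Sum>k. run_sup (-r) (incr k) (real N) \<omega>) - (\<Sum>k<n. run_sup (-r) (incr k) (real N) \<omega>)" for n
    unfolding e_def by (rule suminf_minus_initial_segment[OF run_sup_incr_summable(1)[OF g2]])
  moreover have "(\<lambda>n. (\<Sum>k. run_sup (-r) (incr k) (real N) \<omega>) - (\<Sum>k<n. run_sup (-r) (incr k) (real N) \<omega>)) \<longlonglongrightarrow> 0"
    using tendsto_diff[OF tendsto_const summable_LIMSEQ[OF run_sup_incr_summable(1)[OF g2, of N]],
        of "\<Sum>k. run_sup (-r) (incr k) (real N) \<omega>"] by simp
  ultimately have "e \<longlonglongrightarrow> 0" by (subst tendsto_cong[OF always_eventually]) auto
  moreover have "\<bar>sol t \<omega> - iter n t \<omega>\<bar> \<le> e n" if "t \<in> {-r..T}" for n t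
    unfolding e_def using that N by (intro sol_error) auto
  ultimately show ?thesis by blast
qed

lemma sol_cadlag': "cadlag_from (-r) (\<lambda>t. sol t \<omega>)"
  by (rule cadlag_from_uniform_limit[OF cadlag_adapted_cadlag[OF cadlag_adapted_iter \<omega>] sol_uniform])

text \<open>Purely pathwise: the memory operator is continuous for uniform convergence on [-r, t],
  so the recursion passes to the limit at every sample point where the increments are
  summable.\<close>

lemma sol_fixed:
  assumes t: "-r \<le> t"
  shows "sol t \<omega> = step sol t \<omega>"
proof -
  obtain N :: nat where N: "t \<le> real N" using real_arch_simple by blast
  have lim: "(\<lambda>n. iter n t \<omega>) \<longlonglongrightarrow> sol t \<omega>" using t N by (intro sol_eq_suminf(2)) auto
  show ?thesis
  proof (cases "t \<le> 0")
    case True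
    then have "iter n t \<omega> = \<Phi> t \<omega>" for n by (cases n) (auto simp: start_def step_def)
    then show ?thesis using lim True by (simp add: step_def LIMSEQ_const_iff)
  next
    case False
    obtain e where e: "e \<longlonglongrightarrow> 0" "\<And>n s. s \<in> {-r..t} \<Longrightarrow> \<bar>sol s \<omega> - iter n s \<omega>\<bar> \<le> e n"
      using sol_uniform[of t] by blast
    have z: "left_regular (-r) b (\<lambda>s. iter n s \<omega>)" for n b by (rule cadlag_adapted_left_regular[OF cadlag_adapted_iter \<omega>])
    have y: "left_regular (-r) b (\<lambda>s. sol s \<omega>)" for b by (rule cadlag_from_left_regular[OF sol_cadlag'])
    \<comment> \<open>The constant function e n integrates exactly to e n times the increment of the
      clock, so C is the norm of the memory operator obtained from
      \<open>memory_op_bound\<close>.\<close>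
    define C where "C = K1 * (t - (-r)) + K2 * (qclock \<omega> t - qclock \<omega> (-r))"
    have "(\<lambda>n. memory_op (\<lambda>s. iter n s \<omega>) \<omega> t - memory_op (\<lambda>s. sol s \<omega>) \<omega> t) \<longlonglongrightarrow> 0"
    proof (rule Lim_null_comparison)
      show "(\<lambda>n. e n * C) \<longlonglongrightarrow> 0" using tendsto_mult_left_zero[OF e(1)] .
      have "\<bar>memory_op (\<lambda>s. iter n s \<omega>) \<omega> t - memory_op (\<lambda>s. sol s \<omega>) \<omega> t\<bar> \<le> e n * C" for n
      proof -
        have "\<bar>memory_op (\<lambda>s. iter n s \<omega> - sol s \<omega>) \<omega> t\<bar> \<le> K1 * sint (\<lambda>x. x) (\<lambda>_. e n) (-r) t + K2 * sint (qclock \<omega>) (\<lambda>_. e n) (-r) t"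
          using False e(2) by (intro memory_op_bound left_regular_diff z y left_regular_const) (auto simp: abs_minus_commute)
        also have "\<dots> = e n * C"
          using t by (simp add: stieltjes_id.sint_const stieltjes.sint_const[OF qclock_stieltjes] C_def algebra_simps)
        finally show ?thesis using memory_op_diff[OF z y] False by simp
      qed
      then show "eventually (\<lambda>n. norm (memory_op (\<lambda>s. iter n s \<omega>) \<omega> t - memory_op (\<lambda>s. sol s \<omega>) \<omega> t) \<le> e n * C) sequentially"
        by simp
    qed
    then have "(\<lambda>n. memory_op (\<lambda>s. iter n s \<omega>) \<omega> t) \<longlonglongrightarrow> memory_op (\<lambda>s. sol s \<omega>) \<omega> t" by (rule LIM_zero_cancel)
    then have "(\<lambda>n. \<Phi> 0 \<omega> + (\<eta> * t + memory_op (\<lambda>s. iter n s \<omega>) \<omega> t)) \<longlonglongrightarrow> \<Phi> 0 \<omega> + (\<eta> * t + memory_op (\<lambda>s. sol s \<omega>) \<omega> t)"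
      by (rule tendsto_add[OF tendsto_const tendsto_add[OF tendsto_const]])
    then have "(\<lambda>n. iter (Suc n) t \<omega>) \<longlonglongrightarrow> step sol t \<omega>" using False by (simp add: step_def)
    moreover have "(\<lambda>n. iter (Suc n) t \<omega>) \<longlonglongrightarrow> sol t \<omega>" using lim by (rule LIMSEQ_Suc)
    ultimately show ?thesis by (rule LIMSEQ_unique[rotated])
  qed
qed

end

lemma sol_cadlag:
  assumes "\<omega> \<in> space M"
  shows "cadlag_from (-r) (\<lambda>t. sol t \<omega>)"
proof (cases "increments_summable \<omega>")
  case True
  then show ?thesis using sol_cadlag'[OF assms] by simp
next
  case False
  then have "(\<lambda>t. sol t \<omega>) = (\<lambda>t. start t \<omega>)" by (auto simp: sol_def)
  then show ?thesis using cadlag_adapted_cadlag[OF cadlag_adapted_start assms] by simp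
qed

lemma sol_initial: "\<omega> \<in> space M \<Longrightarrow> t \<in> {-r..0} \<Longrightarrow> sol t \<omega> = \<Phi> t \<omega>"
  using sol_fixed[of \<omega> t] by (cases "increments_summable \<omega>") (auto simp: step_def sol_def start_def)

lemma cadlag_adapted_sol: "cadlag_adapted sol"
  unfolding cadlag_adapted_def adapted_from_def
proof (intro conjI ballI allI impI sol_cadlag)
  fix t assume t: "-r \<le> t"
  have sp: "space (F t) = space M" by (rule space_F[OF t])
  obtain N :: nat where N: "t \<le> real N" using real_arch_simple by blast
  show "sol t \<in> borel_measurable (F t)"
  proof (rule borel_measurable_LIMSEQ_real)
    show "(\<lambda>n. if increments_summable \<omega> then iter n t \<omega> else start t \<omega>) \<longlonglongrightarrow> sol t \<omega>" if "\<omega> \<in> space (F t)" for \<omega>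
      using sol_eq_suminf(2)[of \<omega> t N] that sp t N by (auto simp: sol_def)
    show "(\<lambda>\<omega>. if increments_summable \<omega> then iter n t \<omega> else start t \<omega>) \<in> borel_measurable (F t)" for n
      using AE_sets_F[OF AE_increments_summable t] t sp
      by (intro measurable_If cadlag_adapted_meas[OF cadlag_adapted_iter] cadlag_adapted_meas[OF cadlag_adapted_start]) auto
  qed
qed

lemma cadlag_adapted_run_sup_meas_M: "cadlag_adapted Z \<Longrightarrow> -r \<le> t \<Longrightarrow> run_sup (-r) Z t \<in> borel_measurable M"
  using measurable_F_M[OF cadlag_adapted_run_sup_meas] by blast

text \<open>The solution is dominated by the running supremum of \<open>start\<close> plus the sum
  of all increments. The latter is at most the root of 2 \<open>incr_weight\<close>, whose square
  has finite expectation.\<close>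

lemma sol_finite: "sup_norm2 M (-r) sol t < \<infinity>"
proof -
  obtain N :: nat where N: "t \<le> real N" using real_arch_simple by blast
  let ?W = "incr_weight (real N)"
  have rN: "-r \<le> real N" using r0 by simp
  have "sup_norm2 M (-r) sol (real N) < \<infinity>"
  proof (rule sup_norm2_add_finite[where X="run_sup (-r) start (real N)" and Y="\<lambda>\<omega>. sqrt (2 * enn2real (?W \<omega>))"])
    fix s \<omega> assume \<omega>: "\<omega> \<in> space M" and s: "s \<in> {-r..real N}"
    have st: "\<bar>start s \<omega>\<bar> \<le> run_sup (-r) start (real N) \<omega>"
      by (rule run_sup_upper[where Z=start, OF cadlag_adapted_cadlag[OF cadlag_adapted_start \<omega>] s])
    show "\<bar>sol s \<omega>\<bar> \<le> run_sup (-r) start (real N) \<omega> + sqrt (2 * enn2real (?W \<omega>))"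
    proof (cases "increments_summable \<omega>")
      case True
      have "\<bar>sol s \<omega> - iter 0 s \<omega>\<bar> \<le> sqrt (2 * enn2real (?W \<omega>))"
        using sol_error[OF \<omega> True s, of 0] run_sup_incr_summable(2)[OF True, of N] by simp
      then show ?thesis using st by simp
    next
      case False
      then have "\<bar>sol s \<omega>\<bar> \<le> run_sup (-r) start (real N) \<omega>" using st by (simp add: sol_def)
      moreover have "0 \<le> sqrt (2 * enn2real (?W \<omega>))" by simp
      ultimately show ?thesis by linarith
    qed
  next
    show "run_sup (-r) start (real N) \<in> borel_measurable M" by (rule cadlag_adapted_run_sup_meas_M[OF cadlag_adapted_start rN])
    note [measurable] = incr_weight_meas[of "real N", simplified]
    show "(\<lambda>\<omega>. sqrt (2 * enn2real (?W \<omega>))) \<in> borel_measurable M" by measurable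
    show "(\<integral>\<^sup>+\<omega>. ennreal ((run_sup (-r) start (real N) \<omega>)\<^sup>2) \<partial>M) < \<infinity>"
      using sup_norm2_start[of "real N"] cadlag_adapted_sup_norm2[OF cadlag_adapted_start rN] by simp
    have "(\<integral>\<^sup>+\<omega>. ennreal ((sqrt (2 * enn2real (?W \<omega>)))\<^sup>2) \<partial>M) \<le> (\<integral>\<^sup>+\<omega>. 2 * ?W \<omega> \<partial>M)"
    proof (intro nn_integral_mono)
      fix \<omega>
      have "ennreal ((sqrt (2 * enn2real (?W \<omega>)))\<^sup>2) = 2 * ennreal (enn2real (?W \<omega>))"
        by (simp add: ennreal_mult)
      also have "\<dots> \<le> 2 * ?W \<omega>" by (intro mult_left_mono) (auto simp: ennreal_enn2real_if)
      finally show "ennreal ((sqrt (2 * enn2real (?W \<omega>)))\<^sup>2) \<le> 2 * ?W \<omega>" .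
    qed
    also have "\<dots> = 2 * (\<integral>\<^sup>+\<omega>. ?W \<omega> \<partial>M)" by (rule nn_integral_cmult) measurable
    also have "\<dots> < \<infinity>" using incr_weight_finite[of "real N"] by (simp add: ennreal_mult_less_top)
    finally show "(\<integral>\<^sup>+\<omega>. ennreal ((sqrt (2 * enn2real (?W \<omega>)))\<^sup>2) \<partial>M) < \<infinity>" .
  qed
  then show ?thesis using sup_norm2_mono[OF N] by (rule le_less_trans[rotated])
qed

text \<open>Where the jumps are summable, \<open>qclock\<close> is S; the ds-integrals over closed
  intervals agree with the left-limit form up to a Lebesgue null set.\<close>

lemma step_eq_variance_equation:
  assumes X: "cadlag_from (-r) (\<lambda>t. X t \<omega>)" and g: "jumps_summable \<omega>" and t: "0 < t"
  shows "step X t \<omega> = \<Phi> 0 \<omega> + \<eta> * t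
            + (LINT u:{- p..0}|lborel. f\<^sub>\<mu> u * (LINT s:{u..t + u}|lborel. X s \<omega>))
            - c\<^sub>\<mu> * (LINT s:{0..t}|lborel. X s \<omega>)
            + (LINT u:{- q..0}|lborel. f\<^sub>\<nu> u *
                 (LINT s:{u<..t + u}|interval_measure (qv_path M (-r) L \<omega>). left_lim (\<lambda>v. X v \<omega>) s))
            + c\<^sub>\<nu> * (LINT s:{0<..t}|interval_measure (qv_path M (-r) L \<omega>). left_lim (\<lambda>v. X v \<omega>) s)"
proof -
  have l: "(LINT s:{u..v}|lborel. X s \<omega>) = sint (\<lambda>x. x) (\<lambda>s. X s \<omega>) u v" if "-r \<le> u" for u v
    by (rule lborel_integral_eq_sint[OF cadlag_from_imp_on[OF X that]])
  have "(LINT u:{- p..0}|lborel. f\<^sub>\<mu> u * (LINT s:{u..t + u}|lborel. X s \<omega>)) =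
     (LINT u:{- p..0}|lborel. f\<^sub>\<mu> u * sint (\<lambda>x. x) (\<lambda>s. X s \<omega>) u (t + u))"
    by (rule set_lebesgue_integral_cong) (use pq l in auto)
  moreover have "(LINT s:{0..t}|lborel. X s \<omega>) = sint (\<lambda>x. x) (\<lambda>s. X s \<omega>) 0 t" using l r0 by simp
  moreover have "qclock \<omega> = qv_path M (-r) L \<omega>" using g by (simp add: qclock_def)
  ultimately show ?thesis using t by (simp add: step_def memory_op_def delay_op_def sint_def)
qed

lemma sol_is_strong_solution:
  assumes r: "r = max p q"
  shows "cdgarch_strong_solution M F L p q \<eta> c\<^sub>\<mu> c\<^sub>\<nu> f\<^sub>\<mu> f\<^sub>\<nu> \<Phi> sol"
  unfolding cdgarch_strong_solution_def Let_def r[symmetric]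
proof (intro conjI)
  show "\<forall>\<omega>\<in>space M. cadlag_from (-r) (\<lambda>t. sol t \<omega>)" using sol_cadlag by blast
  show "\<forall>t\<ge>-r. sup_norm2 M (-r) sol t < \<infinity>" using sol_finite by blast
  show "adapted_from (-r) F sol" using cadlag_adapted_sol unfolding cadlag_adapted_def by blast
  show "\<forall>\<omega>\<in>space M. \<forall>t\<in>{-r..0}. sol t \<omega> = \<Phi> t \<omega>" using sol_initial by blast
  show "AE \<omega> in M. \<forall>t>0. sol t \<omega> = \<Phi> 0 \<omega> + \<eta> * t
            + (LINT u:{- p..0}|lborel. f\<^sub>\<mu> u * (LINT s:{u..t + u}|lborel. sol s \<omega>))
            - c\<^sub>\<mu> * (LINT s:{0..t}|lborel. sol s \<omega>)
            + (LINT u:{- q..0}|lborel. f\<^sub>\<nu> u *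
                 (LINT s:{u<..t + u}|interval_measure (qv_path M (-r) L \<omega>). left_lim (\<lambda>v. sol v \<omega>) s))
            + c\<^sub>\<nu> * (LINT s:{0<..t}|interval_measure (qv_path M (-r) L \<omega>). left_lim (\<lambda>v. sol v \<omega>) s)"
    using AE_jumps_summable AE_increments_summable AE_space
  proof eventually_elim
    case (elim \<omega>)
    have "sol t \<omega> = step sol t \<omega>" if "0 < t" for t using sol_fixed[OF elim(3,2)] that r0 by simp
    then show ?case
      using step_eq_variance_equation[where X=sol, OF sol_cadlag[OF elim(3)] elim(1)] by simp
  qed
qed

lemma strong_solution_unique:
  assumes r: "r = max p q" and Y: "cdgarch_strong_solution M F L p q \<eta> c\<^sub>\<mu> c\<^sub>\<nu> f\<^sub>\<mu> f\<^sub>\<nu> \<Phi> Y"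
  shows "AE \<omega> in M. \<forall>t\<ge>-r. Y t \<omega> = sol t \<omega>"
proof -
  note Y' = Y[unfolded cdgarch_strong_solution_def Let_def r[symmetric]]
  have pY: "cadlag_adapted Y" using Y' unfolding cadlag_adapted_def by blast
  have Yc: "\<And>\<omega>. \<omega> \<in> space M \<Longrightarrow> cadlag_from (-r) (\<lambda>t. Y t \<omega>)" using cadlag_adapted_cadlag[OF pY] .
  define D where "D = (\<lambda>t \<omega>. Y t \<omega> - sol t \<omega>)"
  have pD: "cadlag_adapted D" unfolding D_def by (rule cadlag_adapted_diff[OF pY cadlag_adapted_sol])
  have "AE \<omega> in M. \<forall>t\<ge>-r. Y t \<omega> = step Y t \<omega>"
    \<comment> \<open>The fifth conjunct of the notion of strong solution, the almost sure
      equation.\<close>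
    using conjunct2[OF conjunct2[OF conjunct2[OF conjunct2[OF Y']]]] AE_jumps_summable AE_space
  proof eventually_elim
    case (elim \<omega>)
    show ?case
    proof (intro allI impI)
      fix t assume t: "-r \<le> t"
      show "Y t \<omega> = step Y t \<omega>"
      proof (cases "t \<le> 0")
        case True
        then show ?thesis using Y' elim(3) t by (simp add: step_def)
      next
        case False
        then have "0 < t" by simp
        then show ?thesis
          unfolding step_eq_variance_equation[where X=Y, OF Yc[OF elim(3)] elim(2) \<open>0 < t\<close>] using elim(1) by blast
      qed
    qed
  qed
  then have majorant: "AE \<omega> in M. \<forall>t\<ge>-r. \<bar>D t \<omega>\<bar> \<le> majorant D t \<omega>"
    using AE_increments_summable AE_space
  proof eventually_elim
    case (elim \<omega>)
    show ?case
    proof (intro allI impI)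
      fix t assume t: "-r \<le> t"
      have "D t \<omega> = step Y t \<omega> - step sol t \<omega>"
        using elim(1) t sol_fixed[OF elim(3,2) t] unfolding D_def by simp
      then show "\<bar>D t \<omega>\<bar> \<le> majorant D t \<omega>"
        using step_diff_le_majorant[OF pY cadlag_adapted_sol elim(3), of t] unfolding D_def by simp
    qed
  qed
  have "AE \<omega> in M. \<forall>T::nat. run_sup (-r) D (real T) \<omega> = 0"
    unfolding AE_all_countable
  proof
    fix N :: nat
    define T where "T = real N"
    have T: "-r \<le> T" "T \<in> {-r..T}" using r0 by (auto simp: T_def)
    have fin: "sup_norm2 M (-r) D T < \<infinity>"
    proof (rule sup_norm2_add_finite[where X="run_sup (-r) Y T" and Y="run_sup (-r) sol T"])
      fix s \<omega> assume \<omega>: "\<omega> \<in> space M" and s: "s \<in> {-r..T}"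
      show "\<bar>D s \<omega>\<bar> \<le> run_sup (-r) Y T \<omega> + run_sup (-r) sol T \<omega>"
        using run_sup_upper[where Z=Y, OF Yc[OF \<omega>] s] run_sup_upper[where Z=sol, OF sol_cadlag[OF \<omega>] s]
        unfolding D_def by linarith
    next
      show "run_sup (-r) Y T \<in> borel_measurable M" "run_sup (-r) sol T \<in> borel_measurable M"
        using cadlag_adapted_run_sup_meas_M T pY cadlag_adapted_sol by auto
      show "(\<integral>\<^sup>+\<omega>. ennreal ((run_sup (-r) Y T \<omega>)\<^sup>2) \<partial>M) < \<infinity>"
        using Y' T cadlag_adapted_sup_norm2[OF pY T(1)] by auto
      show "(\<integral>\<^sup>+\<omega>. ennreal ((run_sup (-r) sol T \<omega>)\<^sup>2) \<partial>M) < \<infinity>"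
        using sol_finite[of T] cadlag_adapted_sup_norm2[OF cadlag_adapted_sol T(1)] by auto
    qed
    \<comment> \<open>The constant sequence D is dominated by its own majorant, so one and the same
      norm lies below a geometric sequence tending to 0.\<close>
    obtain B where "B < \<infinity>" "\<And>n::nat. sup_norm2 M (-r) D T \<le> ennreal ((1/8)^n) * B"
      using geometric_decay[of T "\<lambda>_. D"] pD fin majorant by (metis T_def of_nat_0_le_iff)
    then have "sup_norm2 M (-r) D T = 0" by (intro ennreal_geometric_zero)
    then have "(\<integral>\<^sup>+\<omega>. ennreal ((run_sup (-r) D T \<omega>)\<^sup>2) \<partial>M) = 0" using cadlag_adapted_sup_norm2[OF pD T(1)] by simp
    moreover have [measurable]: "run_sup (-r) D T \<in> borel_measurable M" by (rule cadlag_adapted_run_sup_meas_M[OF pD T(1)])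
    ultimately have "AE \<omega> in M. ennreal ((run_sup (-r) D T \<omega>)\<^sup>2) = 0"
      by (subst (asm) nn_integral_0_iff_AE) auto
    then show "AE \<omega> in M. run_sup (-r) D (real N) \<omega> = 0"
      unfolding T_def[symmetric] by eventually_elim simp
  qed
  then show ?thesis
    using AE_space
  proof eventually_elim
    case (elim \<omega>)
    show ?case
    proof (intro allI impI)
      fix t assume t: "-r \<le> t"
      obtain N :: nat where "t \<le> real N" using real_arch_simple by blast
      then have "\<bar>D t \<omega>\<bar> \<le> 0"
        using run_sup_upper[where Z=D, OF cadlag_adapted_cadlag[OF pD elim(2)], of t "real N"] elim(1) t by auto
      then show "Y t \<omega> = sol t \<omega>" by (simp add: D_def)
    qed
  qed
qed

text \<open>The bound 1 + (running supremum)^2 dominates all powers with \<alpha> in [0, 2] up to a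
  given time, and it is integrable by the finiteness of the norm. The left limit of a moment is the
  moment of the left limits.\<close>

lemma moments_cadlag:
  assumes X: "cadlag_adapted X" and fin: "\<And>t. sup_norm2 M (-r) X t < \<infinity>" and \<alpha>: "\<alpha> \<in> {0..2}"
  shows "-r \<le> t \<Longrightarrow> integrable M (\<lambda>\<omega>. abs_pow (X t \<omega>) \<alpha>)"
    and "cadlag_from (-r) (\<lambda>t. \<integral>\<omega>. abs_pow (X t \<omega>) \<alpha> \<partial>M)"
proof -
  have XM: "X t \<in> borel_measurable M" if "-r \<le> t" for t using measurable_F_M[OF cadlag_adapted_meas[OF X that order_refl] that] .
  have w: "integrable M (\<lambda>\<omega>. 1 + (run_sup (-r) X T \<omega>)\<^sup>2)" if T: "-r \<le> T" for T
  proof -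
    have [measurable]: "run_sup (-r) X T \<in> borel_measurable M" by (rule cadlag_adapted_run_sup_meas_M[OF X T])
    have "integrable M (\<lambda>\<omega>. (run_sup (-r) X T \<omega>)\<^sup>2)"
      using fin[of T] cadlag_adapted_sup_norm2[OF X T] by (intro integrableI_nonneg) auto
    then show ?thesis by simp
  qed
  have bd: "\<bar>abs_pow (X t \<omega>) \<alpha>\<bar> \<le> 1 + (run_sup (-r) X T \<omega>)\<^sup>2" if "\<omega> \<in> space M" "t \<in> {-r..T}" for t T \<omega>
    by (intro abs_pow_le[OF \<alpha>] run_sup_upper cadlag_adapted_cadlag[OF X] that)
  have meas: "(\<lambda>\<omega>. abs_pow (X t \<omega>) \<alpha>) \<in> borel_measurable M" if "-r \<le> t" for t
    using measurable_compose[OF XM[OF that] abs_pow_measurable] .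
  show "integrable M (\<lambda>\<omega>. abs_pow (X t \<omega>) \<alpha>)" if t: "-r \<le> t" for t
    using bd[of _ t t] t by (intro Bochner_Integration.integrable_bound[OF w[OF t] meas[OF t]]) (auto simp: add_nonneg_nonneg)
  \<comment> \<open>Stated for an arbitrary pathwise limit x, so that it covers X at t from the
    right and the left limit at t from the left.\<close>
  have conv: "(\<lambda>n. \<integral>\<omega>. abs_pow (X (S n) \<omega>) \<alpha> \<partial>M) \<longlonglongrightarrow> (\<integral>\<omega>. abs_pow (x \<omega>) \<alpha> \<partial>M)"
    if S: "\<And>n. S n \<in> {-r..T}" "-r \<le> T" and lim: "\<And>\<omega>. \<omega> \<in> space M \<Longrightarrow> (\<lambda>n. X (S n) \<omega>) \<longlonglongrightarrow> x \<omega>" for S T x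
  proof (rule integral_dominated_convergence[OF _ _ w[OF S(2)]])
    have x: "x \<in> borel_measurable M"
      by (rule borel_measurable_LIMSEQ_real[OF lim XM]) (use S in auto)
    show "(\<lambda>\<omega>. abs_pow (x \<omega>) \<alpha>) \<in> borel_measurable M" by (rule measurable_compose[OF x abs_pow_measurable])
    show "(\<lambda>\<omega>. abs_pow (X (S n) \<omega>) \<alpha>) \<in> borel_measurable M" for n using S(1)[of n] by (intro meas) auto
    show "AE \<omega> in M. (\<lambda>n. abs_pow (X (S n) \<omega>) \<alpha>) \<longlonglongrightarrow> abs_pow (x \<omega>) \<alpha>"
      using lim \<alpha> by (intro AE_I2 abs_pow_tendsto) auto
    show "AE \<omega> in M. norm (abs_pow (X (S n) \<omega>) \<alpha>) \<le> 1 + (run_sup (-r) X T \<omega>)\<^sup>2" for n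
      using bd[OF _ S(1)] by (intro AE_I2) simp
  qed
  have "((\<lambda>t. \<integral>\<omega>. abs_pow (X t \<omega>) \<alpha> \<partial>M) \<longlongrightarrow> (\<integral>\<omega>. abs_pow (X t \<omega>) \<alpha> \<partial>M)) (at_right t)" if t: "-r \<le> t" for t
  proof (rule tendsto_at_right_sequentially[of t "t+1"])
    fix S assume S: "\<And>n. t < S n" "\<And>n. S n < t + 1" "S \<longlonglongrightarrow> t"
    have f: "filterlim S (at_right t) sequentially"
      using S by (intro tendsto_imp_filterlim_at_right) auto
    show "(\<lambda>n. \<integral>\<omega>. abs_pow (X (S n) \<omega>) \<alpha> \<partial>M) \<longlonglongrightarrow> (\<integral>\<omega>. abs_pow (X t \<omega>) \<alpha> \<partial>M)"
    proof (rule conv[of _ "t+1"])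
      show "S n \<in> {-r..t+1}" for n using S(1)[of n] S(2)[of n] t by auto
      fix \<omega> assume "\<omega> \<in> space M"
      then have "((\<lambda>s. X s \<omega>) \<longlongrightarrow> X t \<omega>) (at_right t)"
        using cadlag_adapted_cadlag[OF X] t unfolding cadlag_from_def continuous_within by blast
      then show "(\<lambda>n. X (S n) \<omega>) \<longlonglongrightarrow> X t \<omega>" by (rule filterlim_compose[OF _ f])
    qed (use t in auto)
  qed simp
  moreover have "\<exists>l. ((\<lambda>t. \<integral>\<omega>. abs_pow (X t \<omega>) \<alpha> \<partial>M) \<longlongrightarrow> l) (at_left t)" if t: "-r < t" for t
  proof
    show "((\<lambda>t. \<integral>\<omega>. abs_pow (X t \<omega>) \<alpha> \<partial>M) \<longlongrightarrow> (\<integral>\<omega>. abs_pow (left_lim (\<lambda>s. X s \<omega>) t) \<alpha> \<partial>M)) (at_left t)"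
    proof (rule tendsto_at_left_sequentially[OF t])
      fix S assume S: "\<And>n. S n < t" "\<And>n. -r < S n" "S \<longlonglongrightarrow> t"
      have f: "filterlim S (at_left t) sequentially"
        using S by (intro tendsto_imp_filterlim_at_left) auto
      show "(\<lambda>n. \<integral>\<omega>. abs_pow (X (S n) \<omega>) \<alpha> \<partial>M) \<longlonglongrightarrow> (\<integral>\<omega>. abs_pow (left_lim (\<lambda>s. X s \<omega>) t) \<alpha> \<partial>M)"
      proof (rule conv[of _ t])
        show "S n \<in> {-r..t}" for n using S(1)[of n] S(2)[of n] t by auto
        fix \<omega> assume \<omega>: "\<omega> \<in> space M"
        have "((\<lambda>s. X s \<omega>) \<longlongrightarrow> left_lim (\<lambda>s. X s \<omega>) t) (at_left t)"
          using t by (intro left_regular_left_lim[OF cadlag_adapted_left_regular[OF X \<omega>, of t]]) auto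
        then show "(\<lambda>n. X (S n) \<omega>) \<longlonglongrightarrow> left_lim (\<lambda>s. X s \<omega>) t" by (rule filterlim_compose[OF _ f])
      qed (use t in auto)
    qed
  qed
  ultimately show "cadlag_from (-r) (\<lambda>t. \<integral>\<omega>. abs_pow (X t \<omega>) \<alpha> \<partial>M)"
    unfolding cadlag_from_def continuous_within by blast
qed

end

theorem theorem4p4:
  fixes M :: "'a measure" and F :: "real \<Rightarrow> 'a measure" and L :: "real \<Rightarrow> 'a \<Rightarrow> real"
    and p q \<eta> c\<^sub>\<mu> c\<^sub>\<nu> :: real and f\<^sub>\<mu> f\<^sub>\<nu> :: "real \<Rightarrow> real"
    and \<Phi> :: "real \<Rightarrow> 'a \<Rightarrow> real"
  assumes "prob_space M"
    and "p \<ge> 0" and "q \<ge> 0" and "max p q > 0"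
    and "usual_filtration M (- max p q) F"
    and "levy_process_from M (- max p q) F L"
    and "\<forall>t\<ge>- max p q. integrable M (\<lambda>\<omega>. (L t \<omega>)\<^sup>2) \<and> (\<integral>\<omega>. L t \<omega> \<partial>M) = 0"
    and "\<eta> > 0" and "c\<^sub>\<mu> > 0" and "c\<^sub>\<nu> > 0"
    and "continuous_on {- p..0} f\<^sub>\<mu>" and "\<forall>u\<in>{- p..0}. f\<^sub>\<mu> u \<ge> 0"
    and "continuous_on {- q..0} f\<^sub>\<nu>" and "\<forall>u\<in>{- q..0}. f\<^sub>\<nu> u \<ge> 0"
    and "\<forall>\<omega>\<in>space M. cadlag_on (- max p q) 0 (\<lambda>t. \<Phi> t \<omega>)"
    and "\<forall>t\<in>{- max p q..0}. \<Phi> t \<in> borel_measurable (natural_filtration M (- max p q) L t)"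
    and "sup_norm2 M (- max p q) \<Phi> 0 < \<infinity>"
    and "integrable M (\<lambda>\<omega>. (L 1 \<omega>) ^ 4)"
  shows "\<exists>X. cdgarch_strong_solution M F L p q \<eta> c\<^sub>\<mu> c\<^sub>\<nu> f\<^sub>\<mu> f\<^sub>\<nu> \<Phi> X \<and>
             (\<forall>Y. cdgarch_strong_solution M F L p q \<eta> c\<^sub>\<mu> c\<^sub>\<nu> f\<^sub>\<mu> f\<^sub>\<nu> \<Phi> Y \<longrightarrow>
                  (AE \<omega> in M. \<forall>t\<ge>- max p q. Y t \<omega> = X t \<omega>)) \<and>
             (\<forall>\<alpha>\<in>{0..2}.
                (\<forall>t\<ge>- max p q. integrable M (\<lambda>\<omega>. abs_pow (X t \<omega>) \<alpha>)) \<and>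
                cadlag_from (- max p q) (\<lambda>t. \<integral>\<omega>. abs_pow (X t \<omega>) \<alpha> \<partial>M))"
proof -
  interpret prob_space M by fact
  interpret levy_fourth_moment M "- max p q" F L 1
    by unfold_locales (use assms in auto)
  \<comment> \<open>The generators of the natural filtration at time t are preimages under L s with
    s up to t. They belong to F t because L is adapted, so the natural filtration is contained in
    F.\<close>
  have adapted: "\<Phi> t \<in> borel_measurable (F t)" if t: "t \<in> {- max p q..0}" for t
  proof -
    let ?N = "natural_filtration M (- max p q) L t"
    let ?G = "\<Union>s\<in>{- max p q..t}. {L s -` B \<inter> space M | B. B \<in> sets (borel :: real measure)}"
    have tF: "- max p q \<le> t" using t by simp
    have "?G \<subseteq> sets (F t)"
    proof safe
      fix s and B :: "real set" assume s: "s \<in> {- max p q..t}" "B \<in> sets borel"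
      then show "L s -` B \<inter> space M \<in> sets (F t)"
        using measurable_sets[OF L_meas[of s t] s(2)] space_F[OF tF] by simp
    qed
    then have "sigma_sets (space M) ?G \<subseteq> sets (F t)"
      using sets.sigma_sets_subset[of ?G "F t"] space_F[OF tF] by simp
    moreover have "sets ?N = sigma_sets (space M) ?G" "space ?N = space M"
      unfolding natural_filtration_def by (auto intro!: sets_measure_of space_measure_of)
    ultimately show ?thesis
      using measurable_mono[of "borel :: real measure" borel ?N "F t"] space_F[OF tF] assms(16) t by auto
  qed
  interpret cdgarch M "max p q" F L 1 p q \<eta> c\<^sub>\<mu> c\<^sub>\<nu> f\<^sub>\<mu> f\<^sub>\<nu> \<Phi>
    by unfold_locales (use assms adapted in auto)
  show ?thesis
    using sol_is_strong_solution[OF refl] strong_solution_unique[OF refl] moments_cadlag[OF cadlag_adapted_sol sol_finite]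
    by blast
qed

end
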